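(* Let $\mathcal{E}$ and $\mathcal{E}_*$ be Hilbert spaces and let $\Theta:F^2_m\otimes\mathcal{E}\to F^2_m\otimes\mathcal{E}_*$ be a multi-analytic operator such that $\ker\Theta=\{0\}$ and $\operatorname{ran}\Theta$ is closed. Then the quotient $\mathcal{H}_\Theta=(F^2_m\otimes\mathcal{E}_* )/\operatorname{ran}\Theta$ is similar to $F^2_m\otimes\mathcal{F}$ for some Hilbert space $\mathcal{F}$ if and only if $\Theta\Psi\Theta=\Theta$ for some multi-analytic operator $\Psi:F^2_m\otimes\mathcal{E}_*\to F^2_m\otimes\mathcal{E}$.
   Context: $F^2_m=\bigoplus_{k\ge0}(\mathbb{C}^m)^{\otimes k}$ is the full Fock space, $(\mathbb{C}^m)^{\otimes0}=\mathbb{C}$, with left creation operators $S_if=e_i\otimes f$, where $e_1,\dots,e_m$ is the standard basis of $\mathbb{C}^m$. For a Hilbert space $\mathcal{E}$, $F^2_m\otimes\mathcal{E}$ is a Hilbert module over the algebra $\mathbb{F}[Z_1,\dots,Z_m]$ of complex polynomials in $m$ noncommuting variables, with $Z_i$ acting as $S_i\otimes I_{\mathcal{E}}$. A multi-analytic operator is a bounded operator $\Theta:F^2_m\otimes\mathcal{E}\to F^2_m\otimes\mathcal{E}_*$ with $\Theta(S_i\otimes I_{\mathcal{E}})=(S_i\otimes I_{\mathcal{E}_*})\Theta$ for $i=1,\dots,m$. The quotient by a closed invariant subspace carries the quotient Hilbert space norm and the induced module action. Two Hilbert modules are similar if there is a bounded linear operator with bounded inverse between them that commutes with the actions of $Z_1,\dots,Z_m$.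 *)

theory Defs
  imports "HOL-Analysis.Analysis" "HOL-Algebra.AbelCoset" "HOL-Algebra.Module"
begin

section \<open>Complex Hilbert spaces with explicit carriers\<close>

definition complex_field :: "complex ring" where
  "complex_field = \<lparr>carrier = UNIV, monoid.mult = (*), monoid.one = 1, ring.zero = 0, add = (+)\<rparr>"

text \<open>
  The vector space structure is that of a \<open>module\<close> record over \<^const>\<open>complex_field\<close>.  That record
  extends \<open>ring\<close>; as in HOL-Algebra, the fields \<open>mult\<close> and \<open>one\<close> of a module carry no meaning.
  Inner products are linear in the first argument.
\<close>

record 'a hilbert = "(complex, 'a) module" +
  ip :: "'a \<Rightarrow> 'a \<Rightarrow> complex"

definition hnorm :: "('a, 'z) hilbert_scheme \<Rightarrow> 'a \<Rightarrow> real" where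
  "hnorm H x = sqrt (Re (ip H x x))"

text \<open>
  \<^locale>\<open>Metric_space\<close> asks for a nonnegative symmetric function on the whole type; hence the
  value 0 outside the carrier.
\<close>

definition hdist :: "('a, 'z) hilbert_scheme \<Rightarrow> 'a \<Rightarrow> 'a \<Rightarrow> real" where
  "hdist H x y = (if x \<in> carrier H \<and> y \<in> carrier H then hnorm H (x \<ominus>\<^bsub>H\<^esub> y) else 0)"

locale inner_product_space = Module.module complex_field H
  for H :: "('a, 'z) hilbert_scheme" (structure) +
  assumes ip_add: "\<lbrakk>x \<in> carrier H; y \<in> carrier H; z \<in> carrier H\<rbrakk>
      \<Longrightarrow> ip H (x \<oplus> y) z = ip H x z + ip H y z"
    and ip_smult: "\<lbrakk>x \<in> carrier H; y \<in> carrier H\<rbrakk> \<Longrightarrow> ip H (a \<odot> x) y = a * ip H x y"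
    and ip_cnj: "\<lbrakk>x \<in> carrier H; y \<in> carrier H\<rbrakk> \<Longrightarrow> ip H y x = cnj (ip H x y)"
    and ip_pos: "\<lbrakk>x \<in> carrier H; x \<noteq> \<zero>\<rbrakk> \<Longrightarrow> 0 < Re (ip H x x)"

locale hilbert_space = inner_product_space +
  assumes complete: "Metric_space.mcomplete (carrier H) (hdist H)"

definition closed_in :: "('a, 'z) hilbert_scheme \<Rightarrow> 'a set \<Rightarrow> bool" where
  "closed_in H S \<longleftrightarrow> closedin (Metric_space.mtopology (carrier H) (hdist H)) S"

definition bounded_op ::
  "('a, 'y) hilbert_scheme \<Rightarrow> ('b, 'z) hilbert_scheme \<Rightarrow> ('a \<Rightarrow> 'b) \<Rightarrow> bool" where
  "bounded_op H K T \<longleftrightarrow>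
     T \<in> carrier H \<rightarrow> carrier K \<and>
     (\<forall>x\<in>carrier H. \<forall>y\<in>carrier H. T (x \<oplus>\<^bsub>H\<^esub> y) = T x \<oplus>\<^bsub>K\<^esub> T y) \<and>
     (\<forall>a. \<forall>x\<in>carrier H. T (a \<odot>\<^bsub>H\<^esub> x) = a \<odot>\<^bsub>K\<^esub> T x) \<and>
     (\<exists>C. \<forall>x\<in>carrier H. hnorm K (T x) \<le> C * hnorm H x)"


section \<open>Hilbert modules\<close>

text \<open>
  \<open>act M i\<close> is the operator by which the \<open>i\<close>-th variable acts; the variables
  \<open>Z\<^sub>1, \<dots>, Z\<^sub>m\<close> are numbered \<open>0, \<dots>, m - 1\<close>.
  These operators determine the action of all noncommutative polynomials.
\<close>

record 'a hilbert_module = "'a hilbert" +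
  act :: "nat \<Rightarrow> 'a \<Rightarrow> 'a"

definition similar ::
  "nat \<Rightarrow> ('a, 'y) hilbert_module_scheme \<Rightarrow> ('b, 'z) hilbert_module_scheme \<Rightarrow> bool" where
  "similar m M N \<longleftrightarrow>
     (\<exists>X Y. bounded_op M N X \<and> bounded_op N M Y \<and>
        (\<forall>x\<in>carrier M. Y (X x) = x) \<and> (\<forall>y\<in>carrier N. X (Y y) = y) \<and>
        (\<forall>i<m. \<forall>x\<in>carrier M. X (act M i x) = act N i (X x)))"

text \<open>
  The quotient of a Hilbert module by a closed invariant subspace \<open>N\<close>: its elements are the
  cosets of \<open>N\<close>, its norm is the infimum of the norm over a coset, and its inner product
  is obtained from this norm by polarization.
\<close>

definition quot_norm :: "('a, 'z) hilbert_scheme \<Rightarrow> 'a set \<Rightarrow> real" where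
  "quot_norm H X = Inf (hnorm H ` X)"

definition quot_smult ::
  "('a, 'z) hilbert_scheme \<Rightarrow> 'a set \<Rightarrow> complex \<Rightarrow> 'a set \<Rightarrow> 'a set" where
  "quot_smult H N a X = (\<Union>x\<in>X. N +>\<^bsub>H\<^esub> (a \<odot>\<^bsub>H\<^esub> x))"

definition quot :: "('a, 'z) hilbert_module_scheme \<Rightarrow> 'a set \<Rightarrow> 'a set hilbert_module" where
  "quot M N = \<lparr>carrier = a_rcosets\<^bsub>M\<^esub> N, monoid.mult = undefined, monoid.one = undefined,
     ring.zero = N, add = set_add M, smult = quot_smult M N,
     ip = (\<lambda>X Y. (\<Sum>k<4. \<i> ^ k *
            complex_of_real ((quot_norm M (set_add M X (quot_smult M N (\<i> ^ k) Y)))\<^sup>2)) / 4),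
     act = (\<lambda>i X. \<Union>x\<in>X. N +>\<^bsub>M\<^esub> (act M i x))\<rparr>"


section \<open>Fock space\<close>

text \<open>
  The words of length \<open>k\<close> in the letters \<open>0, \<dots>, m - 1\<close> index the standard orthonormal
  basis \<open>e\<^bsub>w\<^sub>1\<^esub> \<otimes> \<dots> \<otimes> e\<^bsub>w\<^sub>k\<^esub>\<close> of the \<open>k\<close>-fold tensor power of \<open>\<complex>\<^sup>m\<close>, and all words that of
  the full Fock space.  Accordingly, an element of the Hilbert space tensor product of
  the full Fock space with \<open>E\<close> is a square summable family \<open>f\<close> of elements of \<open>E\<close> indexed by
  words, standing for the sum of all \<open>e\<^sub>w \<otimes> f w\<close>.  Families vanish at lists that are not words.
\<close>

definition words :: "nat \<Rightarrow> nat list set" where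
  "words m = lists {..<m}"

definition creation :: "('a, 'z) hilbert_scheme \<Rightarrow> nat \<Rightarrow> (nat list \<Rightarrow> 'a) \<Rightarrow> nat list \<Rightarrow> 'a" where
  "creation E i f w =
     (case w of [] \<Rightarrow> \<zero>\<^bsub>E\<^esub> | j # v \<Rightarrow> if j = i then f v else \<zero>\<^bsub>E\<^esub>)"

definition fock :: "nat \<Rightarrow> ('a, 'z) hilbert_scheme \<Rightarrow> (nat list \<Rightarrow> 'a) hilbert_module" where
  "fock m E = \<lparr>carrier = {f. (\<forall>w. f w \<in> carrier E) \<and> (\<forall>w. w \<notin> words m \<longrightarrow> f w = \<zero>\<^bsub>E\<^esub>) \<and>
       (\<lambda>w. (hnorm E (f w))\<^sup>2) summable_on words m},
     monoid.mult = undefined, monoid.one = undefined,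
     ring.zero = (\<lambda>w. \<zero>\<^bsub>E\<^esub>), add = (\<lambda>f g w. f w \<oplus>\<^bsub>E\<^esub> g w), smult = (\<lambda>a f w. a \<odot>\<^bsub>E\<^esub> f w),
     ip = (\<lambda>f g. \<Sum>\<^sub>\<infinity>w\<in>words m. ip E (f w) (g w)),
     act = creation E\<rparr>"

definition multi_analytic ::
  "nat \<Rightarrow> ('a, 'y) hilbert_scheme \<Rightarrow> ('b, 'z) hilbert_scheme \<Rightarrow>
   ((nat list \<Rightarrow> 'a) \<Rightarrow> nat list \<Rightarrow> 'b) \<Rightarrow> bool" where
  "multi_analytic m E F T \<longleftrightarrow> bounded_op (fock m E) (fock m F) T \<and>
     (\<forall>i<m. \<forall>f\<in>carrier (fock m E). T (act (fock m E) i f) = act (fock m F) i (T f))"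

definition quotient_module ::
  "nat \<Rightarrow> ('a, 'y) hilbert_scheme \<Rightarrow> ('b, 'z) hilbert_scheme \<Rightarrow>
   ((nat list \<Rightarrow> 'a) \<Rightarrow> nat list \<Rightarrow> 'b) \<Rightarrow> (nat list \<Rightarrow> 'b) set hilbert_module" where
  "quotient_module m E F T = quot (fock m F) (T ` carrier (fock m E))"


section \<open>Basic properties\<close>

lemma complex_field_simps [simp]: "carrier complex_field = UNIV" "\<one>\<^bsub>complex_field\<^esub> = 1" "\<zero>\<^bsub>complex_field\<^esub> = 0"
  "a \<oplus>\<^bsub>complex_field\<^esub> b = a + b" "a \<otimes>\<^bsub>complex_field\<^esub> b = a * b"
  by (simp_all add: complex_field_def)

lemma cring_complex_field: "cring complex_field"
proof (rule cringI)
  show "abelian_group complex_field"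
    by (rule abelian_groupI) (auto simp: add.assoc add.commute intro: exI[of _ "- _"] ab_left_minus)
  show "Group.comm_monoid complex_field"
    by (rule comm_monoidI) (auto simp: mult.assoc mult.commute)
qed (auto simp: algebra_simps)

lemma complex_field_uminus [simp]: "\<ominus>\<^bsub>complex_field\<^esub> a = - a"
proof -
  interpret cring complex_field by (rule cring_complex_field)
  show ?thesis by (rule minus_equality) auto
qed

context inner_product_space begin

lemma smult_in [simp, intro]: "x \<in> carrier H \<Longrightarrow> a \<odot> x \<in> carrier H"
  by simp

lemma minus_smult: "x \<in> carrier H \<Longrightarrow> \<ominus> x = (-1) \<odot> x"
  using smult_l_minus[of 1 x] smult_one[of x] by simp

lemma ip_add_r: "\<lbrakk>x \<in> carrier H; y \<in> carrier H; z \<in> carrier H\<rbrakk> \<Longrightarrow> ip H z (x \<oplus> y) = ip H z x + ip H z y"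
  by (metis M.add.m_closed complex_cnj_add ip_add ip_cnj)

lemma ip_smult_r: "\<lbrakk>x \<in> carrier H; y \<in> carrier H\<rbrakk> \<Longrightarrow> ip H x (a \<odot> y) = cnj a * ip H x y"
  by (metis complex_cnj_mult ip_cnj ip_smult smult_in)

lemma ip_zero [simp]: "x \<in> carrier H \<Longrightarrow> ip H \<zero> x = 0" "x \<in> carrier H \<Longrightarrow> ip H x \<zero> = 0"
  using ip_add[of \<zero> \<zero> x] ip_add_r[of \<zero> \<zero> x] by simp_all

lemma ip_ge0: "x \<in> carrier H \<Longrightarrow> 0 \<le> Re (ip H x x)"
  by (cases "x = \<zero>") (auto dest: ip_pos)

lemma Im_ip [simp]: "x \<in> carrier H \<Longrightarrow> Im (ip H x x) = 0"
  by (metis complex_cnj_cancel_iff complex_cnj ip_cnj Reals_cnj_iff complex_is_Real_iff)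

lemma hnorm_sq: "x \<in> carrier H \<Longrightarrow> (hnorm H x)\<^sup>2 = Re (ip H x x)"
  by (simp add: hnorm_def ip_ge0)

lemma ip_self: "x \<in> carrier H \<Longrightarrow> ip H x x = of_real ((hnorm H x)\<^sup>2)"
  by (simp add: hnorm_sq complex_eq_iff)

lemma hnorm_ge0: "x \<in> carrier H \<Longrightarrow> 0 \<le> hnorm H x"
  by (simp add: hnorm_def ip_ge0)

lemma hnorm_eq0: "x \<in> carrier H \<Longrightarrow> hnorm H x = 0 \<longleftrightarrow> x = \<zero>"
  by (cases "x = \<zero>") (auto simp: hnorm_def dest!: ip_pos)

lemma hnorm_smult: "x \<in> carrier H \<Longrightarrow> hnorm H (a \<odot> x) = cmod a * hnorm H x"
proof -
  assume x: "x \<in> carrier H"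
  have "ip H (a \<odot> x) (a \<odot> x) = (a * cnj a) * ip H x x"
    using x by (simp add: ip_smult ip_smult_r)
  hence "Re (ip H (a \<odot> x) (a \<odot> x)) = (cmod a)\<^sup>2 * Re (ip H x x)"
    by (simp add: complex_norm_square [symmetric])
  thus ?thesis by (simp add: hnorm_def real_sqrt_mult)
qed

lemma cauchy_schwarz:
  assumes x: "x \<in> carrier H" and y: "y \<in> carrier H"
  shows "cmod (ip H x y) \<le> hnorm H x * hnorm H y"
proof (cases "y = \<zero>")
  case True thus ?thesis using x by (simp add: hnorm_def)
next
  case False
  define p where "p = Re (ip H y y)"
  have p: "p > 0" using ip_pos[OF y False] by (simp add: p_def)
  have yy: "ip H y y = of_real p" using y by (simp add: p_def complex_eq_iff)
  define a where "a = - ip H x y / of_real p"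
  have yx: "ip H y x = cnj (ip H x y)" using x y by (rule ip_cnj)
  let ?z = "x \<oplus> a \<odot> y"
  have "ip H ?z ?z = ip H x x + cnj a * ip H x y + a * ip H y x + a * cnj a * ip H y y"
    using x y by (simp add: ip_add ip_add_r ip_smult ip_smult_r algebra_simps)
  also have "\<dots> = ip H x x - of_real ((cmod (ip H x y))\<^sup>2 / p)"
    using p unfolding yx yy a_def
    by (simp add: field_simps flip: complex_norm_square)
  finally have "Re (ip H ?z ?z) = Re (ip H x x) - (cmod (ip H x y))\<^sup>2 / p" by simp
  moreover have "0 \<le> Re (ip H ?z ?z)" using x y by (intro ip_ge0) simp
  ultimately have "(cmod (ip H x y))\<^sup>2 / p \<le> Re (ip H x x)" by linarith
  hence "(cmod (ip H x y))\<^sup>2 \<le> Re (ip H x x) * p" using p by (simp add: pos_divide_le_eq)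
  also have "\<dots> = (hnorm H x * hnorm H y)\<^sup>2" using x y by (simp add: hnorm_sq p_def power_mult_distrib)
  finally have "(cmod (ip H x y))\<^sup>2 \<le> (hnorm H x * hnorm H y)\<^sup>2" .
  thus ?thesis by (rule power2_le_imp_le) (intro mult_nonneg_nonneg hnorm_ge0 x y)
qed

lemma hnorm_add_sq:
  assumes "x \<in> carrier H" "y \<in> carrier H"
  shows "(hnorm H (x \<oplus> y))\<^sup>2 = (hnorm H x)\<^sup>2 + (hnorm H y)\<^sup>2 + 2 * Re (ip H x y)"
proof -
  have "Re (ip H y x) = Re (ip H x y)" using ip_cnj[of x y] assms by simp
  thus ?thesis using assms by (simp add: hnorm_sq ip_add ip_add_r)
qed

lemma hnorm_triangle:
  assumes "x \<in> carrier H" "y \<in> carrier H"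
  shows "hnorm H (x \<oplus> y) \<le> hnorm H x + hnorm H y"
proof (rule power2_le_imp_le)
  have "Re (ip H x y) \<le> hnorm H x * hnorm H y"
    using cauchy_schwarz[OF assms] complex_Re_le_cmod order_trans by blast
  thus "(hnorm H (x \<oplus> y))\<^sup>2 \<le> (hnorm H x + hnorm H y)\<^sup>2"
    using assms by (simp add: hnorm_add_sq power2_sum)
qed (use assms in \<open>simp add: hnorm_ge0\<close>)

lemma hnorm_uminus: "x \<in> carrier H \<Longrightarrow> hnorm H (\<ominus> x) = hnorm H x"
  by (simp add: minus_smult hnorm_smult)

lemma hnorm_minus_commute:
  assumes "x \<in> carrier H" "y \<in> carrier H"
  shows "hnorm H (x \<ominus> y) = hnorm H (y \<ominus> x)"
proof -
  have "y \<ominus> x = \<ominus> (x \<ominus> y)" using assms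
    by (simp add: a_minus_def M.minus_add M.add.m_comm)
  thus ?thesis using assms hnorm_uminus[of "x \<ominus> y"] by simp
qed

lemma eq_iff_minus:
  assumes "x \<in> carrier H" "y \<in> carrier H"
  shows "x \<ominus> y = \<zero> \<longleftrightarrow> x = y"
proof
  assume "x \<ominus> y = \<zero>"
  hence "(x \<oplus> \<ominus> y) \<oplus> y = y" using assms by (simp add: a_minus_def)
  thus "x = y" using assms by (metis M.a_assoc M.l_neg M.r_zero M.a_inv_closed)
next
  assume "x = y" thus "x \<ominus> y = \<zero>" using assms by (metis M.r_neg a_minus_def)
qed

sublocale metric: Metric_space "carrier H" "hdist H"
proof
  show "0 \<le> hdist H x y" for x y by (simp add: hdist_def hnorm_ge0)
  show "hdist H x y = hdist H y x" for x y by (simp add: hdist_def hnorm_minus_commute)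
  fix x y z assume x: "x \<in> carrier H" and y: "y \<in> carrier H"
  show "(hdist H x y = 0) = (x = y)" using x y eq_iff_minus[OF x y] hnorm_eq0[of "x \<ominus> y"]
    by (simp add: hdist_def)
  assume z: "z \<in> carrier H"
  have "x \<ominus> z = (x \<ominus> y) \<oplus> (y \<ominus> z)" using x y z
    by (metis M.add.inv_closed M.add.m_assoc M.l_neg M.l_zero M.minus_closed a_minus_def)
  thus "hdist H x z \<le> hdist H x y + hdist H y z" using x y z
    by (simp add: hdist_def hnorm_triangle)
qed

end

lemma module_complex:
  assumes "abelian_group M"
    and "\<And>a x. x \<in> carrier M \<Longrightarrow> a \<odot>\<^bsub>M\<^esub> x \<in> carrier M"
    and "\<And>a b x. x \<in> carrier M \<Longrightarrow> (a + b) \<odot>\<^bsub>M\<^esub> x = a \<odot>\<^bsub>M\<^esub> x \<oplus>\<^bsub>M\<^esub> b \<odot>\<^bsub>M\<^esub> x"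
    and "\<And>a x y. x \<in> carrier M \<Longrightarrow> y \<in> carrier M \<Longrightarrow> a \<odot>\<^bsub>M\<^esub> (x \<oplus>\<^bsub>M\<^esub> y) = a \<odot>\<^bsub>M\<^esub> x \<oplus>\<^bsub>M\<^esub> a \<odot>\<^bsub>M\<^esub> y"
    and "\<And>a b x. x \<in> carrier M \<Longrightarrow> (a * b) \<odot>\<^bsub>M\<^esub> x = a \<odot>\<^bsub>M\<^esub> (b \<odot>\<^bsub>M\<^esub> x)"
    and "\<And>x. x \<in> carrier M \<Longrightarrow> 1 \<odot>\<^bsub>M\<^esub> x = x"
  shows "Module.module complex_field M"
  by (rule moduleI) (use assms cring_complex_field in auto)

definition complex_space :: "complex hilbert" where
  "complex_space = \<lparr>carrier = UNIV, monoid.mult = undefined, monoid.one = undefined, ring.zero = 0,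
     add = (+), smult = (*), ip = (\<lambda>a b. a * cnj b)\<rparr>"

lemma abelian_group_complex_space: "abelian_group complex_space"
  unfolding complex_space_def
  by (rule abelian_groupI) (auto simp: add.assoc add.commute intro: exI[of _ "- _"] ab_left_minus)

lemma uminus_complex_space: "\<ominus>\<^bsub>complex_space\<^esub> a = - a"
proof -
  interpret abelian_group complex_space by (rule abelian_group_complex_space)
  show ?thesis by (rule minus_equality) (auto simp: complex_space_def)
qed

lemma hnorm_complex_space: "hnorm complex_space a = cmod a"
  by (simp add: hnorm_def complex_space_def cmod_def flip: complex_norm_square power2_eq_square)

lemma hilbert_space_complex_space: "hilbert_space complex_space"
proof -
  have M: "Module.module complex_field complex_space"
    by (rule module_complex[OF abelian_group_complex_space]) (auto simp: complex_space_def algebra_simps)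
  interpret Module.module complex_field complex_space by (rule M)
  interpret inner_product_space complex_space
  proof
    show "x \<in> carrier complex_space \<Longrightarrow> x \<noteq> \<zero>\<^bsub>complex_space\<^esub> \<Longrightarrow> 0 < Re (ip complex_space x x)" for x
      by (simp add: complex_space_def flip: complex_norm_square)
  qed (auto simp: complex_space_def algebra_simps)
  have d: "hdist complex_space = dist"
    by (auto simp: hdist_def fun_eq_iff a_minus_def uminus_complex_space hnorm_complex_space dist_norm)
       (auto simp: complex_space_def)
  have c: "carrier complex_space = UNIV" by (simp add: complex_space_def)
  show ?thesis
    by unfold_locales (simp add: c d mcomplete_iff_complete complete_UNIV)
qed

text \<open>The Fock module over a Hilbert space is a Hilbert space.\<close>

lemma fock_simps:
  "carrier (fock m E) = {f. (\<forall>w. f w \<in> carrier E) \<and> (\<forall>w. w \<notin> words m \<longrightarrow> f w = \<zero>\<^bsub>E\<^esub>) \<and>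
       (\<lambda>w. (hnorm E (f w))\<^sup>2) summable_on words m}"
  "\<zero>\<^bsub>fock m E\<^esub> = (\<lambda>w. \<zero>\<^bsub>E\<^esub>)"
  "f \<oplus>\<^bsub>fock m E\<^esub> g = (\<lambda>w. f w \<oplus>\<^bsub>E\<^esub> g w)"
  "a \<odot>\<^bsub>fock m E\<^esub> f = (\<lambda>w. a \<odot>\<^bsub>E\<^esub> f w)"
  "ip (fock m E) f g = (\<Sum>\<^sub>\<infinity>w\<in>words m. ip E (f w) (g w))"
  "act (fock m E) = creation E"
  by (simp_all add: fock_def)

context inner_product_space begin

lemma fock_D: "f \<in> carrier (fock m H) \<Longrightarrow> f w \<in> carrier H"
  "f \<in> carrier (fock m H) \<Longrightarrow> w \<notin> words m \<Longrightarrow> f w = \<zero>"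
  "f \<in> carrier (fock m H) \<Longrightarrow> (\<lambda>w. (hnorm H (f w))\<^sup>2) summable_on words m"
  by (auto simp: fock_simps)

lemma hnorm_add_sq_le:
  assumes "x \<in> carrier H" "y \<in> carrier H"
  shows "(hnorm H (x \<oplus> y))\<^sup>2 \<le> 2 * (hnorm H x)\<^sup>2 + 2 * (hnorm H y)\<^sup>2"
proof -
  have "(hnorm H (x \<oplus> y))\<^sup>2 \<le> (hnorm H x + hnorm H y)\<^sup>2"
    using assms by (intro power_mono hnorm_triangle) (auto simp: hnorm_ge0)
  also have "\<dots> \<le> 2 * (hnorm H x)\<^sup>2 + 2 * (hnorm H y)\<^sup>2"
    using sum_squares_bound[of "hnorm H x" "hnorm H y"] by (simp add: power2_sum)
  finally show ?thesis .
qed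

lemma fock_add_closed:
  assumes "f \<in> carrier (fock m H)" "g \<in> carrier (fock m H)"
  shows "(\<lambda>w. f w \<oplus> g w) \<in> carrier (fock m H)"
proof -
  have "(\<lambda>w. (hnorm H (f w \<oplus> g w))\<^sup>2) summable_on words m"
    by (rule summable_on_comparison_test
          [of "\<lambda>w. 2 * (hnorm H (f w))\<^sup>2 + 2 * (hnorm H (g w))\<^sup>2"])
       (use assms in \<open>auto intro!: summable_on_add summable_on_cmult_right hnorm_add_sq_le dest: fock_D\<close>)
  thus ?thesis using assms by (auto simp: fock_simps)
qed

lemma fock_smult_closed:
  assumes "f \<in> carrier (fock m H)"
  shows "(\<lambda>w. a \<odot> f w) \<in> carrier (fock m H)"
proof -
  have "(\<lambda>w. (hnorm H (a \<odot> f w))\<^sup>2) = (\<lambda>w. (cmod a)\<^sup>2 * (hnorm H (f w))\<^sup>2)"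
    using fock_D(1)[OF assms] by (simp add: hnorm_smult power_mult_distrib)
  moreover have "a \<odot> \<zero> = \<zero>" by simp
  ultimately show ?thesis using assms by (auto simp: fock_simps intro!: summable_on_cmult_right)
qed

lemma fock_zero_closed: "(\<lambda>w. \<zero>) \<in> carrier (fock m H)"
  by (simp add: fock_simps hnorm_def)

lemma abelian_group_fock: "abelian_group (fock m H)"
proof (rule abelian_groupI)
  fix f assume f: "f \<in> carrier (fock m H)"
  have "(\<lambda>w. (-1) \<odot> f w) \<in> carrier (fock m H)" using f by (rule fock_smult_closed)
  moreover have "(-1) \<odot> f w \<oplus> f w = \<zero>" for w
    using fock_D(1)[OF f, of w] minus_smult[of "f w"] M.l_neg[of "f w"] by simp
  ultimately show "\<exists>g\<in>carrier (fock m H). g \<oplus>\<^bsub>fock m H\<^esub> f = \<zero>\<^bsub>fock m H\<^esub>"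
    by (intro bexI[of _ "\<lambda>w. (-1) \<odot> f w"]) (auto simp: fock_simps(2-))
qed (simp_all add: fock_simps(2-) fock_add_closed fock_zero_closed M.a_assoc fock_D, simp add: M.a_comm fock_D)

lemma module_fock: "Module.module complex_field (fock m H)"
proof (rule module_complex[OF abelian_group_fock])
  fix a b x y assume "x \<in> carrier (fock m H)" 
  thus "(a + b) \<odot>\<^bsub>fock m H\<^esub> x = a \<odot>\<^bsub>fock m H\<^esub> x \<oplus>\<^bsub>fock m H\<^esub> b \<odot>\<^bsub>fock m H\<^esub> x"
    "(a * b) \<odot>\<^bsub>fock m H\<^esub> x = a \<odot>\<^bsub>fock m H\<^esub> (b \<odot>\<^bsub>fock m H\<^esub> x)"
    "1 \<odot>\<^bsub>fock m H\<^esub> x = x"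
    using smult_l_distr[of a b] smult_assoc1[of a b] smult_one
    by (auto simp: fock_simps(2-) fock_D)
qed (auto simp: fock_simps(2-) fock_smult_closed smult_r_distr fock_D)

lemma fock_ip_summable:
  assumes "f \<in> carrier (fock m H)" "g \<in> carrier (fock m H)"
  shows "(\<lambda>w. norm (ip H (f w) (g w))) summable_on words m"
proof (rule summable_on_comparison_test [of "\<lambda>w. (hnorm H (f w))\<^sup>2 + (hnorm H (g w))\<^sup>2"])
  show "(\<lambda>w. (hnorm H (f w))\<^sup>2 + (hnorm H (g w))\<^sup>2) summable_on words m"
    using assms by (intro summable_on_add) (auto dest: fock_D)
  fix w
  have a: "f w \<in> carrier H" "g w \<in> carrier H" using assms by (auto dest: fock_D)
  have "cmod (ip H (f w) (g w)) \<le> hnorm H (f w) * hnorm H (g w)"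
    using a by (rule cauchy_schwarz)
  also have "\<dots> \<le> (hnorm H (f w))\<^sup>2 + (hnorm H (g w))\<^sup>2"
  proof -
    have "0 \<le> hnorm H (f w) * hnorm H (g w)" using a by (intro mult_nonneg_nonneg hnorm_ge0)
    thus ?thesis using sum_squares_bound[of "hnorm H (f w)" "hnorm H (g w)"] by linarith
  qed
  finally show "norm (ip H (f w) (g w)) \<le> (hnorm H (f w))\<^sup>2 + (hnorm H (g w))\<^sup>2" .
qed auto

lemma fock_ip_self:
  assumes "f \<in> carrier (fock m H)"
  shows "ip (fock m H) f f = of_real (\<Sum>\<^sub>\<infinity>w\<in>words m. (hnorm H (f w))\<^sup>2)"
proof -
  have "ip (fock m H) f f = (\<Sum>\<^sub>\<infinity>w\<in>words m. complex_of_real ((hnorm H (f w))\<^sup>2))"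
    unfolding fock_simps using assms by (intro infsum_cong) (simp add: ip_self fock_D)
  also have "\<dots> = of_real (\<Sum>\<^sub>\<infinity>w\<in>words m. (hnorm H (f w))\<^sup>2)"
    using assms by (intro infsumI has_sum_of_real has_sum_infsum) (auto dest: fock_D)
  finally show ?thesis .
qed

lemma hnorm_fock_sq:
  assumes "f \<in> carrier (fock m H)"
  shows "(hnorm (fock m H) f)\<^sup>2 = (\<Sum>\<^sub>\<infinity>w\<in>words m. (hnorm H (f w))\<^sup>2)"
  using assms by (simp add: hnorm_def[of "fock m H"] fock_ip_self infsum_nonneg)

lemma inner_product_space_fock: "inner_product_space (fock m H)"
proof -
  interpret F: Module.module complex_field "fock m H" by (rule module_fock)
  show ?thesis
  proof
    fix f g h and a :: complex
    assume f: "f \<in> carrier (fock m H)" 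
    {
      assume g: "g \<in> carrier (fock m H)" and h: "h \<in> carrier (fock m H)"
      show "ip (fock m H) (f \<oplus>\<^bsub>fock m H\<^esub> g) h = ip (fock m H) f h + ip (fock m H) g h"
        using f g h by (simp add: fock_simps(2-) ip_add fock_D infsum_add abs_summable_summable fock_ip_summable)
    }
    {
      assume g: "g \<in> carrier (fock m H)"
      show "ip (fock m H) (a \<odot>\<^bsub>fock m H\<^esub> f) g = a * ip (fock m H) f g"
        using f g by (simp add: fock_simps(2-) ip_smult fock_D infsum_cmult_right')
      have "cnj (ip (fock m H) f g) = (\<Sum>\<^sub>\<infinity>w\<in>words m. cnj (ip H (f w) (g w)))"
        by (simp add: fock_simps(2-))
      also have "\<dots> = ip (fock m H) g f" unfolding fock_simps
        using f g by (intro infsum_cong) (metis ip_cnj fock_D(1))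
      finally show "ip (fock m H) g f = cnj (ip (fock m H) f g)" by simp
    }
    assume nz: "f \<noteq> \<zero>\<^bsub>fock m H\<^esub>"
    then obtain w where w: "f w \<noteq> \<zero>" by (auto simp: fock_simps)
    hence wm: "w \<in> words m" using fock_D(2)[OF f] by blast
    have "0 < (hnorm H (f w))\<^sup>2" using w fock_D(1)[OF f, of w] by (simp add: hnorm_eq0)
    also have "\<dots> = (\<Sum>\<^sub>\<infinity>w\<in>{w}. (hnorm H (f w))\<^sup>2)" by simp
    also have "\<dots> \<le> (\<Sum>\<^sub>\<infinity>w\<in>words m. (hnorm H (f w))\<^sup>2)"
      using f wm by (intro infsum_mono_neutral) (auto dest: fock_D)
    finally show "0 < Re (ip (fock m H) f f)" using f by (simp add: fock_ip_self)
  qed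
qed

end

lemma (in inner_product_space) fock_minus:
  assumes f: "f \<in> carrier (fock m H)" and g: "g \<in> carrier (fock m H)"
  shows "f \<ominus>\<^bsub>fock m H\<^esub> g = (\<lambda>w. f w \<ominus> g w)"
proof -
  interpret F: inner_product_space "fock m H" by (rule inner_product_space_fock)
  show ?thesis using f g
    by (simp add: a_minus_def F.minus_smult) (simp add: fock_simps(2-) minus_smult fock_D)
qed

lemma (in hilbert_space) hilbert_space_fock: "hilbert_space (fock m H)"
proof -
  interpret F: inner_product_space "fock m H" by (rule inner_product_space_fock)
  show ?thesis
  proof
    show "F.metric.mcomplete" unfolding F.metric.mcomplete_def
    proof (intro allI impI)
      fix \<sigma> assume C: "F.metric.MCauchy \<sigma>"
      have s: "\<sigma> n \<in> carrier (fock m H)" for n using C by (auto simp: F.metric.MCauchy_def)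
      note sw = fock_D(1)[OF s]
      have diff: "(\<lambda>w. \<sigma> n w \<ominus> \<sigma> n' w) \<in> carrier (fock m H)" for n n'
        using F.M.minus_closed[OF s s] fock_minus[OF s s] by metis
      have part: "(\<Sum>w\<in>K. (hnorm H (\<sigma> n w \<ominus> \<sigma> n' w))\<^sup>2) \<le> (hdist (fock m H) (\<sigma> n) (\<sigma> n'))\<^sup>2"
        if "finite K" "K \<subseteq> words m" for K n n'
      proof -
        have "(\<Sum>w\<in>K. (hnorm H (\<sigma> n w \<ominus> \<sigma> n' w))\<^sup>2) \<le> (\<Sum>\<^sub>\<infinity>w\<in>words m. (hnorm H (\<sigma> n w \<ominus> \<sigma> n' w))\<^sup>2)"
          using that fock_D(3)[OF diff] by (intro finite_sum_le_infsum) auto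
        also have "\<dots> = (hdist (fock m H) (\<sigma> n) (\<sigma> n'))\<^sup>2"
          using s diff by (simp add: hdist_def fock_minus hnorm_fock_sq)
        finally show ?thesis .
      qed
      have "\<exists>x. limitin metric.mtopology (\<lambda>n. \<sigma> n w) x sequentially" if w: "w \<in> words m" for w
      proof -
        have "hdist H (\<sigma> n w) (\<sigma> n' w) \<le> hdist (fock m H) (\<sigma> n) (\<sigma> n')" for n n'
          using part[of "{w}" n n'] w sw[of n w] sw[of n' w]
          by (intro power2_le_imp_le[OF _ F.metric.nonneg]) (simp add: hdist_def[of H])
        hence "metric.MCauchy (\<lambda>n. \<sigma> n w)" using C sw unfolding metric.MCauchy_def F.metric.MCauchy_def
          by (meson image_subset_iff rangeE order.strict_trans1 UNIV_I)
        thus ?thesis using complete unfolding metric.mcomplete_def by blast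
      qed
      then obtain g0 where g0: "\<And>w. w \<in> words m \<Longrightarrow> limitin metric.mtopology (\<lambda>n. \<sigma> n w) (g0 w) sequentially"
        by metis
      define g where "g w = (if w \<in> words m then g0 w else \<zero>)" for w
      have lim: "g w \<in> carrier H" "(\<lambda>n. hdist H (\<sigma> n w) (g w)) \<longlonglongrightarrow> 0" if "w \<in> words m" for w
        using g0[OF that] that by (auto simp: metric.limitin_metric_dist_null g_def)
      have gw: "g w \<in> carrier H" for w using lim(1) by (cases "w \<in> words m") (auto simp: g_def)
      have lim2: "(\<lambda>n'. hnorm H (\<sigma> n w \<ominus> \<sigma> n' w)) \<longlonglongrightarrow> hnorm H (\<sigma> n w \<ominus> g w)" if "w \<in> words m" for n w
      proof -
        have "\<bar>hdist H (\<sigma> n w) (\<sigma> n' w) - hdist H (\<sigma> n w) (g w)\<bar> \<le> hdist H (\<sigma> n' w) (g w)" for n'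
          using metric.triangle[OF sw[of n w] sw[of n' w] gw[of w]]
            metric.triangle[OF sw[of n w] gw[of w] sw[of n' w]]
            metric.commute[of "g w" "\<sigma> n' w"] by linarith
        hence "(\<lambda>n'. hdist H (\<sigma> n w) (\<sigma> n' w) - hdist H (\<sigma> n w) (g w)) \<longlonglongrightarrow> 0"
          by (intro Lim_null_comparison[OF _ lim(2)[OF that]]) auto
        thus ?thesis using sw gw by (simp add: hdist_def LIM_zero_iff)
      qed
      have key: "\<exists>N. \<forall>n\<ge>N. \<forall>K. finite K \<longrightarrow> K \<subseteq> words m \<longrightarrow> (\<Sum>w\<in>K. (hnorm H (\<sigma> n w \<ominus> g w))\<^sup>2) \<le> e\<^sup>2"
        if e: "e > 0" for e :: real
      proof -
        obtain N where N: "\<And>n n'. n \<ge> N \<Longrightarrow> n' \<ge> N \<Longrightarrow> hdist (fock m H) (\<sigma> n) (\<sigma> n') < e"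
          using C e unfolding F.metric.MCauchy_def by blast
        show ?thesis
        proof (intro exI[of _ N] allI impI)
          fix n K assume n: "n \<ge> N" and K: "finite K" "K \<subseteq> words m"
          have "(\<lambda>n'. \<Sum>w\<in>K. (hnorm H (\<sigma> n w \<ominus> \<sigma> n' w))\<^sup>2) \<longlonglongrightarrow> (\<Sum>w\<in>K. (hnorm H (\<sigma> n w \<ominus> g w))\<^sup>2)"
            using K lim2 by (intro tendsto_sum tendsto_power) auto
          moreover have "\<forall>n'\<ge>N. (\<Sum>w\<in>K. (hnorm H (\<sigma> n w \<ominus> \<sigma> n' w))\<^sup>2) \<le> e\<^sup>2"
          proof (intro allI impI)
            fix n' assume n': "n' \<ge> N"
            have "(hdist (fock m H) (\<sigma> n) (\<sigma> n'))\<^sup>2 \<le> e\<^sup>2"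
              using N[OF n n'] by (intro power_mono) auto
            thus "(\<Sum>w\<in>K. (hnorm H (\<sigma> n w \<ominus> \<sigma> n' w))\<^sup>2) \<le> e\<^sup>2" using part[OF K, of n n'] by linarith
          qed
          ultimately show "(\<Sum>w\<in>K. (hnorm H (\<sigma> n w \<ominus> g w))\<^sup>2) \<le> e\<^sup>2"
            by (meson LIMSEQ_le_const2)
        qed
      qed
      have dg: "(\<lambda>w. \<sigma> n w \<ominus> g w) \<in> carrier (fock m H)"
        if "\<forall>K. finite K \<longrightarrow> K \<subseteq> words m \<longrightarrow> (\<Sum>w\<in>K. (hnorm H (\<sigma> n w \<ominus> g w))\<^sup>2) \<le> B" for n B
      proof -
        have "(\<lambda>w. (hnorm H (\<sigma> n w \<ominus> g w))\<^sup>2) summable_on words m"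
          by (rule nonneg_bdd_above_summable_on) (use that in \<open>auto intro!: bdd_aboveI2[of _ _ B]\<close>)
        moreover have "\<sigma> n w \<ominus> g w = \<zero>" if "w \<notin> words m" for w
          using that fock_D(2)[OF s] by (simp add: g_def eq_iff_minus)
        ultimately show ?thesis using sw gw by (auto simp: fock_simps)
      qed
      have gF: "g \<in> carrier (fock m H)"
      proof -
        obtain n where n: "\<forall>K. finite K \<longrightarrow> K \<subseteq> words m \<longrightarrow> (\<Sum>w\<in>K. (hnorm H (\<sigma> n w \<ominus> g w))\<^sup>2) \<le> 1\<^sup>2"
          using key[of 1] by auto
        have "g = \<sigma> n \<ominus>\<^bsub>fock m H\<^esub> (\<lambda>w. \<sigma> n w \<ominus> g w)"
        proof
          fix w
          have a: "\<sigma> n w \<in> carrier H" "g w \<in> carrier H" using sw gw by auto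
          have "\<sigma> n w \<ominus> (\<sigma> n w \<ominus> g w) = g w" using a
            by (simp add: a_minus_def M.minus_add M.r_neg1 M.a_assoc[symmetric] M.r_neg)
          thus "g w = (\<sigma> n \<ominus>\<^bsub>fock m H\<^esub> (\<lambda>w. \<sigma> n w \<ominus> g w)) w"
            using fock_minus[OF s dg[OF n]] by simp
        qed
        thus ?thesis using F.M.minus_closed[OF s dg[OF n]] by metis
      qed
      have "limitin F.metric.mtopology \<sigma> g sequentially"
        unfolding F.metric.limit_metric_sequentially
      proof (intro conjI gF allI impI)
        fix e :: real assume e: "e > 0"
        obtain N where N: "\<And>n. n \<ge> N \<Longrightarrow> \<forall>K. finite K \<longrightarrow> K \<subseteq> words m \<longrightarrow> (\<Sum>w\<in>K. (hnorm H (\<sigma> n w \<ominus> g w))\<^sup>2) \<le> (e/2)\<^sup>2"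
          using key[of "e/2"] e by auto
        show "\<exists>N. \<forall>n\<ge>N. \<sigma> n \<in> carrier (fock m H) \<and> hdist (fock m H) (\<sigma> n) g < e"
        proof (intro exI[of _ N] allI impI conjI s)
          fix n assume n: "n \<ge> N"
          note d = dg[OF N[OF n]]
          have "(hdist (fock m H) (\<sigma> n) g)\<^sup>2 = (\<Sum>\<^sub>\<infinity>w\<in>words m. (hnorm H (\<sigma> n w \<ominus> g w))\<^sup>2)"
            using s gF d by (simp add: hdist_def fock_minus hnorm_fock_sq)
          also have "\<dots> \<le> (e/2)\<^sup>2"
            using N[OF n] fock_D(3)[OF d] by (intro infsum_le_finite_sums) auto
          finally have "(hdist (fock m H) (\<sigma> n) g)\<^sup>2 \<le> (e/2)\<^sup>2" .
          hence "hdist (fock m H) (\<sigma> n) g \<le> e/2" by (rule power2_le_imp_le) (use e in simp)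
          thus "hdist (fock m H) (\<sigma> n) g < e" using e by linarith
        qed
      qed
      thus "\<exists>x. limitin F.metric.mtopology \<sigma> x sequentially" by (rule exI[of _ g])
    qed
  qed
qed


text \<open>
  \<^term>\<open>fock m complex_space\<close> is the scalar full Fock space, and \<^term>\<open>fock m E\<close> together with the
  map \<open>tens E\<close> is its Hilbert space tensor product with \<open>E\<close>: the inner product of elementary
  tensors is multiplicative, and they form a total set.  The \<open>i\<close>-th variable acts on them
  by \<open>S\<^sub>i \<otimes> I\<close>.
\<close>

definition tens :: "('a, 'z) hilbert_scheme \<Rightarrow> (nat list \<Rightarrow> complex) \<Rightarrow> 'a \<Rightarrow> nat list \<Rightarrow> 'a" where
  "tens E \<phi> x w = \<phi> w \<odot>\<^bsub>E\<^esub> x"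

context inner_product_space begin

lemma tens_closed:
  assumes \<phi>: "\<phi> \<in> carrier (fock m complex_space)" and x: "x \<in> carrier H"
  shows "tens H \<phi> x \<in> carrier (fock m H)"
proof -
  have "(\<lambda>w. (cmod (\<phi> w))\<^sup>2) summable_on words m" "\<And>w. w \<notin> words m \<Longrightarrow> \<phi> w = 0"
    using \<phi> by (auto simp: fock_simps hnorm_complex_space) (simp add: complex_space_def)
  moreover have "0 \<odot> x = \<zero>" using smult_l_null[OF x] by simp
  ultimately show ?thesis using x
    by (auto simp: fock_simps tens_def hnorm_smult power_mult_distrib intro!: summable_on_cmult_left)
qed

lemma ip_tens:
  assumes "\<phi> \<in> carrier (fock m complex_space)" "\<psi> \<in> carrier (fock m complex_space)"
    and "x \<in> carrier H" "y \<in> carrier H"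
  shows "ip (fock m H) (tens H \<phi> x) (tens H \<psi> y) = ip (fock m complex_space) \<phi> \<psi> * ip H x y"
proof -
  have "ip (fock m H) (tens H \<phi> x) (tens H \<psi> y) = (\<Sum>\<^sub>\<infinity>w\<in>words m. \<phi> w * cnj (\<psi> w) * ip H x y)"
    unfolding fock_simps tens_def using assms(3,4)
    by (intro infsum_cong) (simp add: ip_smult ip_smult_r mult_ac)
  thus ?thesis by (simp add: fock_simps(5) complex_space_def infsum_cmult_left')
qed

lemma act_tens:
  assumes "x \<in> carrier H"
  shows "act (fock m H) i (tens H \<phi> x) = tens H (act (fock m complex_space) i \<phi>) x"
proof -
  have "0 \<odot> x = \<zero>" using smult_l_null[OF assms] by simp
  thus ?thesis
    by (auto simp: fun_eq_iff fock_simps(6) creation_def tens_def complex_space_def split: list.split)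
qed

lemma tens_total:
  assumes f: "f \<in> carrier (fock m H)"
    and orth: "\<And>\<phi> x. \<phi> \<in> carrier (fock m complex_space) \<Longrightarrow> x \<in> carrier H \<Longrightarrow>
      ip (fock m H) (tens H \<phi> x) f = 0"
  shows "f = \<zero>\<^bsub>fock m H\<^esub>"
proof -
  have "f w = \<zero>" for w
  proof (cases "w \<in> words m")
    case True
    have fw: "f w \<in> carrier H" using fock_D(1)[OF f] .
    define \<phi> where "\<phi> v = (if v = w then 1 else 0 :: complex)" for v
    have "(\<lambda>v. (cmod (\<phi> v))\<^sup>2) summable_on words m"
      by (subst summable_on_cong_neutral[of "{w}" "words m" "\<lambda>v. (cmod (\<phi> v))\<^sup>2"]) (use True in \<open>auto simp: \<phi>_def\<close>)
    hence \<phi>: "\<phi> \<in> carrier (fock m complex_space)"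
      using True by (auto simp: fock_simps hnorm_complex_space \<phi>_def) (auto simp: complex_space_def)
    have z: "0 \<odot> f w = \<zero>" "1 \<odot> f w = f w" using smult_l_null[OF fw] smult_one[OF fw] by simp_all
    have "0 = ip (fock m H) (tens H \<phi> (f w)) f" using orth[OF \<phi> fw] by simp
    also have "\<dots> = (\<Sum>\<^sub>\<infinity>v\<in>{w}. ip H (f v) (f v))" unfolding fock_simps
      using True fock_D(1)[OF f] z by (intro infsum_cong_neutral) (auto simp: \<phi>_def tens_def)
    finally show ?thesis using ip_pos[OF fw] by fastforce
  qed (use fock_D(2)[OF f] in auto)
  thus ?thesis by (auto simp: fock_simps)
qed

lemma creation_closed:
  assumes f: "f \<in> carrier (fock m H)" and i: "i < m"
  shows "creation H i f \<in> carrier (fock m H)"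
proof -
  have inj: "inj_on (Cons i) (words m)" by simp
  have "(\<lambda>w. (hnorm H (creation H i f w))\<^sup>2) summable_on (Cons i ` words m)"
    using fock_D(3)[OF f] by (subst summable_on_reindex[OF inj]) (simp add: o_def creation_def)
  moreover have "(\<lambda>w. (hnorm H (creation H i f w))\<^sup>2) summable_on (Cons i ` words m) \<longleftrightarrow>
      (\<lambda>w. (hnorm H (creation H i f w))\<^sup>2) summable_on words m"
    using i by (intro summable_on_cong_neutral)
      (auto simp: creation_def hnorm_def words_def split: list.splits if_splits)
  ultimately show ?thesis using fock_D(1,2)[OF f] i
    by (auto simp: fock_simps creation_def words_def split: list.splits)
qed

lemma ip_creation:
  assumes f: "f \<in> carrier (fock m H)" and g: "g \<in> carrier (fock m H)" and i: "i < m"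
  shows "ip (fock m H) (creation H i f) (creation H i g) = ip (fock m H) f g"
proof -
  have inj: "inj_on (Cons i) (words m)" by simp
  have "ip (fock m H) (creation H i f) (creation H i g)
      = (\<Sum>\<^sub>\<infinity>w\<in>Cons i ` words m. ip H (creation H i f w) (creation H i g w))"
    unfolding fock_simps using i 
    by (intro infsum_cong_neutral)
      (auto simp: creation_def words_def split: list.splits if_splits)
  also have "\<dots> = ip (fock m H) f g"
    unfolding fock_simps by (subst infsum_reindex[OF inj]) (simp add: o_def creation_def)
  finally show ?thesis .
qed

lemma quot_norm_lower:
  assumes "X \<subseteq> carrier H" "x \<in> X"
  shows "quot_norm H X \<le> hnorm H x"
  unfolding quot_norm_def using assms
  by (intro cInf_lower bdd_belowI[of _ 0]) (auto intro: hnorm_ge0)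

end

lemma (in inner_product_space) hnorm_quot_aux:
  assumes N: "N \<subseteq> carrier H" "\<zero> \<in> N" "\<And>x y. x \<in> N \<Longrightarrow> y \<in> N \<Longrightarrow> x \<oplus> y \<in> N"
    "\<And>a x. x \<in> N \<Longrightarrow> a \<odot> x \<in> N" 
    and x: "x \<in> carrier H"
  shows "quot_smult H N a (N +> x) = N +> (a \<odot> x)" (is ?A)
    and "y \<in> carrier H \<Longrightarrow> set_add H (N +> x) (N +> y) = N +> (x \<oplus> y)" (is "_ \<Longrightarrow> ?B")
    and "quot_norm H (N +> (a \<odot> x)) = cmod a * quot_norm H (N +> x)" (is ?C)
proof -
  have Nc: "n \<in> carrier H" if "n \<in> N" for n using N(1) that by auto
  have cos: "N +> z = {n \<oplus> z |n. n \<in> N}" for z by (auto simp: a_r_coset_def')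
  have sub: "N +> z \<subseteq> carrier H" if "z \<in> carrier H" for z using that Nc by (auto simp: cos)
  have absorb: "N +> (n \<oplus> z) = N +> z" if n: "n \<in> N" and z: "z \<in> carrier H" for n z
  proof -
    have mn: "\<ominus> n \<in> N" using N(4)[OF n, of "-1"] minus_smult[of n] Nc[OF n] by simp
    have "\<exists>n'. k \<oplus> (n \<oplus> z) = n' \<oplus> z \<and> n' \<in> N" if "k \<in> N" for k
      using N(3)[OF that n] Nc that n z by (intro exI[of _ "k \<oplus> n"]) (simp add: M.a_assoc)
    moreover have "\<exists>n'. k \<oplus> z = n' \<oplus> (n \<oplus> z) \<and> n' \<in> N" if k: "k \<in> N" for k
    proof -
      have "\<ominus> n \<oplus> (n \<oplus> z) = z" using Nc[OF n] z by (simp add: M.r_neg1)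
      hence "k \<oplus> z = (k \<oplus> \<ominus> n) \<oplus> (n \<oplus> z)" using Nc[OF n] Nc[OF k] z by (simp add: M.a_assoc)
      thus ?thesis using N(3)[OF k mn] by blast
    qed
    ultimately show ?thesis by (auto simp: cos)
  qed
  show ?A
  proof -
    have "N +> (a \<odot> (n \<oplus> x)) = N +> (a \<odot> x)" if "n \<in> N" for n
      using absorb[OF N(4)[OF that, of a], of "a \<odot> x"] Nc[OF that] x by (simp add: smult_r_distr)
    thus ?thesis using N(2) unfolding quot_smult_def cos[of x] by blast
  qed
  show ?B if y: "y \<in> carrier H"
  proof (rule Set.set_eqI)
    fix z
    have e: "(n \<oplus> x) \<oplus> (k \<oplus> y) = (n \<oplus> k) \<oplus> (x \<oplus> y)" if "n \<in> N" "k \<in> N" for n k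
      using Nc that x y by (simp add: M.a_ac)
    have "z \<in> set_add H (N +> x) (N +> y) \<longleftrightarrow> (\<exists>n\<in>N. \<exists>k\<in>N. z = (n \<oplus> k) \<oplus> (x \<oplus> y))"
      using e by (auto simp: set_add_def' cos) (metis e)+
    also have "\<dots> \<longleftrightarrow> (\<exists>n\<in>N. z = n \<oplus> (x \<oplus> y))"
      using N(2,3) Nc by (metis M.l_zero)
    finally show "z \<in> set_add H (N +> x) (N +> y) \<longleftrightarrow> z \<in> N +> (x \<oplus> y)" by (auto simp: cos)
  qed
  have le: "quot_norm H (N +> (b \<odot> z)) \<le> cmod b * quot_norm H (N +> z)" if b: "b \<noteq> 0" and z: "z \<in> carrier H" for b z
  proof -
    have "quot_norm H (N +> (b \<odot> z)) / cmod b \<le> quot_norm H (N +> z)"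
      unfolding quot_norm_def[of H "N +> z"]
    proof (rule cInf_greatest)
      show "hnorm H ` (N +> z) \<noteq> {}" using N(2) by (auto simp: cos)
      fix t assume "t \<in> hnorm H ` (N +> z)"
      then obtain n where n: "n \<in> N" "t = hnorm H (n \<oplus> z)" by (auto simp: cos)
      have "b \<odot> (n \<oplus> z) \<in> N +> (b \<odot> z)" using N(4)[OF n(1), of b] Nc[OF n(1)] z
        by (auto simp: cos smult_r_distr)
      hence "quot_norm H (N +> (b \<odot> z)) \<le> hnorm H (b \<odot> (n \<oplus> z))"
        using sub[of "b \<odot> z"] z by (intro quot_norm_lower) auto
      also have "\<dots> = cmod b * t" using Nc[OF n(1)] z n by (simp add: hnorm_smult)
      finally show "quot_norm H (N +> (b \<odot> z)) / cmod b \<le> t" using b by (simp add: divide_le_eq mult.commute)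
    qed
    thus ?thesis using b by (simp add: divide_le_eq mult.commute)
  qed
  show ?C
  proof (cases "a = 0")
    case True
    have "N +> \<zero> = N" using Nc by (force simp: cos)
    moreover have "quot_norm H N = 0"
    proof (rule antisym)
      show "quot_norm H N \<le> 0" using quot_norm_lower[OF N(1,2)] by (simp add: hnorm_def)
      show "0 \<le> quot_norm H N" unfolding quot_norm_def
        using N(2) Nc by (intro cInf_greatest) (auto intro: hnorm_ge0)
    qed
    ultimately show ?thesis using True smult_l_null[OF x] by simp
  next
    case False
    have "inverse a \<odot> (a \<odot> x) = x" using smult_assoc1[of "inverse a" a x] smult_one[OF x] x False by simp
    hence "quot_norm H (N +> x) \<le> cmod (inverse a) * quot_norm H (N +> (a \<odot> x))"
      using le[of "inverse a" "a \<odot> x"] False x by simp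
    hence "cmod a * quot_norm H (N +> x) \<le> quot_norm H (N +> (a \<odot> x))"
      using False by (simp add: norm_divide field_simps)
    thus ?thesis using le[OF False x] by linarith
  qed
qed

text \<open>The inner product defined by polarization gives back the quotient norm.\<close>

lemma hnorm_quot:
  assumes "inner_product_space M"
    and N: "N \<subseteq> carrier M" "\<zero>\<^bsub>M\<^esub> \<in> N" "\<And>x y. x \<in> N \<Longrightarrow> y \<in> N \<Longrightarrow> x \<oplus>\<^bsub>M\<^esub> y \<in> N"
      "\<And>a x. x \<in> N \<Longrightarrow> a \<odot>\<^bsub>M\<^esub> x \<in> N" 
    and X: "X \<in> carrier (quot M N)"
  shows "hnorm (quot M N) X = quot_norm M X"
proof -
  interpret inner_product_space M by fact
  obtain x where x: "x \<in> carrier M" "X = N +>\<^bsub>M\<^esub> x"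
    using X by (auto simp: quot_def A_RCOSETS_def')
  note aux = hnorm_quot_aux[OF N, simplified]
  have t: "quot_norm M (set_add M X (quot_smult M N a X)) = cmod (1 + a) * quot_norm M X" for a
  proof -
    have "(1 + a) \<odot>\<^bsub>M\<^esub> x = x \<oplus>\<^bsub>M\<^esub> a \<odot>\<^bsub>M\<^esub> x" 
      using smult_l_distr[of 1 a x] smult_one[OF x(1)] x(1) by simp
    thus ?thesis using aux(1)[OF x(1), of a] aux(2)[OF x(1), of "a \<odot>\<^bsub>M\<^esub> x"] aux(3)[OF x(1), of "1 + a"] x by simp
  qed
  have c: "cmod (1 + \<i>) = sqrt 2" "cmod (\<i> + 1) = sqrt 2" "cmod (1 - \<i>) = sqrt 2"
    by (simp_all add: cmod_def)
  have "ip (quot M N) X X = of_real ((quot_norm M X)\<^sup>2)"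
    by (simp add: quot_def t numeral_eq_Suc power_mult_distrib c flip: of_real_power)
  moreover have "0 \<le> quot_norm M X"
    unfolding quot_norm_def using x N(1,2)
    by (intro cInf_greatest) (auto simp: a_r_coset_def' intro!: hnorm_ge0)
  ultimately show ?thesis by (simp add: hnorm_def)
qed

end

theory Submission
  imports Defs
begin

text \<open>
  Write \<open>A\<close> and \<open>B\<close> for the Fock modules over \<open>E\<close> and \<open>E\<^sub>*\<close>, \<open>S\<^sub>i\<close> for the action of the \<open>i\<close>-th
  variable and \<open>R\<close> for the range of \<open>\<Theta>\<close>.  As \<open>\<Theta>\<close> is injective, \<open>\<Theta>\<Psi>\<Theta> = \<Theta>\<close> says that \<open>\<Psi>\<close> is a left
  inverse of \<open>\<Theta>\<close>, and the theorem says that the quotient \<open>B/R\<close> is similar to a free module exactly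
  when the quotient map \<open>B \<rightarrow> B/R\<close> splits as a map of modules.

  Suppose that \<open>\<Psi>\<close> is given.  Then \<open>\<Theta>\<Psi>\<close> is an idempotent module map with range \<open>R\<close>, and \<open>B/R\<close> is
  similar to its kernel \<open>N\<close>.  The \<open>S\<^sub>i\<close> act on the closed invariant subspace \<open>N\<close> as isometries with
  orthogonal ranges, and a word of length \<open>n\<close> in them maps into the families that vanish at all
  words shorter than \<open>n\<close>.  So peeling off, again and again, the component orthogonal to
  \<open>S\<^sub>1N + \<dots> + S\<^sub>mN\<close> exhausts \<open>N\<close>; this is the Wold decomposition, and it identifies \<open>N\<close> with the
  Fock module over the wandering subspace \<open>N \<ominus> (S\<^sub>1N + \<dots> + S\<^sub>mN)\<close> (lemmas \<open>synth_analyse\<close> and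
  \<open>analyse_synth\<close>).

  Suppose conversely that \<open>Y\<close> is a similarity from the Fock module over some \<open>F\<close> onto \<open>B/R\<close>.  If
  \<open>Y\<close> lifts to a multi-analytic operator \<open>L\<close> with values in \<open>B\<close>, then \<open>p\<close>, the composition of the
  quotient map, \<open>Y\<^sup>-\<^sup>1\<close> and \<open>L\<close>, is an idempotent module map with kernel \<open>R\<close>, and \<open>\<Psi> = \<Theta>\<^sup>-\<^sup>1(I - p)\<close> is
  as desired; it is bounded because an injective operator with closed range is bounded below
  (lemma \<open>bounded_below\<close>, from Baire's theorem).

  The lift \<open>L\<close> is what commutant lifting provides.  It is constructed here on the side of the adjoints:
  the adjoint of \<open>Y\<close> is an operator \<open>W\<close> on the orthogonal complement \<open>G\<close> of \<open>R\<close> that intertwines the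
  backward shifts \<open>S\<^sub>i\<^sup>*\<close>, and lifting \<open>Y\<close> means extending \<open>W\<close> to an intertwiner on \<open>B\<close> that is still
  bounded.  An intertwiner is determined by its component at the empty word, so that extending it
  from \<open>G\<close> to the space of all \<open>f\<close> with \<open>S\<^sub>i\<^sup>*f \<in> G\<close> for all \<open>i\<close> is a matter of extending a single
  operator \<open>c\<close>.  If \<open>C\<close> is the bound of \<open>W\<close>, the bound on the extension requires that
  \<open>\<parallel>cf\<parallel>\<^sup>2 \<le> C\<^sup>2\<parallel>f\<parallel>\<^sup>2 - \<parallel>WS\<^sub>1\<^sup>*f\<parallel>\<^sup>2 - \<dots> - \<parallel>WS\<^sub>m\<^sup>*f\<parallel>\<^sup>2\<close>.  The right-hand side is a positive semidefinite
  form, and composing \<open>c\<close> with the projection that is orthogonal for this form does it (lemmas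
  \<open>extend_operator\<close> and \<open>backward_intertwiner_step\<close>).  Repeating the step reaches all finitely
  supported families, and the adjoint of the resulting intertwiner is \<open>L\<close>
  (lemma \<open>backward_intertwiner_adjoint\<close>).
\<close>

section \<open>Semi-inner products\<close>

text \<open>
  Degenerate forms matter: the form that controls one step of the extension of an intertwiner is a
  difference of squared norms and can vanish at nonzero vectors.
\<close>
locale semi_inner_product_space = Module.module complex_field V
  for V :: "('a, 'z) hilbert_scheme" (structure) and t :: "'a \<Rightarrow> 'a \<Rightarrow> complex" +
  assumes t_add: "\<lbrakk>x \<in> carrier V; y \<in> carrier V; z \<in> carrier V\<rbrakk> \<Longrightarrow> t (x \<oplus> y) z = t x z + t y z"
    and t_smult: "\<lbrakk>x \<in> carrier V; y \<in> carrier V\<rbrakk> \<Longrightarrow> t (a \<odot> x) y = a * t x y"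
    and t_cnj: "\<lbrakk>x \<in> carrier V; y \<in> carrier V\<rbrakk> \<Longrightarrow> t y x = cnj (t x y)"
    and t_ge0: "x \<in> carrier V \<Longrightarrow> 0 \<le> Re (t x x)"

text \<open>
  The discriminant inequality.  The best choices for \<open>a\<close> are the negative real multiples of the
  conjugate of \<open>b\<close>.
\<close>
lemma quadratic_nonneg_bound:
  fixes b :: complex
  assumes "\<And>a. 0 \<le> \<delta> + 2 * Re (a * b) + (cmod a)\<^sup>2 * T" and T: "T \<ge> 0"
  shows "(cmod b)\<^sup>2 \<le> \<delta> * T"
proof -
  have r: "0 \<le> \<delta> - 2 * s * (cmod b)\<^sup>2 + s\<^sup>2 * (cmod b)\<^sup>2 * T" if "s \<ge> 0" for s
  proof -
    have "Re (- (of_real s * cnj b) * b) = - s * (cmod b)\<^sup>2"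
      using cmod_power2[of b] by (simp add: power2_eq_square algebra_simps)
    moreover have "(cmod (- (of_real s * cnj b)))\<^sup>2 = s\<^sup>2 * (cmod b)\<^sup>2"
      by (simp add: norm_mult power_mult_distrib)
    moreover note assms(1)[of "- (of_real s * cnj b)"]
    ultimately show ?thesis by simp
  qed
  show ?thesis
  proof (cases "T = 0")
    case True
    have "b = 0"
    proof (rule ccontr)
      assume "b \<noteq> 0"
      hence p: "(cmod b)\<^sup>2 > 0" by simp
      have "0 \<le> \<delta>" using r[of 0] by simp
      moreover have "2 * ((\<delta> + 1) / (cmod b)\<^sup>2) * (cmod b)\<^sup>2 = 2 * (\<delta> + 1)" using p by simp
      ultimately show False using r[of "(\<delta> + 1) / (cmod b)\<^sup>2"] True p by simp
    qed
    thus ?thesis using True by simp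
  next
    case False
    hence T: "T > 0" using T by simp
    have "s\<^sup>2 * B * T = s * B" if "s = 1 / T" for s B :: real using that T by (simp add: power2_eq_square)
    hence "0 \<le> \<delta> - (1 / T) * (cmod b)\<^sup>2" using r[of "1 / T"] T by simp
    thus ?thesis using T by (simp add: field_simps)
  qed
qed

lemma sqrt_le_of_le_mult_sqrt:
  assumes "(x::real) \<le> b * sqrt x" "0 \<le> x" "0 \<le> b"
  shows "sqrt x \<le> b"
proof (cases "x = 0")
  case False
  hence "sqrt x > 0" using assms by simp
  moreover have "sqrt x * sqrt x \<le> b * sqrt x" using assms by simp
  ultimately show ?thesis by (meson mult_right_le_imp_le)
qed (use assms in simp)

context semi_inner_product_space begin

abbreviation q :: "'a \<Rightarrow> real" where "q x \<equiv> Re (t x x)"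

lemma smult_in' [simp, intro]: "x \<in> carrier V \<Longrightarrow> a \<odot> x \<in> carrier V"
  by simp

lemma t_add_r: "\<lbrakk>x \<in> carrier V; y \<in> carrier V; z \<in> carrier V\<rbrakk> \<Longrightarrow> t z (x \<oplus> y) = t z x + t z y"
  using t_cnj[of "x \<oplus> y" z] t_cnj[of x z] t_cnj[of y z] by (simp add: t_add)

lemma t_smult_r: "\<lbrakk>x \<in> carrier V; y \<in> carrier V\<rbrakk> \<Longrightarrow> t x (a \<odot> y) = cnj a * t x y"
  using t_cnj[of "a \<odot> y" x] t_cnj[of y x] by (simp add: t_smult)

lemma q_add_smult:
  assumes "x \<in> carrier V" "y \<in> carrier V"
  shows "q (x \<oplus> a \<odot> y) = q x + 2 * Re (a * t y x) + (cmod a)\<^sup>2 * q y"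
proof -
  have "t (x \<oplus> a \<odot> y) (x \<oplus> a \<odot> y) = t x x + a * t y x + cnj a * t x y + (a * cnj a) * t y y"
    using assms by (simp add: t_add t_add_r t_smult t_smult_r algebra_simps)
  moreover have "Re (cnj a * t x y) = Re (a * t y x)"
    using t_cnj[OF assms(2,1)] by simp
  moreover have "Re ((a * cnj a) * t y y) = (cmod a)\<^sup>2 * q y"
    by (simp add: complex_norm_square [symmetric])
  ultimately show ?thesis by simp
qed

lemma t_cauchy_schwarz:
  assumes "x \<in> carrier V" "y \<in> carrier V"
  shows "cmod (t y x) \<le> sqrt (q x) * sqrt (q y)"
proof -
  have "(cmod (t y x))\<^sup>2 \<le> q x * q y"
    using assms t_ge0[of "x \<oplus> a \<odot> y" for a]
    by (intro quadratic_nonneg_bound) (auto simp: q_add_smult t_ge0)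
  thus ?thesis unfolding real_sqrt_mult[symmetric] by (rule real_le_rsqrt)
qed

text \<open>
  A bounded functional is represented by a vector of the completion.  The completion is never
  formed; instead a sequence \<open>g\<close> with error bounds \<open>\<epsilon>\<close> stands for this vector.
\<close>
definition approx :: "('a \<Rightarrow> complex) \<Rightarrow> (nat \<Rightarrow> 'a) \<Rightarrow> (nat \<Rightarrow> real) \<Rightarrow> bool" where
  "approx \<phi> g \<epsilon> \<longleftrightarrow> \<epsilon> \<longlonglongrightarrow> 0 \<and> (\<forall>n. 0 \<le> \<epsilon> n) \<and> (\<forall>n. g n \<in> carrier V \<and>
     (\<forall>h\<in>carrier V. cmod (t h (g n) - \<phi> h) \<le> \<epsilon> n * sqrt (q h)))"

text \<open>
  The \<open>g n\<close> nearly minimise \<open>q x - 2 Re (\<phi> x)\<close>.  The first variation of this function in the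
  direction \<open>h\<close> is controlled by \<open>t h (g n) - \<phi> h\<close>, which is therefore small.
\<close>
lemma approx_exists:
  assumes add: "\<And>x y. \<lbrakk>x \<in> carrier V; y \<in> carrier V\<rbrakk> \<Longrightarrow> \<phi> (x \<oplus> y) = \<phi> x + \<phi> y"
    and smult: "\<And>a x. x \<in> carrier V \<Longrightarrow> \<phi> (a \<odot> x) = a * \<phi> x"
    and bound: "\<And>x. x \<in> carrier V \<Longrightarrow> cmod (\<phi> x) \<le> K * sqrt (q x)"
  shows "\<exists>g \<epsilon>. approx \<phi> g \<epsilon>"
proof -
  define J where "J x = q x - 2 * Re (\<phi> x)" for x
  have lower: "- K\<^sup>2 \<le> J x" if x: "x \<in> carrier V" for x
  proof -
    have "Re (\<phi> x) \<le> K * sqrt (q x)"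
      using bound[OF x] complex_Re_le_cmod order_trans by blast
    moreover have "2 * (K * sqrt (q x)) \<le> q x + K\<^sup>2"
      using zero_le_power2[of "sqrt (q x) - K"] t_ge0[OF x] by (simp add: power2_diff algebra_simps)
    ultimately show ?thesis unfolding J_def by linarith
  qed
  define d where "d = Inf (J ` carrier V)"
  have bdd: "bdd_below (J ` carrier V)" using lower by (intro bdd_belowI[of _ "- K\<^sup>2"]) auto
  have dle: "d \<le> J x" if "x \<in> carrier V" for x
    unfolding d_def using that bdd by (intro cInf_lower) auto
  have "\<exists>x\<in>carrier V. J x < d + 1 / real (Suc n)" for n
  proof -
    have "Inf (J ` carrier V) < d + 1 / real (Suc n)" by (simp add: d_def)
    thus ?thesis using bdd by (subst (asm) cInf_less_iff) auto
  qed
  then obtain g where g: "\<And>n. g n \<in> carrier V" "\<And>n. J (g n) < d + 1 / real (Suc n)" by metis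
  have b: "cmod (t h (g n) - \<phi> h) \<le> sqrt (1 / real (Suc n)) * sqrt (q h)" if h: "h \<in> carrier V" for h n
  proof -
    have "(cmod (t h (g n) - \<phi> h))\<^sup>2 \<le> 1 / real (Suc n) * q h"
    proof (rule quadratic_nonneg_bound)
      fix a
      have "d \<le> J (g n \<oplus> a \<odot> h)" using g h by (intro dle) auto
      also have "\<dots> = J (g n) + 2 * Re (a * (t h (g n) - \<phi> h)) + (cmod a)\<^sup>2 * q h"
        using g(1)[of n] h by (simp add: J_def q_add_smult add smult right_diff_distrib)
      finally show "0 \<le> 1 / real (Suc n) + 2 * Re (a * (t h (g n) - \<phi> h)) + (cmod a)\<^sup>2 * q h"
        using g(2)[of n] by linarith
    qed (rule t_ge0[OF h])
    thus ?thesis unfolding real_sqrt_mult[symmetric] by (rule real_le_rsqrt)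
  qed
  have "(\<lambda>n. sqrt (1 / real (Suc n))) \<longlonglongrightarrow> sqrt 0"
    by (intro tendsto_real_sqrt LIMSEQ_Suc lim_1_over_n)
  thus ?thesis using g b unfolding approx_def
    by (intro exI[of _ g] exI[of _ "\<lambda>n. sqrt (1 / real (Suc n))"]) auto
qed

lemma approx_add_smult:
  assumes "approx \<phi> g \<epsilon>" "approx \<psi> h \<delta>"
  shows "approx (\<lambda>x. \<phi> x + cnj a * \<psi> x) (\<lambda>n. g n \<oplus> a \<odot> h n) (\<lambda>n. \<epsilon> n + cmod a * \<delta> n)"
  unfolding approx_def
proof (intro conjI allI ballI)
  have "(\<lambda>n. \<epsilon> n + cmod a * \<delta> n) \<longlonglongrightarrow> 0 + cmod a * 0"
    using assms unfolding approx_def by (intro tendsto_intros) auto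
  thus "(\<lambda>n. \<epsilon> n + cmod a * \<delta> n) \<longlonglongrightarrow> 0" by simp
  fix n
  show "0 \<le> \<epsilon> n + cmod a * \<delta> n" using assms by (auto simp: approx_def)
  have c: "g n \<in> carrier V" "h n \<in> carrier V" using assms by (auto simp: approx_def)
  thus "g n \<oplus> a \<odot> h n \<in> carrier V" by simp
  fix x assume x: "x \<in> carrier V"
  have "t x (g n \<oplus> a \<odot> h n) - (\<phi> x + cnj a * \<psi> x) = (t x (g n) - \<phi> x) + cnj a * (t x (h n) - \<psi> x)"
    using c x by (simp add: t_add_r t_smult_r algebra_simps)
  also have "cmod \<dots> \<le> cmod (t x (g n) - \<phi> x) + cmod a * cmod (t x (h n) - \<psi> x)"
    using norm_triangle_ineq[of "t x (g n) - \<phi> x" "cnj a * (t x (h n) - \<psi> x)"] by (simp add: norm_mult)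
  also have "\<dots> \<le> \<epsilon> n * sqrt (q x) + cmod a * (\<delta> n * sqrt (q x))"
    using assms x by (intro add_mono mult_left_mono) (auto simp: approx_def)
  finally show "cmod (t x (g n \<oplus> a \<odot> h n) - (\<phi> x + cnj a * \<psi> x)) \<le> (\<epsilon> n + cmod a * \<delta> n) * sqrt (q x)"
    by (simp add: algebra_simps)
qed

text \<open>
  Both sequences represent the same functional; evaluating it at the difference \<open>x\<close> of two members
  bounds \<open>q x = t x x\<close> by a small multiple of \<open>sqrt (q x)\<close>.
\<close>
lemma approx_dist:
  assumes "approx \<phi> g \<epsilon>" "approx \<phi> h \<delta>"
  shows "sqrt (q (g n \<oplus> (-1) \<odot> h k)) \<le> \<epsilon> n + \<delta> k"
proof -
  let ?x = "g n \<oplus> (-1) \<odot> h k"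
  have c: "g n \<in> carrier V" "h k \<in> carrier V" using assms by (auto simp: approx_def)
  have x: "?x \<in> carrier V" using c by simp
  have e: "t ?x ?x = (t ?x (g n) - \<phi> ?x) - (t ?x (h k) - \<phi> ?x)"
    using t_add_r[OF c(1) smult_in'[OF c(2)] x] t_smult_r[OF x c(2), of "-1"] by simp
  hence "q ?x \<le> cmod (t ?x (g n) - \<phi> ?x) + cmod (t ?x (h k) - \<phi> ?x)"
    using complex_Re_le_cmod[of "t ?x ?x"] norm_triangle_ineq4[of "t ?x (g n) - \<phi> ?x" "t ?x (h k) - \<phi> ?x"]
    unfolding e[symmetric] by linarith
  also have "\<dots> \<le> \<epsilon> n * sqrt (q ?x) + \<delta> k * sqrt (q ?x)"
    using assms x by (intro add_mono) (auto simp: approx_def)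
  finally have le: "q ?x \<le> (\<epsilon> n + \<delta> k) * sqrt (q ?x)" by (simp add: algebra_simps)
  thus ?thesis using assms t_ge0[OF x] by (intro sqrt_le_of_le_mult_sqrt) (auto simp: approx_def)
qed

lemma approx_bound:
  assumes "approx \<phi> g \<epsilon>" and bound: "\<And>x. x \<in> carrier V \<Longrightarrow> cmod (\<phi> x) \<le> K * sqrt (q x)" and "0 \<le> K"
  shows "sqrt (q (g n)) \<le> K + \<epsilon> n"
proof -
  have c: "g n \<in> carrier V" using assms by (auto simp: approx_def)
  have "t (g n) (g n) = (t (g n) (g n) - \<phi> (g n)) + \<phi> (g n)" by simp
  hence "q (g n) \<le> cmod (t (g n) (g n) - \<phi> (g n)) + cmod (\<phi> (g n))"
    using complex_Re_le_cmod[of "t (g n) (g n)"] norm_triangle_ineq[of "t (g n) (g n) - \<phi> (g n)" "\<phi> (g n)"]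
    by simp
  also have "\<dots> \<le> \<epsilon> n * sqrt (q (g n)) + K * sqrt (q (g n))"
    using assms c by (intro add_mono) (auto simp: approx_def)
  finally have le: "q (g n) \<le> (K + \<epsilon> n) * sqrt (q (g n))" by (simp add: algebra_simps)
  thus ?thesis using assms t_ge0[OF c] by (intro sqrt_le_of_le_mult_sqrt) (auto simp: approx_def)
qed

end

section \<open>Subspaces, Riesz representation and extension of operators\<close>

lemma tendsto_of_norm_diff_le:
  fixes f :: "nat \<Rightarrow> 'v :: real_normed_vector"
  assumes "\<And>n. norm (f n - l) \<le> b n" "b \<longlonglongrightarrow> 0"
  shows "f \<longlonglongrightarrow> l"
proof -
  have "(\<lambda>n. f n - l) \<longlonglongrightarrow> 0"
    by (rule Lim_null_comparison[OF always_eventually assms(2)]) (simp add: assms(1))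
  thus ?thesis by (simp add: LIM_zero_iff)
qed

abbreviation subspace_of :: "('a, 'z) hilbert_scheme \<Rightarrow> 'a set \<Rightarrow> bool" where
  "subspace_of H G \<equiv> submodule G complex_field H"

lemma (in Module.module) submodule_zero: "submodule G R M \<Longrightarrow> \<zero>\<^bsub>M\<^esub> \<in> G"
  using subgroup.one_closed[of G "add_monoid M"] by (simp add: submodule_def)

lemma subspaceI:
  assumes "Module.module complex_field H" "G \<subseteq> carrier H" "\<zero>\<^bsub>H\<^esub> \<in> G"
    and "\<And>x y. x \<in> G \<Longrightarrow> y \<in> G \<Longrightarrow> x \<oplus>\<^bsub>H\<^esub> y \<in> G"
    and "\<And>a x. x \<in> G \<Longrightarrow> a \<odot>\<^bsub>H\<^esub> x \<in> G"
  shows "subspace_of H G"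
proof -
  interpret Module.module complex_field H by fact
  have "\<ominus>\<^bsub>H\<^esub> x = (-1) \<odot>\<^bsub>H\<^esub> x" if "x \<in> carrier H" for x
    using smult_l_minus[of 1 x] smult_one[of x] that by simp
  thus ?thesis using assms by (intro submoduleI) auto
qed

lemma subspaceD:
  assumes "Module.module complex_field H" "subspace_of H G"
  shows "x \<in> G \<Longrightarrow> x \<in> carrier H" "\<zero>\<^bsub>H\<^esub> \<in> G"
    "x \<in> G \<Longrightarrow> y \<in> G \<Longrightarrow> x \<oplus>\<^bsub>H\<^esub> y \<in> G" "x \<in> G \<Longrightarrow> a \<odot>\<^bsub>H\<^esub> x \<in> G"
proof -
  interpret Module.module complex_field H by fact
  note E = submoduleE[OF assms(2)]
  show "x \<in> G \<Longrightarrow> x \<in> carrier H" "\<zero>\<^bsub>H\<^esub> \<in> G"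
    "x \<in> G \<Longrightarrow> y \<in> G \<Longrightarrow> x \<oplus>\<^bsub>H\<^esub> y \<in> G" "x \<in> G \<Longrightarrow> a \<odot>\<^bsub>H\<^esub> x \<in> G"
    using E submodule_zero[OF assms(2)] by auto
qed

context inner_product_space begin

lemma module_H: "Module.module complex_field H"
  by (rule module_axioms)

lemmas subspace_D = subspaceD[OF module_H]
lemmas subspace_I = subspaceI[OF module_H]

lemma minus_eq: "\<lbrakk>x \<in> carrier H; y \<in> carrier H\<rbrakk> \<Longrightarrow> x \<ominus> y = x \<oplus> (-1) \<odot> y"
  by (simp add: a_minus_def minus_smult)

lemma subspace_minus:
  assumes "subspace_of H G" "x \<in> G" "y \<in> G"
  shows "x \<ominus> y \<in> G"
  using assms(2,3) subspace_D[OF assms(1)] by (simp add: minus_eq)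

lemma ip_minus: "\<lbrakk>x \<in> carrier H; y \<in> carrier H; z \<in> carrier H\<rbrakk> \<Longrightarrow> ip H (x \<ominus> y) z = ip H x z - ip H y z"
  by (simp add: minus_eq ip_add ip_smult)

lemma ip_minus_r: "\<lbrakk>x \<in> carrier H; y \<in> carrier H; z \<in> carrier H\<rbrakk> \<Longrightarrow> ip H z (x \<ominus> y) = ip H z x - ip H z y"
  by (simp add: minus_eq ip_add_r ip_smult_r)

lemmas ip_linear = ip_add ip_add_r ip_smult ip_smult_r ip_minus ip_minus_r

lemma eqI_ip:
  assumes "x \<in> carrier H" "y \<in> carrier H" "\<And>z. z \<in> carrier H \<Longrightarrow> ip H z x = ip H z y"
  shows "x = y"
proof -
  have "ip H (x \<ominus> y) (x \<ominus> y) = 0" using assms by (simp add: ip_minus_r)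
  hence "hnorm H (x \<ominus> y) = 0" by (simp add: hnorm_def)
  thus ?thesis using assms by (simp add: hnorm_eq0 eq_iff_minus)
qed

lemma hnorm_minus_triangle:
  assumes "x \<in> carrier H" "y \<in> carrier H" "z \<in> carrier H"
  shows "hnorm H (x \<ominus> z) \<le> hnorm H (x \<ominus> y) + hnorm H (y \<ominus> z)"
  using metric.triangle[OF assms] assms by (simp add: hdist_def)

lemma hnorm_le_minus_add:
  assumes "x \<in> carrier H" "y \<in> carrier H"
  shows "hnorm H x \<le> hnorm H (x \<ominus> y) + hnorm H y"
  using hnorm_minus_triangle[OF assms M.zero_closed] assms by (simp add: minus_eq)

lemma inner_product_space_subspace:
  assumes "subspace_of H G"
  shows "inner_product_space (H\<lparr>carrier := G\<rparr>)"
proof -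
  interpret S: Module.module complex_field "H\<lparr>carrier := G\<rparr>"
    by (rule submodule.submodule_is_module[OF assms module_H])
  show ?thesis
  proof
    show "ip (H\<lparr>carrier := G\<rparr>) y x = cnj (ip (H\<lparr>carrier := G\<rparr>) x y)"
      if "x \<in> carrier (H\<lparr>carrier := G\<rparr>)" "y \<in> carrier (H\<lparr>carrier := G\<rparr>)" for x y
      using ip_cnj[of x y] that subspace_D(1)[OF assms] by simp
  qed (use subspace_D(1)[OF assms] in \<open>auto simp: ip_add ip_smult ip_pos\<close>)
qed

lemma semi_inner_product_space: "semi_inner_product_space H (ip H)"
  by (intro semi_inner_product_space.intro semi_inner_product_space_axioms.intro module_H)
     (assumption | rule ip_add ip_smult ip_cnj ip_ge0)+

lemma hnorm_subspace [simp]: "hnorm (H\<lparr>carrier := G\<rparr>) = hnorm H"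
  by (simp add: hnorm_def fun_eq_iff)

lemma minus_subspace:
  assumes "subspace_of H G" "x \<in> G" "y \<in> G"
  shows "x \<ominus>\<^bsub>H\<lparr>carrier := G\<rparr>\<^esub> y = x \<ominus> y"
proof -
  interpret S: inner_product_space "H\<lparr>carrier := G\<rparr>" by (rule inner_product_space_subspace[OF assms(1)])
  show ?thesis using assms subspace_D(1)[OF assms(1)] S.minus_eq[of x y] by (simp add: minus_eq)
qed

lemma hnorm_limit_le:
  assumes "\<And>n. g n \<in> carrier H" "z \<in> carrier H" "(\<lambda>n. hnorm H (g n \<ominus> z)) \<longlonglongrightarrow> 0"
    and "\<And>n. hnorm H (g n) \<le> b n" "b \<longlonglongrightarrow> B"
  shows "hnorm H z \<le> B"
proof -
  have "hnorm H z \<le> hnorm H (g n \<ominus> z) + b n" for n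
    using hnorm_le_minus_add[OF assms(2) assms(1)[of n]] assms(4)[of n]
      hnorm_minus_commute[OF assms(2) assms(1)[of n]] by simp
  moreover have "(\<lambda>n. hnorm H (g n \<ominus> z) + b n) \<longlonglongrightarrow> 0 + B"
    using assms by (intro tendsto_add) auto
  ultimately show ?thesis using LIMSEQ_le_const[of "\<lambda>n. hnorm H (g n \<ominus> z) + b n" "0 + B" "hnorm H z"] by auto
qed

lemma ip_limit:
  assumes "\<And>n. g n \<in> carrier H" "z \<in> carrier H" "(\<lambda>n. hnorm H (g n \<ominus> z)) \<longlonglongrightarrow> 0" "h \<in> carrier H"
  shows "(\<lambda>n. ip H h (g n)) \<longlonglongrightarrow> ip H h z"
proof -
  have "cmod (ip H h (g n) - ip H h z) \<le> hnorm H h * hnorm H (g n \<ominus> z)" for n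
    using cauchy_schwarz[OF assms(4) M.minus_closed[OF assms(1) assms(2)]] assms by (simp add: ip_minus_r)
  moreover have "(\<lambda>n. hnorm H h * hnorm H (g n \<ominus> z)) \<longlonglongrightarrow> 0"
    using tendsto_mult_left[OF assms(3), of "hnorm H h"] by simp
  ultimately show ?thesis
    by (rule tendsto_of_norm_diff_le[of "\<lambda>n. ip H h (g n)" _ "\<lambda>n. hnorm H h * hnorm H (g n \<ominus> z)"])
qed

definition seq_closed :: "'a set \<Rightarrow> bool" where
  "seq_closed S \<longleftrightarrow> S \<subseteq> carrier H \<and> (\<forall>g z. (\<forall>n. g n \<in> S) \<longrightarrow> z \<in> carrier H \<longrightarrow>
     (\<lambda>n. hnorm H (g n \<ominus> z)) \<longlonglongrightarrow> 0 \<longrightarrow> z \<in> S)"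

lemma limitin_iff:
  assumes "\<And>n. g n \<in> carrier H" "z \<in> carrier H"
  shows "limitin metric.mtopology g z sequentially \<longleftrightarrow> (\<lambda>n. hnorm H (g n \<ominus> z)) \<longlonglongrightarrow> 0"
  using assms by (simp add: metric.limitin_metric_dist_null hdist_def)

lemma closed_in_iff: "closed_in H S \<longleftrightarrow> seq_closed S"
proof -
  have "range \<sigma> \<subseteq> S \<and> limitin metric.mtopology \<sigma> l sequentially \<longleftrightarrow>
      (\<forall>n. \<sigma> n \<in> S) \<and> l \<in> carrier H \<and> (\<lambda>n. hnorm H (\<sigma> n \<ominus> l)) \<longlonglongrightarrow> 0" if S: "S \<subseteq> carrier H" for \<sigma> l
  proof -
    have "l \<in> carrier H" if "limitin metric.mtopology \<sigma> l sequentially"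
      using that by (simp add: metric.limitin_metric)
    thus ?thesis using limitin_iff[of \<sigma> l] S by (auto simp: image_subset_iff subset_iff)
  qed
  thus ?thesis unfolding closed_in_def metric.metric_closedin_iff_sequentially_closed seq_closed_def by blast
qed

end

context hilbert_space begin

lemma Cauchy_limit:
  assumes g: "\<And>n. g n \<in> carrier H" and le: "\<And>n k. hnorm H (g n \<ominus> g k) \<le> \<epsilon> n + \<epsilon> k" and \<epsilon>: "\<epsilon> \<longlonglongrightarrow> (0::real)"
  shows "\<exists>z\<in>carrier H. (\<lambda>n. hnorm H (g n \<ominus> z)) \<longlonglongrightarrow> 0"
proof -
  have "metric.MCauchy g" unfolding metric.MCauchy_def
  proof (intro conjI allI impI)
    show "range g \<subseteq> carrier H" using g by auto
    fix e :: real assume "e > 0"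
    then obtain N where N: "\<And>n. n \<ge> N \<Longrightarrow> \<bar>\<epsilon> n\<bar> < e / 2" using LIMSEQ_D[OF \<epsilon>, of "e / 2"] by auto
    show "\<exists>N. \<forall>n n'. N \<le> n \<longrightarrow> N \<le> n' \<longrightarrow> hdist H (g n) (g n') < e"
    proof (intro exI[of _ N] allI impI)
      fix n n' assume "N \<le> n" "N \<le> n'"
      thus "hdist H (g n) (g n') < e" using N[of n] N[of n'] le[of n n'] g by (simp add: hdist_def)
    qed
  qed
  then obtain z where z: "limitin metric.mtopology g z sequentially"
    using complete unfolding metric.mcomplete_def by blast
  hence "z \<in> carrier H" by (simp add: metric.limitin_metric)
  thus ?thesis using z g limitin_iff by auto
qed

lemma hilbert_space_subspace:
  assumes G: "subspace_of H G" and cl: "seq_closed G"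
  shows "hilbert_space (H\<lparr>carrier := G\<rparr>)"
proof -
  interpret S: inner_product_space "H\<lparr>carrier := G\<rparr>" by (rule inner_product_space_subspace[OF G])
  have Gc: "G \<subseteq> carrier H" using subspace_D(1)[OF G] by auto
  have d: "hdist (H\<lparr>carrier := G\<rparr>) x y = hdist H x y" if "x \<in> G" "y \<in> G" for x y
    using that Gc by (auto simp: hdist_def minus_subspace[OF G])
  have "S.metric.mcomplete" unfolding S.metric.mcomplete_def
  proof (intro allI impI)
    fix \<sigma> assume C: "S.metric.MCauchy \<sigma>"
    hence r: "\<sigma> n \<in> G" for n unfolding S.metric.MCauchy_def by auto
    have "metric.MCauchy \<sigma>" using C r Gc d unfolding metric.MCauchy_def S.metric.MCauchy_def by auto
    then obtain z where "limitin metric.mtopology \<sigma> z sequentially"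
      using complete unfolding metric.mcomplete_def by blast
    hence z: "z \<in> carrier H" "(\<lambda>n. hdist H (\<sigma> n) z) \<longlonglongrightarrow> 0" by (auto simp: metric.limitin_metric_dist_null)
    hence "z \<in> G" using cl r Gc unfolding seq_closed_def by (auto simp: hdist_def subset_iff)
    hence "limitin S.metric.mtopology \<sigma> z sequentially"
      unfolding S.metric.limitin_metric_dist_null using z r d by simp
    thus "\<exists>x. limitin S.metric.mtopology \<sigma> x sequentially" ..
  qed
  thus ?thesis by unfold_locales
qed

text \<open>
  The representing vector is the limit of a representing sequence in \<open>G\<close>, hence lies in the closure
  of \<open>G\<close>.  This version gives projections onto closed subspaces, adjoints, and vectors that are
  prescribed only by their inner products with a dense subspace.
\<close>
lemma riesz:
  assumes G: "subspace_of H G"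
    and add: "\<And>x y. \<lbrakk>x \<in> G; y \<in> G\<rbrakk> \<Longrightarrow> \<phi> (x \<oplus> y) = \<phi> x + \<phi> y"
    and smult: "\<And>a x. x \<in> G \<Longrightarrow> \<phi> (a \<odot> x) = a * \<phi> x"
    and bound: "\<And>x. x \<in> G \<Longrightarrow> cmod (\<phi> x) \<le> K * hnorm H x" and K: "0 \<le> K"
  shows "\<exists>z\<in>carrier H. hnorm H z \<le> K \<and> (\<forall>h\<in>G. ip H h z = \<phi> h) \<and> (seq_closed G \<longrightarrow> z \<in> G)"
proof -
  interpret S: inner_product_space "H\<lparr>carrier := G\<rparr>" by (rule inner_product_space_subspace[OF G])
  interpret T: semi_inner_product_space "H\<lparr>carrier := G\<rparr>" "ip (H\<lparr>carrier := G\<rparr>)"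
    by (rule S.semi_inner_product_space)
  have q: "sqrt (T.q x) = hnorm H x" for x by (simp add: hnorm_def)
  note q' = q[simplified]
  obtain g \<epsilon> where ap: "T.approx \<phi> g \<epsilon>"
    using T.approx_exists[of \<phi> K] add smult bound by (auto simp: q')
  have g: "g n \<in> G" "g n \<in> carrier H" for n using ap subspace_D(1)[OF G] unfolding T.approx_def by auto
  have \<epsilon>: "\<epsilon> \<longlonglongrightarrow> 0" "0 \<le> \<epsilon> n" for n using ap unfolding T.approx_def by auto
  have "hnorm H (g n \<ominus> g k) \<le> \<epsilon> n + \<epsilon> k" for n k
    using T.approx_dist[OF ap ap, of n k] g by (simp add: q' minus_eq)
  from Cauchy_limit[OF g(2) this \<epsilon>(1)] obtain z
    where z: "z \<in> carrier H" "(\<lambda>n. hnorm H (g n \<ominus> z)) \<longlonglongrightarrow> 0" by blast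
  have "hnorm H (g n) \<le> K + \<epsilon> n" for n
    using T.approx_bound[OF ap, of K n] bound K by (simp add: q')
  moreover have "(\<lambda>n. K + \<epsilon> n) \<longlonglongrightarrow> K" using tendsto_add[OF tendsto_const \<epsilon>(1), of K] by simp
  ultimately have "hnorm H z \<le> K" by (rule hnorm_limit_le[OF g(2) z])
  moreover have "ip H h z = \<phi> h" if h: "h \<in> G" for h
  proof (rule LIMSEQ_unique)
    show "(\<lambda>n. ip H h (g n)) \<longlonglongrightarrow> ip H h z" using ip_limit[OF g(2) z] h subspace_D(1)[OF G] by blast
    have "cmod (ip H h (g n) - \<phi> h) \<le> \<epsilon> n * hnorm H h" for n
      using ap h unfolding T.approx_def by (auto simp: q')
    moreover have "(\<lambda>n. \<epsilon> n * hnorm H h) \<longlonglongrightarrow> 0" using tendsto_mult_right[OF \<epsilon>(1), of "hnorm H h"] by simp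
    ultimately show "(\<lambda>n. ip H h (g n)) \<longlonglongrightarrow> \<phi> h"
      by (rule tendsto_of_norm_diff_le[of "\<lambda>n. ip H h (g n)" _ "\<lambda>n. \<epsilon> n * hnorm H h"])
  qed
  moreover have "z \<in> G" if "seq_closed G" using that g z unfolding seq_closed_def by blast
  ultimately show ?thesis using z(1) by blast
qed

end

context hilbert_space begin

lemma projection_exists:
  assumes G: "subspace_of H G" and cl: "seq_closed G" and x: "x \<in> carrier H"
  shows "\<exists>z\<in>G. \<forall>h\<in>G. ip H h z = ip H h x"
proof -
  note Gc = subspace_D(1)[OF G]
  have "\<exists>z\<in>carrier H. hnorm H z \<le> hnorm H x \<and> (\<forall>h\<in>G. ip H h z = ip H h x) \<and> (seq_closed G \<longrightarrow> z \<in> G)"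
  proof (rule riesz[OF G])
    show "cmod (ip H y x) \<le> hnorm H x * hnorm H y" if "y \<in> G" for y
      using cauchy_schwarz[OF Gc[OF that] x] by (simp add: mult.commute)
  qed (simp_all add: x Gc ip_add ip_smult hnorm_ge0)
  thus ?thesis using cl by blast
qed

end

text \<open>
  The extension is \<open>c\<close> after the \<open>t\<close>-orthogonal projection onto the closure of \<open>G\<close>.  The projection
  of \<open>x\<close> is available only as a sequence in \<open>G\<close> that represents the functional \<open>t _ x\<close>; the bound on
  \<open>c\<close> turns it into a Cauchy sequence in the complete space \<open>K\<close>.
\<close>
lemma (in semi_inner_product_space) extend_operator:
  assumes K: "hilbert_space K" and G: "subspace_of V G"
    and c: "\<And>x. x \<in> G \<Longrightarrow> c x \<in> carrier K"
    and add: "\<And>x y. \<lbrakk>x \<in> G; y \<in> G\<rbrakk> \<Longrightarrow> c (x \<oplus> y) = c x \<oplus>\<^bsub>K\<^esub> c y"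
    and smult: "\<And>a x. x \<in> G \<Longrightarrow> c (a \<odot> x) = a \<odot>\<^bsub>K\<^esub> c x"
    and bound: "\<And>x. x \<in> G \<Longrightarrow> (hnorm K (c x))\<^sup>2 \<le> q x"
  shows "\<exists>C. (\<forall>x\<in>carrier V. C x \<in> carrier K) \<and>
    (\<forall>x\<in>carrier V. \<forall>y\<in>carrier V. C (x \<oplus> y) = C x \<oplus>\<^bsub>K\<^esub> C y) \<and>
    (\<forall>a. \<forall>x\<in>carrier V. C (a \<odot> x) = a \<odot>\<^bsub>K\<^esub> C x) \<and>
    (\<forall>x\<in>carrier V. (hnorm K (C x))\<^sup>2 \<le> q x) \<and> (\<forall>x\<in>G. C x = c x)"
proof -
  interpret K: hilbert_space K by fact
  have mV: "Module.module complex_field V" by (rule module_axioms)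
  note Gc = subspaceD(1)[OF mV G]
  interpret S: semi_inner_product_space "V\<lparr>carrier := G\<rparr>" t
  proof (intro semi_inner_product_space.intro semi_inner_product_space_axioms.intro)
    show "Module.module complex_field (V\<lparr>carrier := G\<rparr>)"
      by (rule submodule.submodule_is_module[OF G mV])
    show "t y x = cnj (t x y)" if "x \<in> carrier (V\<lparr>carrier := G\<rparr>)" "y \<in> carrier (V\<lparr>carrier := G\<rparr>)" for x y
      using that Gc by (intro t_cnj) auto
  qed (use Gc in \<open>auto simp: t_add t_smult t_ge0\<close>)
  have bound': "hnorm K (c x) \<le> sqrt (q x)" if "x \<in> G" for x
    using bound[OF that] by (rule real_le_rsqrt)
  have diff: "hnorm K (c x \<ominus>\<^bsub>K\<^esub> c y) \<le> sqrt (q (x \<oplus> (-1) \<odot> y))" if "x \<in> G" "y \<in> G" for x y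
    using bound'[of "x \<oplus> (-1) \<odot> y"] that c subspaceD(3,4)[OF mV G]
    by (simp add: add smult K.minus_eq)
  \<comment> \<open>\<open>c\<close> maps some sequence that represents the projection of \<open>x\<close> to a sequence with limit \<open>z\<close>\<close>
  define lim where "lim x z \<longleftrightarrow> z \<in> carrier K \<and>
    (\<exists>g \<epsilon>. S.approx (\<lambda>h. t h x) g \<epsilon> \<and> (\<lambda>n. hnorm K (c (g n) \<ominus>\<^bsub>K\<^esub> z)) \<longlonglongrightarrow> 0)" for x z
  have apG: "g n \<in> G" if "S.approx \<phi> g \<epsilon>" for \<phi> g \<epsilon> n using that by (simp add: S.approx_def)
  have lim_ex: "\<exists>z. lim x z" if x: "x \<in> carrier V" for x
  proof -
    have "\<exists>g \<epsilon>. S.approx (\<lambda>h. t h x) g \<epsilon>"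
      using x Gc t_cauchy_schwarz[OF x] by (intro S.approx_exists[of _ "sqrt (q x)"]) (auto simp: t_add t_smult)
    then obtain g \<epsilon> where ap: "S.approx (\<lambda>h. t h x) g \<epsilon>" by blast
    note gG = apG[OF ap]
    have "hnorm K (c (g n) \<ominus>\<^bsub>K\<^esub> c (g k)) \<le> \<epsilon> n + \<epsilon> k" for n k
      using diff[OF gG gG, of n k] S.approx_dist[OF ap ap, of n k] by simp
    moreover have "\<epsilon> \<longlonglongrightarrow> 0" using ap by (simp add: S.approx_def)
    ultimately obtain z where "z \<in> carrier K" "(\<lambda>n. hnorm K (c (g n) \<ominus>\<^bsub>K\<^esub> z)) \<longlonglongrightarrow> 0"
      using K.Cauchy_limit[of "\<lambda>n. c (g n)" \<epsilon>] c gG by blast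
    thus ?thesis using ap unfolding lim_def by blast
  qed
  have lim_unique: "z = z'" if l1: "lim x z" and l2: "lim x z'" for x z z'
  proof -
    obtain g \<epsilon> where ap1: "S.approx (\<lambda>h. t h x) g \<epsilon>"
      and gz: "(\<lambda>n. hnorm K (c (g n) \<ominus>\<^bsub>K\<^esub> z)) \<longlonglongrightarrow> 0" using l1 unfolding lim_def by blast
    obtain h \<delta> where ap2: "S.approx (\<lambda>h. t h x) h \<delta>"
      and hz: "(\<lambda>n. hnorm K (c (h n) \<ominus>\<^bsub>K\<^esub> z')) \<longlonglongrightarrow> 0" using l2 unfolding lim_def by blast
    note ap = ap1 ap2
    have zc: "z \<in> carrier K" "z' \<in> carrier K" using l1 l2 by (auto simp: lim_def)
    note gG = apG[OF ap(1)] and hG = apG[OF ap(2)]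
    have "hnorm K (z \<ominus>\<^bsub>K\<^esub> z') \<le> hnorm K (c (g n) \<ominus>\<^bsub>K\<^esub> z) + (\<epsilon> n + \<delta> n) + hnorm K (c (h n) \<ominus>\<^bsub>K\<^esub> z')" for n
    proof -
      have "hnorm K (c (g n) \<ominus>\<^bsub>K\<^esub> c (h n)) \<le> \<epsilon> n + \<delta> n"
        using diff[OF gG hG, of n n] S.approx_dist[OF ap, of n n] by simp
      moreover have "hnorm K (z \<ominus>\<^bsub>K\<^esub> z') \<le> hnorm K (z \<ominus>\<^bsub>K\<^esub> c (g n)) + hnorm K (c (g n) \<ominus>\<^bsub>K\<^esub> z')"
        "hnorm K (c (g n) \<ominus>\<^bsub>K\<^esub> z') \<le> hnorm K (c (g n) \<ominus>\<^bsub>K\<^esub> c (h n)) + hnorm K (c (h n) \<ominus>\<^bsub>K\<^esub> z')"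
        using zc c gG hG by (auto intro: K.hnorm_minus_triangle)
      moreover have "hnorm K (z \<ominus>\<^bsub>K\<^esub> c (g n)) = hnorm K (c (g n) \<ominus>\<^bsub>K\<^esub> z)"
        using zc c gG by (intro K.hnorm_minus_commute) auto
      ultimately show ?thesis by linarith
    qed
    moreover have "(\<lambda>n. hnorm K (c (g n) \<ominus>\<^bsub>K\<^esub> z) + (\<epsilon> n + \<delta> n) + hnorm K (c (h n) \<ominus>\<^bsub>K\<^esub> z')) \<longlonglongrightarrow> 0 + (0 + 0) + 0"
      using ap by (intro tendsto_add gz hz) (auto simp: S.approx_def)
    ultimately have "hnorm K (z \<ominus>\<^bsub>K\<^esub> z') \<le> 0 + (0 + 0) + 0" by (meson LIMSEQ_le_const)
    hence "hnorm K (z \<ominus>\<^bsub>K\<^esub> z') = 0" using zc K.hnorm_ge0[of "z \<ominus>\<^bsub>K\<^esub> z'"] by simp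
    thus ?thesis using zc by (simp add: K.hnorm_eq0 K.eq_iff_minus)
  qed
  define C where "C x = (THE z. lim x z)" for x
  have C: "lim x (C x)" if "x \<in> carrier V" for x
    unfolding C_def using lim_ex[OF that] lim_unique by (metis theI)
  have Cc: "C x \<in> carrier K" if "x \<in> carrier V" for x using C[OF that] by (simp add: lim_def)
  have C_eq: "C x = z" if "lim x z" "x \<in> carrier V" for x z using lim_unique[OF C that(1)] that(2) by blast
  have comb: "C (x \<oplus> a \<odot> y) = C x \<oplus>\<^bsub>K\<^esub> a \<odot>\<^bsub>K\<^esub> C y" if x: "x \<in> carrier V" and y: "y \<in> carrier V" for x y a
  proof (rule C_eq)
    obtain g \<epsilon> where ap1: "S.approx (\<lambda>h. t h x) g \<epsilon>"
      and gz: "(\<lambda>n. hnorm K (c (g n) \<ominus>\<^bsub>K\<^esub> C x)) \<longlonglongrightarrow> 0" using C[OF x] unfolding lim_def by blast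
    obtain h \<delta> where ap2: "S.approx (\<lambda>h. t h y) h \<delta>"
      and hz: "(\<lambda>n. hnorm K (c (h n) \<ominus>\<^bsub>K\<^esub> C y)) \<longlonglongrightarrow> 0" using C[OF y] unfolding lim_def by blast
    note ap = ap1 ap2
    note gG = apG[OF ap(1)] and hG = apG[OF ap(2)]
    have "S.approx (\<lambda>z. t z x + cnj a * t z y) (\<lambda>n. g n \<oplus> a \<odot> h n) (\<lambda>n. \<epsilon> n + cmod a * \<delta> n)"
      using S.approx_add_smult[OF ap] by simp
    hence ap3: "S.approx (\<lambda>z. t z (x \<oplus> a \<odot> y)) (\<lambda>n. g n \<oplus> a \<odot> h n) (\<lambda>n. \<epsilon> n + cmod a * \<delta> n)"
      using x y Gc unfolding S.approx_def by (simp add: t_add_r t_smult_r)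
    have "hnorm K (c (g n \<oplus> a \<odot> h n) \<ominus>\<^bsub>K\<^esub> (C x \<oplus>\<^bsub>K\<^esub> a \<odot>\<^bsub>K\<^esub> C y))
        \<le> hnorm K (c (g n) \<ominus>\<^bsub>K\<^esub> C x) + cmod a * hnorm K (c (h n) \<ominus>\<^bsub>K\<^esub> C y)" for n
    proof -
      have cc: "c (g n) \<in> carrier K" "c (h n) \<in> carrier K" "C x \<in> carrier K" "C y \<in> carrier K"
        using c gG hG Cc x y by auto
      have "c (g n \<oplus> a \<odot> h n) \<ominus>\<^bsub>K\<^esub> (C x \<oplus>\<^bsub>K\<^esub> a \<odot>\<^bsub>K\<^esub> C y)
          = (c (g n) \<ominus>\<^bsub>K\<^esub> C x) \<oplus>\<^bsub>K\<^esub> a \<odot>\<^bsub>K\<^esub> (c (h n) \<ominus>\<^bsub>K\<^esub> C y)"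
        using cc gG hG subspaceD(4)[OF mV G]
        by (intro K.eqI_ip) (simp_all add: add smult K.ip_linear algebra_simps)
      thus ?thesis using cc K.hnorm_triangle[of "c (g n) \<ominus>\<^bsub>K\<^esub> C x" "a \<odot>\<^bsub>K\<^esub> (c (h n) \<ominus>\<^bsub>K\<^esub> C y)"]
        by (simp add: K.hnorm_smult)
    qed
    moreover have "0 \<le> hnorm K (c (g n \<oplus> a \<odot> h n) \<ominus>\<^bsub>K\<^esub> (C x \<oplus>\<^bsub>K\<^esub> a \<odot>\<^bsub>K\<^esub> C y))" for n
      using c gG hG Cc x y subspaceD(3,4)[OF mV G] by (intro K.hnorm_ge0) auto
    moreover have "(\<lambda>n. hnorm K (c (g n) \<ominus>\<^bsub>K\<^esub> C x) + cmod a * hnorm K (c (h n) \<ominus>\<^bsub>K\<^esub> C y)) \<longlonglongrightarrow> 0"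
      using tendsto_add[OF gz tendsto_mult_left[OF hz, of "cmod a"]] by simp
    ultimately have "(\<lambda>n. hnorm K (c (g n \<oplus> a \<odot> h n) \<ominus>\<^bsub>K\<^esub> (C x \<oplus>\<^bsub>K\<^esub> a \<odot>\<^bsub>K\<^esub> C y))) \<longlonglongrightarrow> 0"
      by - (rule tendsto_of_norm_diff_le[where l = 0 and
          b = "\<lambda>n. hnorm K (c (g n) \<ominus>\<^bsub>K\<^esub> C x) + cmod a * hnorm K (c (h n) \<ominus>\<^bsub>K\<^esub> C y)"]; simp)
    thus "lim (x \<oplus> a \<odot> y) (C x \<oplus>\<^bsub>K\<^esub> a \<odot>\<^bsub>K\<^esub> C y)" using ap3 Cc x y unfolding lim_def by auto
  qed (use x y in simp)
  have onG: "C x = c x" if x: "x \<in> G" for x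
  proof (rule C_eq[OF _ Gc[OF x]])
    have "S.approx (\<lambda>h. t h x) (\<lambda>n. x) (\<lambda>n. 0)" using x by (simp add: S.approx_def)
    moreover have "(\<lambda>n. hnorm K (c x \<ominus>\<^bsub>K\<^esub> c x)) \<longlonglongrightarrow> 0"
      using c[OF x] K.eq_iff_minus[of "c x" "c x"] K.hnorm_eq0[of "c x \<ominus>\<^bsub>K\<^esub> c x"] by simp
    ultimately show "lim x (c x)" using c[OF x] unfolding lim_def by blast
  qed
  have "C (x \<oplus> y) = C x \<oplus>\<^bsub>K\<^esub> C y" if "x \<in> carrier V" "y \<in> carrier V" for x y
    using comb[OF that, of 1] that Cc smult_one[of y] K.smult_one[of "C y"] by simp
  moreover have "C (a \<odot> x) = a \<odot>\<^bsub>K\<^esub> C x" if x: "x \<in> carrier V" for x a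
  proof -
    have "c \<zero> = \<zero>\<^bsub>K\<^esub>" using smult[of "\<zero>" 0] subspaceD(2)[OF mV G] c[of \<zero>] K.smult_l_null[of "c \<zero>"] by simp
    hence "C \<zero> = \<zero>\<^bsub>K\<^esub>" using onG subspaceD(2)[OF mV G] by simp
    thus ?thesis using comb[OF M.zero_closed x, of a] x Cc by simp
  qed
  moreover have "(hnorm K (C x))\<^sup>2 \<le> q x" if x: "x \<in> carrier V" for x
  proof -
    obtain g \<epsilon> where ap: "S.approx (\<lambda>h. t h x) g \<epsilon>" and gz: "(\<lambda>n. hnorm K (c (g n) \<ominus>\<^bsub>K\<^esub> C x)) \<longlonglongrightarrow> 0"
      using C[OF x] unfolding lim_def by blast
    note gG = apG[OF ap]
    have "hnorm K (c (g n)) \<le> sqrt (q x) + \<epsilon> n" for n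
      using bound'[OF gG, of n] S.approx_bound[OF ap, of "sqrt (q x)" n] t_cauchy_schwarz[OF x] Gc t_ge0[OF x] by fastforce
    moreover have "(\<lambda>n. sqrt (q x) + \<epsilon> n) \<longlonglongrightarrow> sqrt (q x) + 0"
      using ap by (intro tendsto_intros) (simp add: S.approx_def)
    ultimately have "hnorm K (C x) \<le> sqrt (q x)"
      using K.hnorm_limit_le[OF c[OF gG] Cc[OF x] gz, of "\<lambda>n. sqrt (q x) + \<epsilon> n" "sqrt (q x)"] by simp
    thus ?thesis using K.hnorm_ge0[OF Cc[OF x]] t_ge0[OF x] real_sqrt_pow2 power_mono by metis
  qed
  ultimately show ?thesis using Cc onG by (intro exI[of _ C]) blast
qed

section \<open>Bounded operators\<close>

lemma (in inner_product_space) eq_if_ip_minus: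
  assumes "x \<in> carrier H" "y \<in> carrier H" "ip H (x \<ominus> y) (x \<ominus> y) = 0"
  shows "x = y"
proof -
  have "hnorm H (x \<ominus> y) = 0" using assms(3) by (simp add: hnorm_def)
  thus ?thesis using hnorm_eq0[OF M.minus_closed[OF assms(1,2)]] eq_iff_minus[OF assms(1,2)] by simp
qed

locale bounded_operator = H: inner_product_space H + K: inner_product_space K
  for H :: "('a, 'y) hilbert_scheme" and K :: "('b, 'z) hilbert_scheme" +
  fixes T :: "'a \<Rightarrow> 'b"
  assumes bounded: "bounded_op H K T"
begin

lemma closed [simp, intro]: "x \<in> carrier H \<Longrightarrow> T x \<in> carrier K"
  and add: "\<lbrakk>x \<in> carrier H; y \<in> carrier H\<rbrakk> \<Longrightarrow> T (x \<oplus>\<^bsub>H\<^esub> y) = T x \<oplus>\<^bsub>K\<^esub> T y"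
  and smult: "x \<in> carrier H \<Longrightarrow> T (a \<odot>\<^bsub>H\<^esub> x) = a \<odot>\<^bsub>K\<^esub> T x"
  using bounded unfolding bounded_op_def by auto

lemma zero: "T \<zero>\<^bsub>H\<^esub> = \<zero>\<^bsub>K\<^esub>"
  using smult[of "\<zero>\<^bsub>H\<^esub>" 0] H.smult_l_null[of "\<zero>\<^bsub>H\<^esub>"] K.smult_l_null[of "T \<zero>\<^bsub>H\<^esub>"] by simp

lemma minus: "\<lbrakk>x \<in> carrier H; y \<in> carrier H\<rbrakk> \<Longrightarrow> T (x \<ominus>\<^bsub>H\<^esub> y) = T x \<ominus>\<^bsub>K\<^esub> T y"
  by (simp add: H.minus_eq K.minus_eq add smult)

lemma bound_ex: "\<exists>C>0. \<forall>x\<in>carrier H. hnorm K (T x) \<le> C * hnorm H x"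
proof -
  obtain C where C: "\<And>x. x \<in> carrier H \<Longrightarrow> hnorm K (T x) \<le> C * hnorm H x"
    using bounded unfolding bounded_op_def by blast
  have "hnorm K (T x) \<le> (\<bar>C\<bar> + 1) * hnorm H x" if "x \<in> carrier H" for x
    using C[OF that] mult_right_mono[of C "\<bar>C\<bar> + 1" "hnorm H x"] H.hnorm_ge0[OF that] by linarith
  thus ?thesis by (intro exI[of _ "\<bar>C\<bar> + 1"]) auto
qed

lemma subspace_kernel: "subspace_of H {x \<in> carrier H. T x = \<zero>\<^bsub>K\<^esub>}"
  by (rule H.subspace_I) (auto simp: add smult zero)

lemma subspace_range: "subspace_of K (T ` carrier H)"
proof (rule K.subspace_I)
  show "\<zero>\<^bsub>K\<^esub> \<in> T ` carrier H" using zero by (metis H.M.zero_closed image_eqI)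
qed (auto simp: add[symmetric] smult[symmetric])

lemma limit:
  assumes "\<And>n. g n \<in> carrier H" "z \<in> carrier H" "(\<lambda>n. hnorm H (g n \<ominus>\<^bsub>H\<^esub> z)) \<longlonglongrightarrow> 0"
  shows "(\<lambda>n. hnorm K (T (g n) \<ominus>\<^bsub>K\<^esub> T z)) \<longlonglongrightarrow> 0"
proof -
  obtain C where C: "\<And>x. x \<in> carrier H \<Longrightarrow> hnorm K (T x) \<le> C * hnorm H x" using bound_ex by blast
  have "norm (hnorm K (T (g n) \<ominus>\<^bsub>K\<^esub> T z) - 0) \<le> C * hnorm H (g n \<ominus>\<^bsub>H\<^esub> z)" for n
    using C[of "g n \<ominus>\<^bsub>H\<^esub> z"] assms(1,2) by (simp add: minus K.hnorm_ge0)
  moreover have "(\<lambda>n. C * hnorm H (g n \<ominus>\<^bsub>H\<^esub> z)) \<longlonglongrightarrow> 0"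
    using tendsto_mult_left[OF assms(3), of C] by simp
  ultimately show ?thesis
    by (rule tendsto_of_norm_diff_le[of "\<lambda>n. hnorm K (T (g n) \<ominus>\<^bsub>K\<^esub> T z)"])
qed

lemma seq_closed_kernel: "H.seq_closed {x \<in> carrier H. T x = \<zero>\<^bsub>K\<^esub>}"
  unfolding H.seq_closed_def
proof (intro conjI allI impI)
  fix g z assume g: "\<forall>n. g n \<in> {x \<in> carrier H. T x = \<zero>\<^bsub>K\<^esub>}" and z: "z \<in> carrier H"
    and lim: "(\<lambda>n. hnorm H (g n \<ominus>\<^bsub>H\<^esub> z)) \<longlonglongrightarrow> 0"
  have "(\<lambda>n. hnorm K (T (g n) \<ominus>\<^bsub>K\<^esub> T z)) \<longlonglongrightarrow> 0" using g by (intro limit[OF _ z lim]) auto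
  hence "hnorm K (\<zero>\<^bsub>K\<^esub> \<ominus>\<^bsub>K\<^esub> T z) = 0" using g by (simp add: LIMSEQ_const_iff)
  hence "T z = \<zero>\<^bsub>K\<^esub>" using z K.hnorm_eq0[of "\<zero>\<^bsub>K\<^esub> \<ominus>\<^bsub>K\<^esub> T z"] K.eq_iff_minus[of "\<zero>\<^bsub>K\<^esub>" "T z"] by simp
  thus "z \<in> {x \<in> carrier H. T x = \<zero>\<^bsub>K\<^esub>}" using z by simp
qed auto

end

lemma bounded_operatorI:
  assumes "inner_product_space H" "inner_product_space K"
    and "\<And>x. x \<in> carrier H \<Longrightarrow> T x \<in> carrier K"
    and "\<And>x y. \<lbrakk>x \<in> carrier H; y \<in> carrier H\<rbrakk> \<Longrightarrow> T (x \<oplus>\<^bsub>H\<^esub> y) = T x \<oplus>\<^bsub>K\<^esub> T y"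
    and "\<And>a x. x \<in> carrier H \<Longrightarrow> T (a \<odot>\<^bsub>H\<^esub> x) = a \<odot>\<^bsub>K\<^esub> T x"
    and "\<And>x. x \<in> carrier H \<Longrightarrow> hnorm K (T x) \<le> C * hnorm H x"
  shows "bounded_operator H K T"
  using assms unfolding bounded_operator_def bounded_operator_axioms_def bounded_op_def by blast

text \<open>
  Stated without reference to a Hilbert space structure, so that it applies to quotients, of which
  only the operations and the norm are used.
\<close>
lemma bounded_op_comp:
  assumes T: "bounded_op H K T" and S: "bounded_op K L S"
    and nonneg: "\<And>y. y \<in> carrier K \<Longrightarrow> 0 \<le> hnorm K y"
  shows "bounded_op H L (\<lambda>x. S (T x))"
proof -
  obtain C where C: "\<And>y. y \<in> carrier K \<Longrightarrow> hnorm L (S y) \<le> C * hnorm K y"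
    using S unfolding bounded_op_def by blast
  obtain B where B: "\<And>x. x \<in> carrier H \<Longrightarrow> hnorm K (T x) \<le> B * hnorm H x"
    using T unfolding bounded_op_def by blast
  have Tc: "T x \<in> carrier K" if "x \<in> carrier H" for x using T that unfolding bounded_op_def by auto
  have "hnorm L (S (T x)) \<le> (\<bar>C\<bar> * B) * hnorm H x" if x: "x \<in> carrier H" for x
  proof -
    have "hnorm L (S (T x)) \<le> \<bar>C\<bar> * hnorm K (T x)"
      using C[OF Tc[OF x]] mult_right_mono[of C "\<bar>C\<bar>" "hnorm K (T x)"] nonneg[OF Tc[OF x]] by linarith
    also have "\<dots> \<le> \<bar>C\<bar> * (B * hnorm H x)" using B[OF x] by (rule mult_left_mono) simp
    finally show ?thesis by (simp add: mult.assoc)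
  qed
  thus ?thesis using T S Tc unfolding bounded_op_def by auto
qed

context hilbert_space begin

lemma seq_closed_orthogonal:
  assumes "S \<subseteq> carrier H"
  shows "subspace_of H {x \<in> carrier H. \<forall>h\<in>S. ip H h x = 0}" "seq_closed {x \<in> carrier H. \<forall>h\<in>S. ip H h x = 0}"
proof -
  show "subspace_of H {x \<in> carrier H. \<forall>h\<in>S. ip H h x = 0}"
    by (rule subspace_I) (use assms in \<open>auto simp: ip_add_r ip_smult_r subset_iff\<close>)
  show "seq_closed {x \<in> carrier H. \<forall>h\<in>S. ip H h x = 0}" unfolding seq_closed_def
  proof (intro conjI allI impI)
    fix g z assume g: "\<forall>n. g n \<in> {x \<in> carrier H. \<forall>h\<in>S. ip H h x = 0}" and z: "z \<in> carrier H"
      and lim: "(\<lambda>n. hnorm H (g n \<ominus> z)) \<longlonglongrightarrow> 0"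
    have "ip H h z = 0" if h: "h \<in> S" for h
    proof -
      have "(\<lambda>n. ip H h (g n)) \<longlonglongrightarrow> ip H h z" using g h assms by (intro ip_limit[OF _ z lim]) auto
      thus ?thesis using g h by (simp add: LIMSEQ_const_iff)
    qed
    thus "z \<in> {x \<in> carrier H. \<forall>h\<in>S. ip H h x = 0}" using z by simp
  qed auto
qed

definition proj :: "'a set \<Rightarrow> 'a \<Rightarrow> 'a" where
  "proj G x = (SOME z. z \<in> G \<and> (\<forall>h\<in>G. ip H h z = ip H h x))"

context
  fixes G assumes G: "subspace_of H G" and cl: "seq_closed G"
begin

lemma proj_in: "x \<in> carrier H \<Longrightarrow> proj G x \<in> G"
  and ip_proj: "x \<in> carrier H \<Longrightarrow> h \<in> G \<Longrightarrow> ip H h (proj G x) = ip H h x"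
  using someI_ex[of "\<lambda>z. z \<in> G \<and> (\<forall>h\<in>G. ip H h z = ip H h x)"] projection_exists[OF G cl, of x]
  unfolding proj_def[symmetric] by blast+

lemma proj_in_carrier: "x \<in> carrier H \<Longrightarrow> proj G x \<in> carrier H"
  using proj_in subspace_D(1)[OF G] by blast

lemma proj_unique:
  assumes x: "x \<in> carrier H" and z: "z \<in> G" "\<And>h. h \<in> G \<Longrightarrow> ip H h z = ip H h x"
  shows "proj G x = z"
proof -
  have d: "proj G x \<ominus> z \<in> G" using proj_in[OF x] z(1) by (rule subspace_minus[OF G])
  note c = proj_in_carrier[OF x] subspace_D(1)[OF G z(1)] subspace_D(1)[OF G d]
  have "ip H (proj G x \<ominus> z) (proj G x \<ominus> z) = 0"
    using c ip_proj[OF x d] z(2)[OF d] ip_minus_r[OF c] by simp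
  thus ?thesis using eq_if_ip_minus[OF c(1,2)] by simp
qed

lemma orthogonal_minus_proj: "\<lbrakk>x \<in> carrier H; h \<in> G\<rbrakk> \<Longrightarrow> ip H h (x \<ominus> proj G x) = 0"
  using ip_proj proj_in_carrier subspace_D(1)[OF G] by (simp add: ip_minus_r)

lemma bounded_operator_minus_proj: "bounded_operator H H (\<lambda>x. x \<ominus> proj G x)"
proof (rule bounded_operatorI[where C = 1])
  show "inner_product_space H" "inner_product_space H" by unfold_locales
  show c: "x \<ominus> proj G x \<in> carrier H" if "x \<in> carrier H" for x using that proj_in_carrier by simp
  note Gc = subspace_D(1)[OF G]
  show "(x \<oplus> y) \<ominus> proj G (x \<oplus> y) = (x \<ominus> proj G x) \<oplus> (y \<ominus> proj G y)" if xy: "x \<in> carrier H" "y \<in> carrier H" for x y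
  proof -
    have "proj G (x \<oplus> y) = proj G x \<oplus> proj G y"
      using xy proj_in subspace_D(3)[OF G] ip_proj proj_in_carrier Gc
      by (intro proj_unique) (auto simp: ip_add_r)
    thus ?thesis using xy proj_in_carrier by (intro eqI_ip) (auto simp: ip_linear)
  qed
  show "(a \<odot> x) \<ominus> proj G (a \<odot> x) = a \<odot> (x \<ominus> proj G x)" if x: "x \<in> carrier H" for a x
  proof -
    have "proj G (a \<odot> x) = a \<odot> proj G x"
      using x proj_in subspace_D(4)[OF G] ip_proj proj_in_carrier Gc
      by (intro proj_unique) (auto simp: ip_smult_r)
    thus ?thesis using x proj_in_carrier by (intro eqI_ip) (auto simp: ip_linear algebra_simps)
  qed
  show "hnorm H (x \<ominus> proj G x) \<le> 1 * hnorm H x" if x: "x \<in> carrier H" for x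
  proof -
    have "x = proj G x \<oplus> (x \<ominus> proj G x)" using x proj_in_carrier by (intro eqI_ip) (auto simp: ip_linear)
    hence "(hnorm H x)\<^sup>2 = (hnorm H (proj G x))\<^sup>2 + (hnorm H (x \<ominus> proj G x))\<^sup>2"
      using hnorm_add_sq[OF proj_in_carrier[OF x] c[OF x]] orthogonal_minus_proj[OF x proj_in[OF x]] by simp
    hence "(hnorm H (x \<ominus> proj G x))\<^sup>2 \<le> (hnorm H x)\<^sup>2" by simp
    thus ?thesis using power2_le_imp_le hnorm_ge0[OF x] by simp
  qed
qed

text \<open>
  The difference of \<open>x\<close> and its projection is orthogonal to \<open>G\<close>, hence to \<open>x\<close> and to the projection
  of \<open>x\<close>, hence to itself.
\<close>
lemma in_subspace_if_orthogonal_complement: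
  assumes x: "x \<in> carrier H" and "\<And>z. \<lbrakk>z \<in> carrier H; \<And>h. h \<in> G \<Longrightarrow> ip H h z = 0\<rbrakk> \<Longrightarrow> ip H x z = 0"
  shows "x \<in> G"
proof -
  let ?z = "x \<ominus> proj G x"
  have c: "proj G x \<in> carrier H" "?z \<in> carrier H" using x proj_in_carrier by auto
  have "ip H x ?z = 0" using c x orthogonal_minus_proj by (intro assms(2)) auto
  moreover have "ip H (proj G x) ?z = 0" using orthogonal_minus_proj[OF x proj_in[OF x]] .
  ultimately have "ip H ?z ?z = 0" using x c(1) ip_minus[OF x c] by simp
  hence "x = proj G x" using eq_if_ip_minus[OF x c(1)] by simp
  thus ?thesis using proj_in[OF x] by simp
qed

end

end

section \<open>Injective operators with closed range\<close>

lemma (in bounded_operator) adjoint_exists: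
  assumes "hilbert_space H" and v: "v \<in> carrier K"
  shows "\<exists>w\<in>carrier H. \<forall>x\<in>carrier H. ip K (T x) v = ip H x w"
proof -
  interpret HH: hilbert_space H by fact
  obtain C where C: "C > 0" "\<And>x. x \<in> carrier H \<Longrightarrow> hnorm K (T x) \<le> C * hnorm H x" using bound_ex by blast
  have "\<exists>z\<in>carrier H. hnorm H z \<le> C * hnorm K v \<and> (\<forall>h\<in>carrier H. ip H h z = ip K (T h) v) \<and>
      (H.seq_closed (carrier H) \<longrightarrow> z \<in> carrier H)"
  proof (rule HH.riesz[OF H.carrier_is_submodule])
    fix x assume x: "x \<in> carrier H"
    have "cmod (ip K (T x) v) \<le> hnorm K (T x) * hnorm K v" using x v by (intro K.cauchy_schwarz) auto
    also have "\<dots> \<le> (C * hnorm H x) * hnorm K v" using C(2)[OF x] K.hnorm_ge0[OF v] by (rule mult_right_mono)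
    finally show "cmod (ip K (T x) v) \<le> C * hnorm K v * hnorm H x" by (simp add: mult_ac)
  qed (use v C K.hnorm_ge0[OF v] in \<open>simp_all add: add smult K.ip_add K.ip_smult\<close>)
  thus ?thesis by metis
qed

text \<open>
  The vectors \<open>T x\<close> with \<open>\<parallel>x\<parallel> \<le> k\<close> form a closed set, because \<open>\<parallel>x\<parallel> \<le> k\<close> can be tested on the range of
  the adjoint of \<open>T\<close>, that is, by inner products of \<open>T x\<close> with fixed vectors.  These sets cover the
  range, which is complete.  So one of them contains a ball, by Baire's theorem, and differences of
  its members yield a bound on a ball around zero.
\<close>
lemma (in bounded_operator) bounded_below:
  assumes "hilbert_space H" "hilbert_space K"
    and inj: "\<And>x. x \<in> carrier H \<Longrightarrow> T x = \<zero>\<^bsub>K\<^esub> \<Longrightarrow> x = \<zero>\<^bsub>H\<^esub>"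
    and closed_range: "K.seq_closed (T ` carrier H)"
  shows "\<exists>C. \<forall>x\<in>carrier H. hnorm H x \<le> C * hnorm K (T x)"
proof -
  interpret HH: hilbert_space H by fact
  interpret KK: hilbert_space K by fact
  define R where "R = T ` carrier H"
  have R: "subspace_of K R" "K.seq_closed R" using subspace_range closed_range by (simp_all add: R_def)
  note Rc = K.subspace_D(1)[OF R(1)]
  interpret S: hilbert_space "K\<lparr>carrier := R\<rparr>" by (rule KK.hilbert_space_subspace[OF R])
  \<comment> \<open>the graph of the adjoint of \<open>T\<close>\<close>
  define A where "A = {(v, w). v \<in> carrier K \<and> w \<in> carrier H \<and> (\<forall>x\<in>carrier H. ip K (T x) v = ip H x w)}"
  have A: "v \<in> carrier K" "w \<in> carrier H" "x \<in> carrier H \<Longrightarrow> ip K (T x) v = ip H x w"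
    if "(v, w) \<in> A" for v w x using that by (auto simp: A_def)
  have A_ex: "\<exists>w. (v, w) \<in> A" if "v \<in> carrier K" for v
    using adjoint_exists[OF assms(1) that] that by (auto simp: A_def)
  \<comment> \<open>A norm bound can be tested on the range of the adjoint, which is dense because \<open>T\<close> is injective:
    the vector \<open>z\<close> below satisfies the bound and represents \<open>x\<close> on this range, so that \<open>T z = T x\<close>.\<close>
  have dense: "hnorm H x \<le> k"
    if x: "x \<in> carrier H" and k: "0 \<le> k" and le: "\<And>v w. (v, w) \<in> A \<Longrightarrow> cmod (ip K (T x) v) \<le> k * hnorm H w" for x k
  proof -
    have "subspace_of H (snd ` A)"
    proof (rule H.subspace_I)
      have "(\<zero>\<^bsub>K\<^esub>, \<zero>\<^bsub>H\<^esub>) \<in> A" by (simp add: A_def)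
      thus "\<zero>\<^bsub>H\<^esub> \<in> snd ` A" by force
      fix w w' a assume w: "w \<in> snd ` A"
      then obtain v where v: "(v, w) \<in> A" by force
      {
        assume "w' \<in> snd ` A"
        then obtain v' where "(v', w') \<in> A" by force
        hence "(v \<oplus>\<^bsub>K\<^esub> v', w \<oplus>\<^bsub>H\<^esub> w') \<in> A" using v by (simp add: A_def K.ip_add_r H.ip_add_r)
        thus "w \<oplus>\<^bsub>H\<^esub> w' \<in> snd ` A" by force
      }
      have "(a \<odot>\<^bsub>K\<^esub> v, a \<odot>\<^bsub>H\<^esub> w) \<in> A" using v by (simp add: A_def K.ip_smult_r H.ip_smult_r)
      thus "a \<odot>\<^bsub>H\<^esub> w \<in> snd ` A" by force
    qed (auto simp: A_def)
    moreover have "cmod (ip H w x) \<le> k * hnorm H w" if w: "w \<in> snd ` A" for w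
    proof -
      obtain v where v: "(v, w) \<in> A" using w by force
      have "cmod (ip H w x) = cmod (ip H x w)"
        using H.ip_cnj[OF x A(2)[OF v]] by simp
      thus ?thesis using le[OF v] A(3)[OF v x] by simp
    qed
    moreover have "w \<in> carrier H" if "w \<in> snd ` A" for w using that A(2) by auto
    ultimately have "\<exists>z\<in>carrier H. hnorm H z \<le> k \<and> (\<forall>h\<in>snd ` A. ip H h z = ip H h x) \<and>
        (H.seq_closed (snd ` A) \<longrightarrow> z \<in> snd ` A)"
      using x k by (intro HH.riesz) (auto simp: H.ip_add H.ip_smult)
    then obtain z where z: "z \<in> carrier H" "hnorm H z \<le> k" "\<And>w. w \<in> snd ` A \<Longrightarrow> ip H w z = ip H w x" by blast
    have "T z = T x"
    proof (rule K.eqI_ip)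
      fix v assume v: "v \<in> carrier K"
      obtain w where w: "(v, w) \<in> A" using A_ex[OF v] by blast
      have "ip H w z = ip H w x" using z(3) w by force
      hence "ip H z w = ip H x w"
        using H.ip_cnj[OF A(2)[OF w] z(1)] H.ip_cnj[OF A(2)[OF w] x] by simp
      hence "ip K (T z) v = ip K (T x) v" using A(3)[OF w] z(1) x by simp
      thus "ip K v (T z) = ip K v (T x)"
        using K.ip_cnj[OF closed[OF z(1)] v] K.ip_cnj[OF closed[OF x] v] by simp
    qed (use z x in auto)
    hence "T (z \<ominus>\<^bsub>H\<^esub> x) = \<zero>\<^bsub>K\<^esub>" using z(1) x by (simp add: minus K.eq_iff_minus)
    hence "z = x" using inj[of "z \<ominus>\<^bsub>H\<^esub> x"] z(1) x by (simp add: H.eq_iff_minus)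
    thus ?thesis using z(2) by simp
  qed
  define B where "B k = {y \<in> R. \<forall>(v, w) \<in> A. cmod (ip K y v) \<le> real k * hnorm H w}" for k :: nat
  have B_cl: "closedin S.metric.mtopology (B k)" for k
  proof -
    have "S.seq_closed (B k)" unfolding S.seq_closed_def
    proof (intro conjI allI impI)
      fix g z assume g: "\<forall>n. g n \<in> B k" and z: "z \<in> carrier (K\<lparr>carrier := R\<rparr>)"
        and lim: "(\<lambda>n. hnorm (K\<lparr>carrier := R\<rparr>) (g n \<ominus>\<^bsub>K\<lparr>carrier := R\<rparr>\<^esub> z)) \<longlonglongrightarrow> 0"
      have gR: "g n \<in> R" for n using g by (simp add: B_def)
      have zR: "z \<in> R" using z by simp
      have lim': "(\<lambda>n. hnorm K (g n \<ominus>\<^bsub>K\<^esub> z)) \<longlonglongrightarrow> 0"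
        using lim gR zR by (simp add: K.minus_subspace[OF R(1)])
      have "cmod (ip K z v) \<le> real k * hnorm H w" if vw: "(v, w) \<in> A" for v w
      proof -
        have v: "v \<in> carrier K" using A(1)[OF vw] .
        have sym: "cmod (ip K y v) = cmod (ip K v y)" if "y \<in> carrier K" for y using K.ip_cnj[OF v that] by simp
        have "(\<lambda>n. cmod (ip K v (g n))) \<longlonglongrightarrow> cmod (ip K v z)"
          using K.ip_limit[OF Rc[OF gR] Rc[OF zR] lim' v] by (rule tendsto_norm)
        moreover have "cmod (ip K v (g n)) \<le> real k * hnorm H w" for n
        proof -
          have "cmod (ip K (g n) v) \<le> real k * hnorm H w" using g vw unfolding B_def by fast
          thus ?thesis using sym[OF Rc[OF gR]] by simp
        qed
        ultimately show ?thesis using LIMSEQ_le_const2 sym[OF Rc[OF zR]] by metis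
      qed
      thus "z \<in> B k" using zR by (auto simp: B_def)
    qed (auto simp: B_def)
    thus ?thesis using S.closed_in_iff unfolding closed_in_def by blast
  qed
  have "R \<subseteq> (\<Union>k. B k)"
  proof
    fix y assume "y \<in> R"
    then obtain x where x: "x \<in> carrier H" "y = T x" by (auto simp: R_def)
    obtain k :: nat where k: "hnorm H x \<le> real k" using real_arch_simple by blast
    have "cmod (ip K y v) \<le> real k * hnorm H w" if vw: "(v, w) \<in> A" for v w
    proof -
      have "cmod (ip K y v) \<le> hnorm H x * hnorm H w"
        using A(3)[OF vw x(1)] H.cauchy_schwarz[OF x(1) A(2)[OF vw]] x(2) by simp
      also have "\<dots> \<le> real k * hnorm H w" using k H.hnorm_ge0[OF A(2)[OF vw]] by (rule mult_right_mono)
      finally show ?thesis .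
    qed
    thus "y \<in> (\<Union>k. B k)" using \<open>y \<in> R\<close> by (auto simp: B_def)
  qed
  hence un: "(\<Union>k. B k) = R" by (auto simp: B_def)
  have "\<exists>k. S.metric.mtopology interior_of (B k) \<noteq> {}"
  proof (rule ccontr)
    assume "\<not> ?thesis"
    hence "S.metric.mtopology interior_of (\<Union>(range B)) = {}"
      using B_cl by (intro S.metric.metric_Baire_category_alt[OF S.complete]) auto
    hence "S.metric.mtopology interior_of R = {}" using un by simp
    moreover have "S.metric.mtopology interior_of R = R"
      using interior_of_topspace[of S.metric.mtopology] unfolding S.metric.topspace_mtopology by simp
    ultimately show False using K.subspace_D(2)[OF R(1)] by auto
  qed
  then obtain k y where yi: "y \<in> S.metric.mtopology interior_of (B k)" by blast
  obtain r where r: "r > 0" "S.metric.mball y r \<subseteq> S.metric.mtopology interior_of (B k)"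
    using yi openin_interior_of[of S.metric.mtopology "B k"] unfolding S.metric.openin_mtopology by blast
  note interior_sub = interior_of_subset[of S.metric.mtopology "B k"]
  have y: "y \<in> B k" by (rule subsetD[OF interior_sub yi])
  hence yR: "y \<in> R" by (simp add: B_def)
  have ball: "y \<oplus>\<^bsub>K\<^esub> z \<in> B k" if z: "z \<in> R" "hnorm K z < r" for z
  proof -
    have c: "y \<oplus>\<^bsub>K\<^esub> z \<in> R" using K.subspace_D(3)[OF R(1) yR z(1)] .
    have "y \<ominus>\<^bsub>K\<^esub> (y \<oplus>\<^bsub>K\<^esub> z) = (-1) \<odot>\<^bsub>K\<^esub> z"
      using Rc[OF yR] Rc[OF z(1)] by (intro K.eqI_ip) (auto simp: K.ip_linear)
    hence "hdist (K\<lparr>carrier := R\<rparr>) y (y \<oplus>\<^bsub>K\<^esub> z) < r"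
      using z c yR Rc[OF z(1)] by (simp add: hdist_def K.minus_subspace[OF R(1)] K.hnorm_smult)
    hence "y \<oplus>\<^bsub>K\<^esub> z \<in> S.metric.mball y r" using c yR unfolding S.metric.in_mball by simp
    thus ?thesis using r(2) interior_sub by blast
  qed
  have small: "hnorm H x \<le> 2 * real k" if x: "x \<in> carrier H" "hnorm K (T x) < r" for x
  proof (rule dense[OF x(1)])
    fix v w assume vw: "(v, w) \<in> A"
    have TR: "T x \<in> R" using x by (simp add: R_def)
    note v = A(1)[OF vw]
    have "cmod (ip K (y \<oplus>\<^bsub>K\<^esub> T x) v) \<le> real k * hnorm H w" "cmod (ip K y v) \<le> real k * hnorm H w"
      using ball[OF TR x(2)] y vw unfolding B_def by fast+
    moreover have "ip K (T x) v = ip K (y \<oplus>\<^bsub>K\<^esub> T x) v - ip K y v"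
      using Rc[OF yR] Rc[OF TR] v by (simp add: K.ip_add)
    ultimately show "cmod (ip K (T x) v) \<le> 2 * real k * hnorm H w"
      using norm_triangle_ineq4[of "ip K (y \<oplus>\<^bsub>K\<^esub> T x) v" "ip K y v"] by simp
  qed simp
  have "hnorm H x \<le> (4 * real k / r) * hnorm K (T x)" if x: "x \<in> carrier H" for x
  proof (cases "T x = \<zero>\<^bsub>K\<^esub>")
    case True
    thus ?thesis using inj[OF x True] H.hnorm_eq0[of "\<zero>\<^bsub>H\<^esub>"] K.hnorm_eq0[of "\<zero>\<^bsub>K\<^esub>"] by simp
  next
    case False
    hence p: "hnorm K (T x) > 0" using K.hnorm_ge0[OF closed[OF x]] K.hnorm_eq0[OF closed[OF x]] by linarith
    define s where "s = r / (2 * hnorm K (T x))"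
    have s: "s > 0" "s * hnorm K (T x) < r" using p r(1) by (auto simp: s_def)
    have "hnorm K (T (of_real s \<odot>\<^bsub>H\<^esub> x)) = s * hnorm K (T x)"
      using x s(1) by (simp add: smult K.hnorm_smult)
    hence "hnorm H (of_real s \<odot>\<^bsub>H\<^esub> x) \<le> 2 * real k" using small[of "of_real s \<odot>\<^bsub>H\<^esub> x"] s x by simp
    hence "s * hnorm H x \<le> 2 * real k" using x s(1) by (simp add: H.hnorm_smult)
    thus ?thesis using p r(1) by (simp add: s_def field_simps)
  qed
  thus ?thesis by blast
qed

section \<open>Quotients\<close>

locale quotient_space = M: inner_product_space M
  for M :: "('a, 'z) hilbert_module_scheme" and N :: "'a set" +
  assumes N: "subspace_of M N"
begin

lemmas N_D = M.subspace_D[OF N]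

lemma N_sub: "N \<subseteq> carrier M" using N_D(1) by auto

abbreviation coset :: "'a \<Rightarrow> 'a set" where "coset x \<equiv> N +>\<^bsub>M\<^esub> x"

lemma coset_eq: "coset x = {n \<oplus>\<^bsub>M\<^esub> x |n. n \<in> N}"
  by (auto simp: a_r_coset_def')

lemma carrier_quot: "carrier (quot M N) = coset ` carrier M"
  by (auto simp: quot_def A_RCOSETS_def')

lemma coset_closed [simp]: "x \<in> carrier M \<Longrightarrow> coset x \<in> carrier (quot M N)"
  by (simp add: carrier_quot)

lemma in_coset_iff:
  assumes "x \<in> carrier M" "y \<in> carrier M"
  shows "y \<in> coset x \<longleftrightarrow> y \<ominus>\<^bsub>M\<^esub> x \<in> N"
proof
  assume "y \<in> coset x"
  then obtain n where n: "n \<in> N" "y = n \<oplus>\<^bsub>M\<^esub> x" by (auto simp: coset_eq)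
  have "y \<ominus>\<^bsub>M\<^esub> x = n" unfolding n(2) using N_D(1)[OF n(1)] assms(1) by (intro M.eqI_ip) (auto simp: M.ip_linear)
  thus "y \<ominus>\<^bsub>M\<^esub> x \<in> N" using n by simp
next
  assume n: "y \<ominus>\<^bsub>M\<^esub> x \<in> N"
  have "y = (y \<ominus>\<^bsub>M\<^esub> x) \<oplus>\<^bsub>M\<^esub> x" using assms by (intro M.eqI_ip) (auto simp: M.ip_linear)
  thus "y \<in> coset x" using n by (auto simp: coset_eq)
qed

lemma coset_subset: "x \<in> carrier M \<Longrightarrow> coset x \<subseteq> carrier M"
  using N_D(1) by (auto simp: coset_eq)

lemma self_in_coset: "x \<in> carrier M \<Longrightarrow> x \<in> coset x"
  using N_D(2) by (force simp: coset_eq)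

lemma coset_eqI:
  assumes "x \<in> carrier M" "y \<in> carrier M" "x \<ominus>\<^bsub>M\<^esub> y \<in> N"
  shows "coset x = coset y"
proof -
  have "coset x' \<subseteq> coset y'" if c: "x' \<in> carrier M" "y' \<in> carrier M" and d: "x' \<ominus>\<^bsub>M\<^esub> y' \<in> N" for x' y'
  proof
    fix z assume z: "z \<in> coset x'"
    hence zc: "z \<in> carrier M" using coset_subset[OF c(1)] by auto
    have "z \<ominus>\<^bsub>M\<^esub> y' = (z \<ominus>\<^bsub>M\<^esub> x') \<oplus>\<^bsub>M\<^esub> (x' \<ominus>\<^bsub>M\<^esub> y')" using c zc by (intro M.eqI_ip) (auto simp: M.ip_linear)
    hence "z \<ominus>\<^bsub>M\<^esub> y' \<in> N" using N_D(3)[OF _ d] z in_coset_iff[OF c(1) zc] by simp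
    thus "z \<in> coset y'" using in_coset_iff[OF c(2) zc] by simp
  qed
  moreover have "y \<ominus>\<^bsub>M\<^esub> x \<in> N"
  proof -
    have "y \<ominus>\<^bsub>M\<^esub> x = (-1) \<odot>\<^bsub>M\<^esub> (x \<ominus>\<^bsub>M\<^esub> y)" using assms by (intro M.eqI_ip) (auto simp: M.ip_linear)
    thus ?thesis using N_D(4)[OF assms(3), of "-1"] by simp
  qed
  ultimately show ?thesis using assms by blast
qed

lemma coset_eq_iff:
  assumes "x \<in> carrier M" "y \<in> carrier M"
  shows "coset x = coset y \<longleftrightarrow> x \<ominus>\<^bsub>M\<^esub> y \<in> N"
  using coset_eqI[OF assms] self_in_coset[OF assms(1)] in_coset_iff[OF assms(2,1)] by blast

lemma coset_add:
  assumes "x \<in> carrier M" "y \<in> carrier M"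
  shows "coset x \<oplus>\<^bsub>quot M N\<^esub> coset y = coset (x \<oplus>\<^bsub>M\<^esub> y)"
  using M.hnorm_quot_aux(2)[OF N_sub N_D(2-4) assms] by (simp add: quot_def)

lemma coset_smult:
  assumes "x \<in> carrier M"
  shows "a \<odot>\<^bsub>quot M N\<^esub> coset x = coset (a \<odot>\<^bsub>M\<^esub> x)"
  using M.hnorm_quot_aux(1)[OF N_sub N_D(2-4) assms] by (simp add: quot_def)

text \<open>
  In the definition of the quotient, the action is a union over all representatives; invariance of
  \<open>N\<close> makes the cosets in this union coincide.
\<close>
lemma coset_act:
  assumes inv: "\<And>n. n \<in> N \<Longrightarrow> act M i n \<in> N"
    and add: "\<And>x y. \<lbrakk>x \<in> carrier M; y \<in> carrier M\<rbrakk> \<Longrightarrow> act M i (x \<oplus>\<^bsub>M\<^esub> y) = act M i x \<oplus>\<^bsub>M\<^esub> act M i y"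
    and closed: "\<And>x. x \<in> carrier M \<Longrightarrow> act M i x \<in> carrier M"
    and x: "x \<in> carrier M"
  shows "act (quot M N) i (coset x) = coset (act M i x)"
proof -
  have eq: "coset (act M i y) = coset (act M i x)" if y: "y \<in> coset x" for y
  proof -
    obtain n where n: "n \<in> N" "y = n \<oplus>\<^bsub>M\<^esub> x" using y by (auto simp: coset_eq)
    have e: "act M i y = act M i n \<oplus>\<^bsub>M\<^esub> act M i x" using n add[OF N_D(1) x] by simp
    have "act M i y \<ominus>\<^bsub>M\<^esub> act M i x = act M i n" unfolding e
      using closed[OF x] closed[OF N_D(1)[OF n(1)]] by (intro M.eqI_ip) (auto simp: M.ip_linear)
    thus ?thesis using inv[OF n(1)] closed x N_D(1)[OF n(1)] n(2) by (intro coset_eqI) auto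
  qed
  have "(\<Union>y\<in>coset x. coset (act M i y)) = coset (act M i x)"
    by (rule SUP_eq_const) (use self_in_coset[OF x] in blast, rule eq)
  thus ?thesis by (simp add: quot_def)
qed

lemma hnorm_coset: "x \<in> carrier M \<Longrightarrow> hnorm (quot M N) (coset x) = Inf (hnorm M ` coset x)"
  using hnorm_quot[OF M.inner_product_space_axioms N_sub N_D(2-4) coset_closed] by (simp add: quot_norm_def)

lemma hnorm_quot_nonneg:
  assumes "Z \<in> carrier (quot M N)"
  shows "0 \<le> hnorm (quot M N) Z"
proof -
  obtain x where x: "x \<in> carrier M" "Z = coset x" using assms by (auto simp: carrier_quot)
  show ?thesis unfolding x(2) hnorm_coset[OF x(1)]
    using self_in_coset[OF x(1)] coset_subset[OF x(1)] M.hnorm_ge0 by (intro cInf_greatest) auto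
qed

lemma bounded_op_coset: "bounded_op M (quot M N) coset"
  unfolding bounded_op_def
proof (intro conjI)
  have "hnorm (quot M N) (coset x) \<le> 1 * hnorm M x" if x: "x \<in> carrier M" for x
    unfolding hnorm_coset[OF x] quot_norm_def[symmetric]
    using M.quot_norm_lower[OF coset_subset[OF x] self_in_coset[OF x]] by simp
  thus "\<exists>C. \<forall>x\<in>carrier M. hnorm (quot M N) (coset x) \<le> C * hnorm M x" by blast
qed (auto simp: coset_add coset_smult)

lemma factor_through_quotient:
  assumes "bounded_operator M K T" and T0: "\<And>n. n \<in> N \<Longrightarrow> T n = \<zero>\<^bsub>K\<^esub>"
  shows "\<exists>S. bounded_op (quot M N) K S \<and> (\<forall>x\<in>carrier M. S (coset x) = T x)"
proof -
  interpret T: bounded_operator M K T by fact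
  have const: "T y = T x" if "x \<in> carrier M" "y \<in> coset x" for x y
    using that T0 N_D(1) by (auto simp: coset_eq T.add)
  define S where "S X = T (SOME x. x \<in> X)" for X
  have S: "S (coset x) = T x" if x: "x \<in> carrier M" for x
    unfolding S_def using const[OF x] someI[of "\<lambda>y. y \<in> coset x", OF self_in_coset[OF x]] by blast
  obtain C where C: "C > 0" "\<And>x. x \<in> carrier M \<Longrightarrow> hnorm K (T x) \<le> C * hnorm M x" using T.bound_ex by blast
  have "hnorm K (S (coset x)) \<le> C * hnorm (quot M N) (coset x)" if x: "x \<in> carrier M" for x
  proof -
    have "hnorm K (T x) / C \<le> Inf (hnorm M ` coset x)"
    proof (rule cInf_greatest)
      show "hnorm M ` coset x \<noteq> {}" using self_in_coset[OF x] by blast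
      fix t assume "t \<in> hnorm M ` coset x"
      then obtain y where y: "y \<in> coset x" "t = hnorm M y" by blast
      have "y \<in> carrier M" using y(1) coset_subset[OF x] by auto
      thus "hnorm K (T x) / C \<le> t"
        using C(1) C(2)[of y] const[OF x y(1)] y(2) by (simp add: divide_le_eq mult.commute)
    qed
    thus ?thesis using C(1) by (simp add: S[OF x] hnorm_coset[OF x] divide_le_eq mult.commute)
  qed
  hence "bounded_op (quot M N) K S" unfolding bounded_op_def carrier_quot
    by (auto simp: S coset_add coset_smult T.add T.smult)
  thus ?thesis using S by blast
qed

end

section \<open>Words and the recursive structure of the Fock module\<close>

text \<open>The adjoint of the creation operator (see \<open>ip_bshift\<close> below).\<close>
definition bshift :: "nat \<Rightarrow> (nat list \<Rightarrow> 'a) \<Rightarrow> nat list \<Rightarrow> 'a" where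
  "bshift i f v = f (i # v)"

definition trunc :: "('a, 'z) hilbert_scheme \<Rightarrow> nat \<Rightarrow> (nat list \<Rightarrow> 'a) \<Rightarrow> nat list \<Rightarrow> 'a" where
  "trunc H n f w = (if length w < n then f w else \<zero>\<^bsub>H\<^esub>)"

lemma Nil_in_words [simp]: "[] \<in> words m"
  and Cons_in_words [simp]: "i # v \<in> words m \<longleftrightarrow> i < m \<and> v \<in> words m"
  by (auto simp: words_def)

lemma words_unfold: "words m = insert [] (\<Union>i<m. Cons i ` words m)"
proof (rule Set.set_eqI)
  show "w \<in> words m \<longleftrightarrow> w \<in> insert [] (\<Union>i<m. Cons i ` words m)" for w by (cases w) auto
qed

lemma has_sum_words:
  fixes a :: "nat list \<Rightarrow> real"
  assumes "\<And>i. i < m \<Longrightarrow> ((\<lambda>v. a (i # v)) has_sum s i) (words m)"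
  shows "(a has_sum (a [] + (\<Sum>i<m. s i))) (words m)"
proof -
  have "(a has_sum s i) (Cons i ` words m)" if "i < m" for i
    using assms[OF that] by (subst has_sum_reindex) (auto simp: o_def)
  hence "(a has_sum (\<Sum>i<m. s i)) (\<Union>i<m. Cons i ` words m)"
    by (intro sum_has_sum) auto
  hence "(a has_sum (a [] + (\<Sum>i<m. s i))) ({[]} \<union> (\<Union>i<m. Cons i ` words m))"
    by (intro has_sum_Un_disjoint) (auto intro: has_sum_finiteI)
  thus ?thesis using words_unfold[of m] by simp
qed

context inner_product_space begin

text \<open>
  This and the next lemma identify the Fock module over \<open>H\<close> with the orthogonal sum of \<open>H\<close> and of
  \<open>m\<close> copies of the Fock module itself.  Inductions on the length of words rest on them.
\<close>
lemma fock_iff: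
  "f \<in> carrier (fock m H) \<longleftrightarrow>
    f [] \<in> carrier H \<and> (\<forall>i<m. bshift i f \<in> carrier (fock m H)) \<and> (\<forall>i v. \<not> i < m \<longrightarrow> f (i # v) = \<zero>)"
    (is "?L \<longleftrightarrow> ?R")
proof
  assume f: ?L
  have "bshift i f \<in> carrier (fock m H)" if i: "i < m" for i
  proof -
    have "(\<lambda>w. (hnorm H (f w))\<^sup>2) summable_on (Cons i ` words m)"
      by (rule summable_on_subset_banach[OF fock_D(3)[OF f]]) (use i in auto)
    hence "(\<lambda>v. (hnorm H (f (i # v)))\<^sup>2) summable_on words m"
      by (subst (asm) summable_on_reindex) (auto simp: o_def)
    thus ?thesis using fock_D(1,2)[OF f] by (auto simp: fock_simps bshift_def)
  qed
  thus ?R using fock_D(1,2)[OF f] by auto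
next
  assume R: ?R
  have s: "((\<lambda>v. (hnorm H (f (i # v)))\<^sup>2) has_sum (\<Sum>\<^sub>\<infinity>v\<in>words m. (hnorm H (f (i # v)))\<^sup>2)) (words m)" if "i < m" for i
    using R that fock_D(3)[of "bshift i f" m] by (intro has_sum_infsum) (simp add: bshift_def)
  have "(\<lambda>w. (hnorm H (f w))\<^sup>2) summable_on words m"
    using has_sum_words[OF s] by (auto simp: summable_on_def)
  moreover have "f w \<in> carrier H" for w
  proof (cases w)
    case (Cons i v) thus ?thesis using R fock_D(1)[of "bshift i f" m v] by (cases "i < m") (auto simp: bshift_def)
  qed (use R in auto)
  moreover have "f w = \<zero>" if "w \<notin> words m" for w
  proof (cases w)
    case (Cons i v) thus ?thesis using that R fock_D(2)[of "bshift i f" m v] by (cases "i < m") (auto simp: bshift_def)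
  qed (use that in auto)
  ultimately show ?L by (auto simp: fock_simps)
qed

lemma hnorm_fock_rec:
  assumes f: "f \<in> carrier (fock m H)"
  shows "(hnorm (fock m H) f)\<^sup>2 = (hnorm H (f []))\<^sup>2 + (\<Sum>i<m. (hnorm (fock m H) (bshift i f))\<^sup>2)"
proof -
  have b: "bshift i f \<in> carrier (fock m H)" if "i < m" for i using fock_iff[of f m] f that by blast
  have "((\<lambda>v. (hnorm H (f (i # v)))\<^sup>2) has_sum (hnorm (fock m H) (bshift i f))\<^sup>2) (words m)" if "i < m" for i
    using has_sum_infsum[OF fock_D(3)[OF b[OF that]]] hnorm_fock_sq[OF b[OF that]] by (simp add: bshift_def)
  from infsumI[OF has_sum_words[OF this]] show ?thesis using hnorm_fock_sq[OF f] by simp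
qed

lemma hnorm_fock_zero: "hnorm (fock m H) (\<lambda>w. \<zero>) = 0"
  using hnorm_fock_sq[OF fock_zero_closed, of m] by (simp add: hnorm_def[of H])

lemma bshift_closed: "\<lbrakk>f \<in> carrier (fock m H); i < m\<rbrakk> \<Longrightarrow> bshift i f \<in> carrier (fock m H)"
  using fock_iff by blast

lemma bounded_operator_bshift:
  assumes i: "i < m"
  shows "bounded_operator (fock m H) (fock m H) (bshift i)"
proof (rule bounded_operatorI[where C = 1, OF inner_product_space_fock inner_product_space_fock])
  interpret F: inner_product_space "fock m H" by (rule inner_product_space_fock)
  fix f assume f: "f \<in> carrier (fock m H)"
  show "bshift i f \<in> carrier (fock m H)" using f i by (rule bshift_closed)
  have "(hnorm (fock m H) (bshift i f))\<^sup>2 \<le> (\<Sum>i<m. (hnorm (fock m H) (bshift i f))\<^sup>2)"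
    using i by (intro member_le_sum[of i "{..<m}" "\<lambda>i. (hnorm (fock m H) (bshift i f))\<^sup>2"]) auto
  hence "(hnorm (fock m H) (bshift i f))\<^sup>2 \<le> (hnorm (fock m H) f)\<^sup>2"
    using hnorm_fock_rec[OF f] by (simp add: add_increasing)
  thus "hnorm (fock m H) (bshift i f) \<le> 1 * hnorm (fock m H) f"
    using power2_le_imp_le[OF _ F.hnorm_ge0[OF f]] by simp
qed (auto simp: fock_simps(2-) bshift_def)

lemma bounded_operator_vacuum: "bounded_operator (fock m H) H (\<lambda>f. f [])"
proof (rule bounded_operatorI[where C = 1, OF inner_product_space_fock])
  interpret F: inner_product_space "fock m H" by (rule inner_product_space_fock)
  show "inner_product_space H" by unfold_locales
  fix f assume f: "f \<in> carrier (fock m H)"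
  show "f [] \<in> carrier H" using fock_D(1)[OF f] .
  have "(hnorm H (f []))\<^sup>2 \<le> (hnorm (fock m H) f)\<^sup>2"
    using hnorm_fock_rec[OF f] by (simp add: sum_nonneg)
  thus "hnorm H (f []) \<le> 1 * hnorm (fock m H) f"
    using power2_le_imp_le[OF _ F.hnorm_ge0[OF f]] by simp
qed (auto simp: fock_simps(2-))

lemma bounded_operator_creation:
  assumes i: "i < m"
  shows "bounded_operator (fock m H) (fock m H) (creation H i)"
proof (rule bounded_operatorI[where C = 1, OF inner_product_space_fock inner_product_space_fock])
  fix f assume f: "f \<in> carrier (fock m H)"
  show "creation H i f \<in> carrier (fock m H)" using creation_closed[OF f i] .
  show "hnorm (fock m H) (creation H i f) \<le> 1 * hnorm (fock m H) f"
    using ip_creation[OF f f i] by (simp add: hnorm_def)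
qed (auto simp: fock_simps(2-) creation_def fun_eq_iff split: list.split)

lemma bshift_creation: "bshift i (creation H j f) = (if i = j then f else (\<lambda>w. \<zero>))"
  by (auto simp: bshift_def creation_def fun_eq_iff)

lemma creation_Nil: "creation H i f [] = \<zero>"
  by (simp add: creation_def)

lemma ip_bshift:
  assumes f: "f \<in> carrier (fock m H)" and g: "g \<in> carrier (fock m H)" and i: "i < m"
  shows "ip (fock m H) (bshift i f) g = ip (fock m H) f (creation H i g)"
proof -
  have inj: "inj_on (Cons i) (words m)" by simp
  have "ip (fock m H) f (creation H i g)
      = (\<Sum>\<^sub>\<infinity>w\<in>Cons i ` words m. ip H (f w) (creation H i g w))"
    unfolding fock_simps using i fock_D(1)[OF f]
    by (intro infsum_cong_neutral) (auto simp: creation_def words_def split: list.splits if_splits)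
  also have "\<dots> = ip (fock m H) (bshift i f) g"
    unfolding fock_simps by (subst infsum_reindex[OF inj]) (simp add: o_def creation_def bshift_def)
  finally show ?thesis by simp
qed

lemma trunc_closed:
  assumes f: "f \<in> carrier (fock m H)"
  shows "trunc H n f \<in> carrier (fock m H)" "hnorm (fock m H) (trunc H n f) \<le> hnorm (fock m H) f"
proof -
  interpret F: inner_product_space "fock m H" by (rule inner_product_space_fock)
  have le: "(hnorm H (trunc H n f w))\<^sup>2 \<le> (hnorm H (f w))\<^sup>2" for w by (simp add: trunc_def hnorm_def[of H \<zero>])
  have s: "(\<lambda>w. (hnorm H (trunc H n f w))\<^sup>2) summable_on words m"
    by (rule summable_on_comparison_test[OF fock_D(3)[OF f]]) (use le in auto)
  thus c: "trunc H n f \<in> carrier (fock m H)" using fock_D(1,2)[OF f] by (auto simp: fock_simps trunc_def)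
  have "(hnorm (fock m H) (trunc H n f))\<^sup>2 \<le> (hnorm (fock m H) f)\<^sup>2"
    unfolding hnorm_fock_sq[OF f] hnorm_fock_sq[OF c] using le by (intro infsum_mono s fock_D(3)[OF f])
  thus "hnorm (fock m H) (trunc H n f) \<le> hnorm (fock m H) f"
    using power2_le_imp_le[OF _ F.hnorm_ge0[OF f]] by simp
qed

text \<open>
  A family given by a recursion on words is estimated length by length; this lemma removes the
  restriction on the length.
\<close>
lemma fock_if_trunc:
  assumes t: "\<And>n. trunc H n f \<in> carrier (fock m H)" and B: "0 \<le> B"
    and le: "\<And>n. hnorm (fock m H) (trunc H n f) \<le> B"
  shows "f \<in> carrier (fock m H)" "hnorm (fock m H) f \<le> B"
proof -
  interpret F: inner_product_space "fock m H" by (rule inner_product_space_fock)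
  have tw: "f w = trunc H (Suc (length w)) f w" for w by (simp add: trunc_def)
  have bd: "(\<Sum>w\<in>K. (hnorm H (f w))\<^sup>2) \<le> B\<^sup>2" if K: "finite K" "K \<subseteq> words m" for K
  proof -
    obtain n where n: "\<And>w. w \<in> K \<Longrightarrow> length w < n"
      using finite_nat_set_iff_bounded[of "length ` K"] K(1) by auto
    have "(\<Sum>w\<in>K. (hnorm H (f w))\<^sup>2) = (\<Sum>w\<in>K. (hnorm H (trunc H n f w))\<^sup>2)"
      using n by (intro sum.cong) (auto simp: trunc_def)
    also have "\<dots> \<le> (\<Sum>\<^sub>\<infinity>w\<in>words m. (hnorm H (trunc H n f w))\<^sup>2)"
      by (rule finite_sum_le_infsum[OF fock_D(3)[OF t] K]) simp
    also have "\<dots> = (hnorm (fock m H) (trunc H n f))\<^sup>2" using hnorm_fock_sq[OF t] by simp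
    also have "\<dots> \<le> B\<^sup>2" using le[of n] F.hnorm_ge0[OF t] by (rule power_mono)
    finally show ?thesis .
  qed
  have s: "(\<lambda>w. (hnorm H (f w))\<^sup>2) summable_on words m"
    by (rule nonneg_bdd_above_summable_on) (use bd in \<open>auto intro!: bdd_aboveI2[of _ _ "B\<^sup>2"]\<close>)
  have "f w \<in> carrier H" for w using fock_D(1)[OF t[of "Suc (length w)"], of w] tw[of w] by simp
  moreover have "f w = \<zero>" if "w \<notin> words m" for w
    using fock_D(2)[OF t[of "Suc (length w)"] that] tw[of w] by simp
  ultimately show f: "f \<in> carrier (fock m H)" using s by (simp add: fock_simps)
  have "(hnorm (fock m H) f)\<^sup>2 \<le> B\<^sup>2" unfolding hnorm_fock_sq[OF f] using bd by (intro infsum_le_finite_sums s)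
  thus "hnorm (fock m H) f \<le> B" using power2_le_imp_le B by blast
qed

lemma trunc_0: "trunc H 0 f = (\<lambda>w. \<zero>)"
  by (simp add: trunc_def fun_eq_iff)

lemma trunc_Suc_Nil: "trunc H (Suc n) f [] = f []"
  and bshift_trunc_Suc: "bshift i (trunc H (Suc n) f) = trunc H n (bshift i f)"
  by (auto simp: trunc_def bshift_def fun_eq_iff)

end

section \<open>Multi-analytic operators\<close>

locale multi_analytic_operator = E: inner_product_space E + F: inner_product_space F
  for m :: nat and E :: "('a, 'y) hilbert_scheme" and F :: "('b, 'z) hilbert_scheme" +
  fixes T :: "(nat list \<Rightarrow> 'a) \<Rightarrow> nat list \<Rightarrow> 'b"
  assumes multi_analytic: "multi_analytic m E F T"

sublocale multi_analytic_operator \<subseteq> bounded_operator "fock m E" "fock m F" T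
proof -
  interpret H: inner_product_space "fock m E" by (rule E.inner_product_space_fock)
  interpret K: inner_product_space "fock m F" by (rule F.inner_product_space_fock)
  show "bounded_operator (fock m E) (fock m F) T"
    by unfold_locales (use multi_analytic in \<open>simp add: multi_analytic_def\<close>)
qed

context multi_analytic_operator begin

lemma creation: "\<lbrakk>i < m; f \<in> carrier (fock m E)\<rbrakk> \<Longrightarrow> T (creation E i f) = creation F i (T f)"
  using multi_analytic unfolding multi_analytic_def fock_simps(6) by blast

text \<open>
  A family \<open>f\<close> that vanishes at the empty word is the sum of the \<open>S\<^sub>i (bshift i f)\<close>.  The families
  \<open>part j\<close> in the proof are the partial sums.
\<close>
lemma of_shifted:
  assumes f: "f \<in> carrier (fock m E)" and f0: "f [] = \<zero>\<^bsub>E\<^esub>"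
  shows "T f [] = \<zero>\<^bsub>F\<^esub>" "i < m \<Longrightarrow> bshift i (T f) = T (bshift i f)"
proof -
  define part where "part j w = (case w of [] \<Rightarrow> \<zero>\<^bsub>E\<^esub> | i # v \<Rightarrow> if i < j then f w else \<zero>\<^bsub>E\<^esub>)" for j w
  have bf: "bshift i f \<in> carrier (fock m E)" if "i < m" for i using E.bshift_closed[OF f that] .
  have "j \<le> m \<Longrightarrow> part j \<in> carrier (fock m E) \<and>
    T (part j) = (\<lambda>w. case w of [] \<Rightarrow> \<zero>\<^bsub>F\<^esub> | i # v \<Rightarrow> if i < j then T (bshift i f) v else \<zero>\<^bsub>F\<^esub>)" for j
  proof (induction j)
    case 0
    have "part 0 = \<zero>\<^bsub>fock m E\<^esub>" by (auto simp: part_def fock_simps fun_eq_iff split: list.split)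
    thus ?case using zero E.fock_zero_closed by (auto simp: fock_simps(2) fun_eq_iff split: list.split)
  next
    case (Suc j)
    hence j: "j < m" by simp
    have IH: "part j \<in> carrier (fock m E)"
      "T (part j) = (\<lambda>w. case w of [] \<Rightarrow> \<zero>\<^bsub>F\<^esub> | i # v \<Rightarrow> if i < j then T (bshift i f) v else \<zero>\<^bsub>F\<^esub>)"
      using Suc by simp_all
    have c: "creation E j (bshift j f) \<in> carrier (fock m E)" using E.creation_closed[OF bf[OF j] j] .
    have e: "part (Suc j) = part j \<oplus>\<^bsub>fock m E\<^esub> creation E j (bshift j f)"
      using E.fock_D(1)[OF f]
      by (auto simp: part_def fock_simps(3) creation_def bshift_def fun_eq_iff less_Suc_eq split: list.split)
    have "T (part (Suc j)) = T (part j) \<oplus>\<^bsub>fock m F\<^esub> creation F j (T (bshift j f))"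
      unfolding e add[OF IH(1) c] creation[OF j bf[OF j]] ..
    also have "\<dots> = (\<lambda>w. case w of [] \<Rightarrow> \<zero>\<^bsub>F\<^esub> | i # v \<Rightarrow> if i < Suc j then T (bshift i f) v else \<zero>\<^bsub>F\<^esub>)"
    proof
      fix w
      have "T (bshift i f) v \<in> carrier F" if "i < m" for i v using F.fock_D(1)[OF closed[OF bf[OF that]]] .
      thus "(T (part j) \<oplus>\<^bsub>fock m F\<^esub> creation F j (T (bshift j f))) w =
          (case w of [] \<Rightarrow> \<zero>\<^bsub>F\<^esub> | i # v \<Rightarrow> if i < Suc j then T (bshift i f) v else \<zero>\<^bsub>F\<^esub>)"
        using j unfolding IH(2) by (auto simp: fock_simps(3) creation_def less_Suc_eq split: list.split)
    qed
    finally show ?case using H.M.a_closed[OF IH(1) c] unfolding e by simp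
  qed
  from this[of m] have T: "T (part m) = (\<lambda>w. case w of [] \<Rightarrow> \<zero>\<^bsub>F\<^esub> | i # v \<Rightarrow> if i < m then T (bshift i f) v else \<zero>\<^bsub>F\<^esub>)"
    by simp
  have "part m = f"
  proof
    fix w show "part m w = f w" using f0 E.fock_D(2)[OF f, of w] by (auto simp: part_def split: list.split)
  qed
  with T show "T f [] = \<zero>\<^bsub>F\<^esub>" "i < m \<Longrightarrow> bshift i (T f) = T (bshift i f)" by (simp_all add: bshift_def fun_eq_iff)
qed

text \<open>
  Multi-analytic operators are lower triangular with respect to the length of words.  So the values
  of \<open>T f\<close> at short words can be computed after changing \<open>f\<close> at long words.
\<close>
lemma of_vanishing:
  assumes "f \<in> carrier (fock m E)" "\<And>w. length w < n \<Longrightarrow> f w = \<zero>\<^bsub>E\<^esub>" "length w < n"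
  shows "T f w = \<zero>\<^bsub>F\<^esub>"
  using assms
proof (induction n arbitrary: f w)
  case (Suc n)
  have f0: "f [] = \<zero>\<^bsub>E\<^esub>" using Suc.prems(2) by simp
  note sh = of_shifted[OF Suc.prems(1) f0]
  show ?case
  proof (cases w)
    case Nil thus ?thesis using sh(1) by simp
  next
    case (Cons i v)
    show ?thesis
    proof (cases "i < m")
      case True
      have "T (bshift i f) v = \<zero>\<^bsub>F\<^esub>"
        using Suc.prems(2,3) Cons by (intro Suc.IH E.bshift_closed[OF Suc.prems(1) True]) (auto simp: bshift_def)
      thus ?thesis using sh(2)[OF True] Cons by (metis bshift_def)
    next
      case False
      thus ?thesis using F.fock_D(2)[OF closed[OF Suc.prems(1)], of w] Cons by simp
    qed
  qed
qed simp

end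

section \<open>Invariant subspaces as free modules\<close>

context inner_product_space begin

lemma subspace_Int: "\<lbrakk>subspace_of H S; subspace_of H T\<rbrakk> \<Longrightarrow> subspace_of H (S \<inter> T)"
  by (rule subspace_I) (auto dest: subspace_D)

lemma seq_closed_Int: "\<lbrakk>seq_closed S; seq_closed T\<rbrakk> \<Longrightarrow> seq_closed (S \<inter> T)"
  unfolding seq_closed_def by blast

end

text \<open>
  A subspace of a Fock module inherits the type of modules, with an action that is meaningless if
  the subspace is not invariant.  Truncation leaves only the Hilbert space.
\<close>
lemma hilbert_space_truncate:
  assumes "hilbert_space H"
  shows "hilbert_space (hilbert.truncate H)"
proof -
  interpret H: hilbert_space H by fact
  let ?K = "hilbert.truncate H"
  have sel: "carrier ?K = carrier H" "zero ?K = zero H" "add ?K = add H" "smult ?K = smult H" "ip ?K = ip H"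
    by (simp_all add: hilbert.defs)
  have "abelian_group ?K"
    by (rule abelian_groupI) (auto simp: sel H.M.a_ac intro: bexI[of _ "\<ominus>\<^bsub>H\<^esub> x" for x] H.M.l_neg)
  hence "Module.module complex_field ?K"
    using H.smult_l_distr H.smult_r_distr H.smult_assoc1 H.smult_one
    by (intro module_complex) (auto simp: sel)
  then interpret K: inner_product_space ?K
    by (intro inner_product_space.intro inner_product_space_axioms.intro)
       (simp_all add: sel H.ip_add H.ip_smult H.ip_pos H.ip_cnj[symmetric])
  have "hdist ?K = hdist H"
    by (auto simp: hdist_def hnorm_def fun_eq_iff K.minus_eq H.minus_eq sel)
  thus ?thesis using H.complete by unfold_locales (simp add: sel)
qed

text \<open>
  The closed invariant subspace is given as the kernel \<open>N\<close> of a multi-analytic operator.  This makes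
  membership of \<open>N\<close> a condition on values at words, which triangularity reduces to short words.
\<close>
locale multi_analytic_kernel = H: hilbert_space H + E: inner_product_space E
  for m :: nat and H :: "('a, 'y) hilbert_scheme" and E :: "('b, 'z) hilbert_scheme" +
  fixes P :: "(nat list \<Rightarrow> 'a) \<Rightarrow> nat list \<Rightarrow> 'b"
  assumes multi_analytic: "multi_analytic m H E P"
begin

sublocale B: hilbert_space "fock m H"
  by (rule H.hilbert_space_fock)

sublocale P: multi_analytic_operator m H E P
  by unfold_locales (rule multi_analytic)

abbreviation N :: "(nat list \<Rightarrow> 'a) set" where
  "N \<equiv> {f \<in> carrier (fock m H). P f = \<zero>\<^bsub>fock m E\<^esub>}"

text \<open>The subspace \<open>S\<^sub>1N + \<dots> + S\<^sub>mN\<close>, described by coordinates; this makes its closedness evident.\<close>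
definition shifted :: "(nat list \<Rightarrow> 'a) set" where
  "shifted = {h \<in> carrier (fock m H). h [] = \<zero>\<^bsub>H\<^esub> \<and> (\<forall>i<m. bshift i h \<in> N)}"

lemma creation_N: "\<lbrakk>f \<in> N; i < m\<rbrakk> \<Longrightarrow> creation H i f \<in> N"
  by (auto simp: P.creation H.creation_closed) (auto simp: fock_simps(2) creation_def fun_eq_iff split: list.split)

lemma shifted_subset: "h \<in> shifted \<Longrightarrow> h \<in> N"
proof -
  assume h: "h \<in> shifted"
  hence hB: "h \<in> carrier (fock m H)" "h [] = \<zero>\<^bsub>H\<^esub>" by (auto simp: shifted_def)
  have "P h w = \<zero>\<^bsub>E\<^esub>" for w
  proof (cases w)
    case Nil thus ?thesis using P.of_shifted(1)[OF hB] by simp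
  next
    case (Cons i v)
    show ?thesis
    proof (cases "i < m")
      case True
      have "bshift i (P h) = \<zero>\<^bsub>fock m E\<^esub>" using P.of_shifted(2)[OF hB True] h True by (simp add: shifted_def)
      thus ?thesis unfolding Cons by (metis bshift_def fock_simps(2))
    next
      case False thus ?thesis using E.fock_D(2)[OF P.closed[OF hB(1)], of w] Cons by simp
    qed
  qed
  thus "h \<in> N" using hB by (auto simp: fock_simps(2) fun_eq_iff)
qed

lemma shifted_closed: "subspace_of (fock m H) shifted" "B.seq_closed shifted"
proof -
  have P: "bounded_operator (fock m H) (fock m E) (\<lambda>f. P (bshift i f))" if i: "i < m" for i
  proof -
    interpret S: bounded_operator "fock m H" "fock m H" "bshift i" by (rule H.bounded_operator_bshift[OF i])
    show ?thesis
      by unfold_locales (rule bounded_op_comp[OF S.bounded P.bounded B.hnorm_ge0])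
  qed
  interpret V: bounded_operator "fock m H" H "\<lambda>f. f []" by (rule H.bounded_operator_vacuum)
  have eq: "shifted = {h \<in> carrier (fock m H). h [] = \<zero>\<^bsub>H\<^esub>} \<inter>
      {h \<in> carrier (fock m H). \<forall>i<m. P (bshift i h) = \<zero>\<^bsub>fock m E\<^esub>}"
    using H.bshift_closed by (auto simp: shifted_def)
  have "subspace_of (fock m H) {h \<in> carrier (fock m H). \<forall>i<m. P (bshift i h) = \<zero>\<^bsub>fock m E\<^esub>}"
    by (rule B.subspace_I) (use bounded_operator.add[OF P] bounded_operator.smult[OF P] bounded_operator.zero[OF P] in auto)
  thus "subspace_of (fock m H) shifted" unfolding eq by (intro B.subspace_Int V.subspace_kernel)
  have "B.seq_closed {h \<in> carrier (fock m H). \<forall>i<m. P (bshift i h) = \<zero>\<^bsub>fock m E\<^esub>}"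
    using bounded_operator.seq_closed_kernel[OF P] unfolding B.seq_closed_def by blast
  thus "B.seq_closed shifted" unfolding eq by (intro B.seq_closed_Int V.seq_closed_kernel)
qed

lemmas shifted_D = B.subspace_D[OF shifted_closed(1)]

definition wandering :: "(nat list \<Rightarrow> 'a) hilbert" where
  "wandering = hilbert.truncate
     (fock m H\<lparr>carrier := N \<inter> {f \<in> carrier (fock m H). \<forall>h\<in>shifted. ip (fock m H) h f = 0}\<rparr>)"

lemma wandering_simps:
  "carrier wandering = N \<inter> {f \<in> carrier (fock m H). \<forall>h\<in>shifted. ip (fock m H) h f = 0}"
  "zero wandering = zero (fock m H)" "add wandering = add (fock m H)"
  "smult wandering = smult (fock m H)" "ip wandering = ip (fock m H)"
  "hnorm wandering = hnorm (fock m H)"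
  by (simp_all add: wandering_def hilbert.defs hnorm_def fun_eq_iff)

lemma hilbert_space_wandering: "hilbert_space wandering"
proof -
  have s: "shifted \<subseteq> carrier (fock m H)" by (auto simp: shifted_def)
  show ?thesis unfolding wandering_def
    by (intro hilbert_space_truncate B.hilbert_space_subspace B.subspace_Int B.seq_closed_Int
        P.subspace_kernel P.seq_closed_kernel B.seq_closed_orthogonal[OF s])
qed

sublocale W: hilbert_space wandering
  by (rule hilbert_space_wandering)

text \<open>
  Every \<open>f \<in> N\<close> is the orthogonal sum of \<open>D f\<close>, in the wandering subspace, and of the vectors
  \<open>S\<^sub>i (A i f)\<close> with \<open>A i f \<in> N\<close>.  Iterating this produces the coefficients of \<open>f\<close>.
\<close>
abbreviation "D f \<equiv> f \<ominus>\<^bsub>fock m H\<^esub> B.proj shifted f"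

lemmas proj_in = B.proj_in[OF shifted_closed]

sublocale D: bounded_operator "fock m H" "fock m H" "\<lambda>f. D f"
  by (rule B.bounded_operator_minus_proj[OF shifted_closed])

abbreviation "A i f \<equiv> bshift i (B.proj shifted f)"

lemma A_in: "\<lbrakk>f \<in> carrier (fock m H); i < m\<rbrakk> \<Longrightarrow> A i f \<in> N"
  using proj_in[of f] by (auto simp: shifted_def)

lemma D_in: "f \<in> N \<Longrightarrow> D f \<in> carrier wandering"
proof -
  assume f: "f \<in> N"
  have p: "B.proj shifted f \<in> N" using shifted_subset[OF proj_in] f by simp
  have "D f \<in> N" using f p by (intro B.subspace_minus[OF P.subspace_kernel])
  thus ?thesis using f B.orthogonal_minus_proj[OF shifted_closed] by (simp add: wandering_simps)
qed

lemma decompose: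
  assumes "f \<in> carrier (fock m H)"
  shows "f w = D f w \<oplus>\<^bsub>H\<^esub> B.proj shifted f w"
proof -
  have p: "B.proj shifted f \<in> carrier (fock m H)" using proj_in[OF assms] shifted_D(1) by blast
  have "f = D f \<oplus>\<^bsub>fock m H\<^esub> B.proj shifted f" using assms p by (intro B.eqI_ip) (auto simp: B.ip_linear)
  from fun_cong[OF this, of w] show ?thesis by (simp add: fock_simps(3))
qed

lemma hnorm_decompose:
  assumes f: "f \<in> carrier (fock m H)"
  shows "(hnorm (fock m H) f)\<^sup>2 = (hnorm (fock m H) (D f))\<^sup>2 + (\<Sum>i<m. (hnorm (fock m H) (A i f))\<^sup>2)"
proof -
  have s: "B.proj shifted f \<in> shifted" using proj_in[OF f] .
  have p: "B.proj shifted f \<in> carrier (fock m H)" using s shifted_D(1) by blast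
  have e: "B.proj shifted f \<oplus>\<^bsub>fock m H\<^esub> D f = f" using f p by (intro B.eqI_ip) (auto simp: B.ip_linear)
  have "(hnorm (fock m H) f)\<^sup>2 = (hnorm (fock m H) (B.proj shifted f))\<^sup>2 + (hnorm (fock m H) (D f))\<^sup>2"
    using B.hnorm_add_sq[OF p D.closed[OF f]] B.orthogonal_minus_proj[OF shifted_closed f s] unfolding e by simp
  moreover have "(hnorm (fock m H) (B.proj shifted f))\<^sup>2 = (\<Sum>i<m. (hnorm (fock m H) (A i f))\<^sup>2)"
    using H.hnorm_fock_rec[OF p] s by (simp add: shifted_def hnorm_def[of H "\<zero>\<^bsub>H\<^esub>"])
  ultimately show ?thesis by simp
qed

lemma proj_linear:
  assumes f: "f \<in> carrier (fock m H)"
  shows "g \<in> carrier (fock m H) \<Longrightarrow>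
      B.proj shifted (f \<oplus>\<^bsub>fock m H\<^esub> g) = B.proj shifted f \<oplus>\<^bsub>fock m H\<^esub> B.proj shifted g"
    "B.proj shifted (a \<odot>\<^bsub>fock m H\<^esub> f) = a \<odot>\<^bsub>fock m H\<^esub> B.proj shifted f"
proof -
  have p: "B.proj shifted f \<in> carrier (fock m H)" if "f \<in> carrier (fock m H)" for f
    using proj_in[OF that] shifted_D(1) by blast
  note ipp = B.ip_proj[OF shifted_closed]
  show "B.proj shifted (f \<oplus>\<^bsub>fock m H\<^esub> g) = B.proj shifted f \<oplus>\<^bsub>fock m H\<^esub> B.proj shifted g"
    if g: "g \<in> carrier (fock m H)"
    using f g p shifted_D(1) shifted_D(3)[OF proj_in proj_in]
    by (intro B.proj_unique[OF shifted_closed]) (auto simp: B.ip_add_r ipp)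
  show "B.proj shifted (a \<odot>\<^bsub>fock m H\<^esub> f) = a \<odot>\<^bsub>fock m H\<^esub> B.proj shifted f"
    using f p shifted_D(1) shifted_D(4)[OF proj_in]
    by (intro B.proj_unique[OF shifted_closed]) (auto simp: B.ip_smult_r ipp)
qed

text \<open>
  The Wold coefficient of \<open>f\<close> at the word \<open>w\<close>; \<open>analyse f\<close> is the family of all of them, and \<open>synth\<close>
  recovers the sum of the \<open>S\<^sub>w (x w)\<close>.  This sum is finite at each word \<open>u\<close>, since only the prefixes
  \<open>w\<close> of \<open>u\<close> contribute, and \<open>glue\<close> evaluates it there.
\<close>
primrec coeff :: "nat list \<Rightarrow> (nat list \<Rightarrow> 'a) \<Rightarrow> nat list \<Rightarrow> 'a" where
  "coeff [] f = D f"
| "coeff (i # w) f = (if i < m then coeff w (A i f) else \<zero>\<^bsub>fock m H\<^esub>)"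

definition analyse :: "(nat list \<Rightarrow> 'a) \<Rightarrow> nat list \<Rightarrow> nat list \<Rightarrow> 'a" where
  "analyse f w = coeff w f"

primrec glue :: "nat list \<Rightarrow> (nat list \<Rightarrow> nat list \<Rightarrow> 'a) \<Rightarrow> 'a" where
  "glue [] x = x [] []"
| "glue (i # v) x = x [] (i # v) \<oplus>\<^bsub>H\<^esub> (if i < m then glue v (bshift i x) else \<zero>\<^bsub>H\<^esub>)"

definition synth :: "(nat list \<Rightarrow> nat list \<Rightarrow> 'a) \<Rightarrow> nat list \<Rightarrow> 'a" where
  "synth x u = glue u x"

lemma analyse_Nil: "analyse f [] = D f"
  and bshift_analyse: "i < m \<Longrightarrow> bshift i (analyse f) = analyse (A i f)"
  and analyse_outside: "\<not> i < m \<Longrightarrow> analyse f (i # w) = \<zero>\<^bsub>wandering\<^esub>"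
  by (auto simp: analyse_def bshift_def fun_eq_iff wandering_simps)

text \<open>
  Bessel's inequality for the Wold coefficients, by induction on the length of the words taken into
  account, from the Pythagorean identity \<open>hnorm_decompose\<close>.
\<close>
lemma analyse_closed:
  assumes "f \<in> N"
  shows "analyse f \<in> carrier (fock m wandering)" "hnorm (fock m wandering) (analyse f) \<le> hnorm (fock m H) f"
proof -
  interpret FW: inner_product_space "fock m wandering" by (rule W.inner_product_space_fock)
  have *: "trunc wandering n (analyse f) \<in> carrier (fock m wandering) \<and>
      (hnorm (fock m wandering) (trunc wandering n (analyse f)))\<^sup>2 \<le> (hnorm (fock m H) f)\<^sup>2" if "f \<in> N" for f n
    using that
  proof (induction n arbitrary: f)
    case 0
    show ?case using W.fock_zero_closed by (simp add: W.trunc_0 W.hnorm_fock_zero)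
  next
    case (Suc n)
    have f: "f \<in> carrier (fock m H)" using Suc.prems by simp
    let ?t = "trunc wandering (Suc n) (analyse f)"
    have b: "bshift i ?t = trunc wandering n (analyse (A i f))" if "i < m" for i
      using that by (simp add: W.bshift_trunc_Suc bshift_analyse)
    have IH: "bshift i ?t \<in> carrier (fock m wandering)"
      "(hnorm (fock m wandering) (bshift i ?t))\<^sup>2 \<le> (hnorm (fock m H) (A i f))\<^sup>2" if i: "i < m" for i
      using Suc.IH[OF A_in[OF f i]] unfolding b[OF i] by auto
    have t0: "?t [] = D f" by (simp add: W.trunc_Suc_Nil analyse_Nil)
    have c: "?t \<in> carrier (fock m wandering)"
      unfolding W.fock_iff[of ?t] t0 using D_in[OF Suc.prems] IH(1)
      by (auto simp: trunc_def analyse_outside)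
    have "(hnorm (fock m wandering) ?t)\<^sup>2
        = (hnorm wandering (D f))\<^sup>2 + (\<Sum>i<m. (hnorm (fock m wandering) (bshift i ?t))\<^sup>2)"
      using W.hnorm_fock_rec[OF c] unfolding t0 .
    also have "\<dots> \<le> (hnorm (fock m H) (D f))\<^sup>2 + (\<Sum>i<m. (hnorm (fock m H) (A i f))\<^sup>2)"
      using IH(2) by (intro add_mono sum_mono) (auto simp: wandering_simps)
    also have "\<dots> = (hnorm (fock m H) f)\<^sup>2" using hnorm_decompose[OF f] by simp
    finally show ?case using c by simp
  qed
  have n0: "0 \<le> hnorm (fock m H) f" using assms B.hnorm_ge0 by simp
  have le: "hnorm (fock m wandering) (trunc wandering n (analyse f)) \<le> hnorm (fock m H) f" for n
    using *[OF assms, of n] n0 power2_le_imp_le by blast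
  show "analyse f \<in> carrier (fock m wandering)" "hnorm (fock m wandering) (analyse f) \<le> hnorm (fock m H) f"
    using W.fock_if_trunc[of "analyse f" m, OF _ n0 le] * assms by blast+
qed

lemma analyse_linear:
  assumes "f \<in> carrier (fock m H)"
  shows "g \<in> carrier (fock m H) \<Longrightarrow>
      analyse (f \<oplus>\<^bsub>fock m H\<^esub> g) = analyse f \<oplus>\<^bsub>fock m wandering\<^esub> analyse g"
    "analyse (a \<odot>\<^bsub>fock m H\<^esub> f) = a \<odot>\<^bsub>fock m wandering\<^esub> analyse f"
proof -
  have S: "bounded_operator (fock m H) (fock m H) (bshift i)" if "i < m" for i
    by (rule H.bounded_operator_bshift[OF that])
  have p: "B.proj shifted f \<in> carrier (fock m H)" if "f \<in> carrier (fock m H)" for f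
    using proj_in[OF that] shifted_D(1) by blast
  have Ac: "A i f \<in> carrier (fock m H)" if "f \<in> carrier (fock m H)" "i < m" for i f
    using A_in[OF that] by simp
  have "coeff w (f \<oplus>\<^bsub>fock m H\<^esub> g) = coeff w f \<oplus>\<^bsub>fock m H\<^esub> coeff w g"
    if "f \<in> carrier (fock m H)" "g \<in> carrier (fock m H)" for f g w
    using that
  proof (induction w arbitrary: f g)
    case (Cons i w)
    show ?case
    proof (cases "i < m")
      case True
      thus ?thesis using Cons Ac p
        by (simp add: proj_linear bounded_operator.add[OF S])
    qed simp
  qed (simp add: D.add)
  thus "g \<in> carrier (fock m H) \<Longrightarrow>
      analyse (f \<oplus>\<^bsub>fock m H\<^esub> g) = analyse f \<oplus>\<^bsub>fock m wandering\<^esub> analyse g"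
    using assms by (simp add: analyse_def fun_eq_iff fock_simps(3)[of m wandering] wandering_simps)
  have "coeff w (a \<odot>\<^bsub>fock m H\<^esub> f) = a \<odot>\<^bsub>fock m H\<^esub> coeff w f" if "f \<in> carrier (fock m H)" for f w
    using that
  proof (induction w arbitrary: f)
    case (Cons i w)
    show ?case
    proof (cases "i < m")
      case True
      thus ?thesis using Cons Ac p
        by (simp add: proj_linear bounded_operator.smult[OF S])
    qed simp
  qed (simp add: D.smult)
  thus "analyse (a \<odot>\<^bsub>fock m H\<^esub> f) = a \<odot>\<^bsub>fock m wandering\<^esub> analyse f"
    using assms by (simp add: analyse_def fun_eq_iff fock_simps(4)[of m wandering] wandering_simps)
qed

lemma analyse_zero: "analyse \<zero>\<^bsub>fock m H\<^esub> = \<zero>\<^bsub>fock m wandering\<^esub>"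
proof -
  interpret FW: inner_product_space "fock m wandering" by (rule W.inner_product_space_fock)
  have c: "\<zero>\<^bsub>fock m H\<^esub> \<in> N" using P.zero by simp
  show ?thesis using analyse_linear(2)[of "\<zero>\<^bsub>fock m H\<^esub>" 0] B.smult_l_null[of "\<zero>\<^bsub>fock m H\<^esub>"]
    FW.smult_l_null[OF analyse_closed(1)[OF c]] by simp
qed

lemma analyse_creation:
  assumes f: "f \<in> N" and i: "i < m"
  shows "analyse (creation H i f) = creation wandering i (analyse f)"
proof
  fix w
  let ?g = "creation H i f"
  have g: "?g \<in> carrier (fock m H)" using creation_N[OF f i] by simp
  have z: "(\<lambda>w. \<zero>\<^bsub>H\<^esub>) \<in> N" using P.zero B.M.zero_closed by (simp add: fock_simps(2))
  have "?g \<in> shifted" using g f z by (auto simp: shifted_def H.creation_Nil H.bshift_creation)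
  hence p: "B.proj shifted ?g = ?g" using g by (intro B.proj_unique[OF shifted_closed]) auto
  show "analyse ?g w = creation wandering i (analyse f) w"
  proof (cases w)
    case Nil
    show ?thesis using g B.eq_iff_minus[OF g g]
      by (simp add: Nil analyse_Nil p creation_def wandering_simps)
  next
    case (Cons j v)
    show ?thesis
    proof (cases "j < m")
      case True
      have "analyse ?g (j # v) = analyse (bshift j ?g) v"
        using bshift_analyse[OF True, of ?g] unfolding p by (metis bshift_def)
      thus ?thesis using analyse_zero
        by (auto simp: Cons H.bshift_creation creation_def fock_simps(2) wandering_simps)
    next
      case False thus ?thesis using i by (auto simp: Cons analyse_outside creation_def)
    qed
  qed
qed

text \<open>
  The recursion of \<open>glue\<close> mirrors the orthogonal decomposition of \<open>N\<close>: the coefficient at the empty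
  word is the wandering part of \<open>synth x\<close>, and the other coefficients make up the shifted part \<open>h\<close>.
\<close>
lemma synth_decompose:
  fixes x
  defines "h \<equiv> \<lambda>u. case u of [] \<Rightarrow> \<zero>\<^bsub>H\<^esub> | i # v \<Rightarrow> if i < m then synth (bshift i x) v else \<zero>\<^bsub>H\<^esub>"
  assumes x: "x \<in> carrier (fock m wandering)" and N: "\<forall>i<m. synth (bshift i x) \<in> N"
  shows "h \<in> shifted" "synth x = h \<oplus>\<^bsub>fock m H\<^esub> x []" "B.proj shifted (synth x) = h"
    "\<And>i. i < m \<Longrightarrow> bshift i h = synth (bshift i x)"
    "(hnorm (fock m H) (synth x))\<^sup>2
      = (hnorm (fock m H) (x []))\<^sup>2 + (\<Sum>i<m. (hnorm (fock m H) (synth (bshift i x)))\<^sup>2)"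
proof -
  show b: "bshift i h = synth (bshift i x)" if "i < m" for i
    using that by (auto simp: h_def bshift_def fun_eq_iff)
  have hB: "h \<in> carrier (fock m H)"
    unfolding H.fock_iff[of h] using b N by (auto simp: h_def)
  show hs: "h \<in> shifted" using hB b N by (auto simp: shifted_def h_def)
  have x0: "x [] \<in> carrier wandering" using W.fock_D(1)[OF x] .
  hence x0B: "x [] \<in> carrier (fock m H)" and orth: "\<And>k. k \<in> shifted \<Longrightarrow> ip (fock m H) k (x []) = 0"
    by (auto simp: wandering_simps)
  show e: "synth x = h \<oplus>\<^bsub>fock m H\<^esub> x []"
  proof
    fix u
    have hc: "h u \<in> carrier H" "x [] u \<in> carrier H" using H.fock_D(1)[OF hB] H.fock_D(1)[OF x0B] by auto
    have "synth x u = x [] u \<oplus>\<^bsub>H\<^esub> h u" using hc by (cases u) (auto simp: synth_def h_def)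
    thus "synth x u = (h \<oplus>\<^bsub>fock m H\<^esub> x []) u" using hc by (simp add: fock_simps(3) H.M.a_comm)
  qed
  show "B.proj shifted (synth x) = h"
    unfolding e using hB x0B hs orth shifted_D(1)
    by (intro B.proj_unique[OF shifted_closed]) (auto simp: B.ip_add_r)
  have "(hnorm (fock m H) (synth x))\<^sup>2 = (hnorm (fock m H) h)\<^sup>2 + (hnorm (fock m H) (x []))\<^sup>2"
    unfolding e using B.hnorm_add_sq[OF hB x0B] orth[OF hs] by simp
  moreover have "(hnorm (fock m H) h)\<^sup>2 = (\<Sum>i<m. (hnorm (fock m H) (synth (bshift i x)))\<^sup>2)"
    using H.hnorm_fock_rec[OF hB] b by (simp add: h_def hnorm_def[of H "\<zero>\<^bsub>H\<^esub>"])
  ultimately show "(hnorm (fock m H) (synth x))\<^sup>2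
      = (hnorm (fock m H) (x []))\<^sup>2 + (\<Sum>i<m. (hnorm (fock m H) (synth (bshift i x)))\<^sup>2)" by simp
qed

lemma synth_zero: "synth (\<lambda>w. \<zero>\<^bsub>wandering\<^esub>) = \<zero>\<^bsub>fock m H\<^esub>"
proof -
  have "glue u (\<lambda>w. \<zero>\<^bsub>wandering\<^esub>) = \<zero>\<^bsub>H\<^esub>" for u
    by (induction u) (auto simp: wandering_simps fock_simps(2) bshift_def[abs_def])
  thus ?thesis by (simp add: synth_def fun_eq_iff fock_simps(2))
qed

lemma synth_trunc:
  assumes "x \<in> carrier (fock m wandering)"
  shows "synth (trunc wandering n x) \<in> N \<and>
    (hnorm (fock m H) (synth (trunc wandering n x)))\<^sup>2 \<le> (hnorm (fock m wandering) (trunc wandering n x))\<^sup>2"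
  using assms
proof (induction n arbitrary: x)
  case 0
  show ?case using P.zero B.hnorm_eq0[OF B.M.zero_closed] by (simp add: W.trunc_0 synth_zero)
next
  case (Suc n)
  let ?t = "trunc wandering (Suc n) x"
  have t: "?t \<in> carrier (fock m wandering)" using W.trunc_closed(1)[OF Suc.prems] .
  have b: "bshift i ?t = trunc wandering n (bshift i x)" for i by (rule W.bshift_trunc_Suc)
  have IH: "synth (bshift i ?t) \<in> N" "(hnorm (fock m H) (synth (bshift i ?t)))\<^sup>2 \<le> (hnorm (fock m wandering) (bshift i ?t))\<^sup>2"
    if "i < m" for i using Suc.IH[OF W.bshift_closed[OF Suc.prems that]] unfolding b by auto
  have "\<forall>i<m. synth (bshift i ?t) \<in> N" using IH(1) by blast
  note dec = synth_decompose[OF t this]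
  have t0: "?t [] \<in> N" using W.fock_D(1)[OF t, of "[]"] by (auto simp: wandering_simps)
  have "synth ?t \<in> N"
    unfolding dec(2) by (rule B.subspace_D(3)[OF P.subspace_kernel shifted_subset[OF dec(1)] t0])
  moreover have "(hnorm (fock m H) (synth ?t))\<^sup>2 \<le> (hnorm (fock m wandering) ?t)\<^sup>2"
    unfolding dec(5) W.hnorm_fock_rec[OF t] using IH(2)
    by (intro add_mono sum_mono) (auto simp: wandering_simps)
  ultimately show ?case by blast
qed

lemma glue_trunc: "length u < n \<Longrightarrow> glue u (trunc wandering n x) = glue u x"
proof (induction u arbitrary: n x)
  case Nil thus ?case by (simp add: trunc_def)
next
  case (Cons i v)
  then obtain k where k: "n = Suc k" "length v < k" by (cases n) auto
  show ?case using Cons.IH[OF k(2)] unfolding k(1) by (simp add: W.trunc_Suc_Nil W.bshift_trunc_Suc)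
qed

text \<open>
  For each word, both the value of \<open>synth x\<close> and that of its image under \<open>P\<close> depend only on a
  truncation of \<open>x\<close>.  So the results on finitely many coefficients carry over without limits.
\<close>
lemma synth_closed:
  assumes x: "x \<in> carrier (fock m wandering)"
  shows "synth x \<in> N" "hnorm (fock m H) (synth x) \<le> hnorm (fock m wandering) x"
proof -
  interpret FW: inner_product_space "fock m wandering" by (rule W.inner_product_space_fock)
  note t = synth_trunc[OF x] and n0 = FW.hnorm_ge0[OF x]
  have tc: "synth (trunc wandering n x) \<in> carrier (fock m H)" for n using t[of n] by simp
  have tr: "trunc H n (synth x) = trunc H n (synth (trunc wandering n x))" for n
    by (auto simp: trunc_def[of H] synth_def glue_trunc fun_eq_iff)
  have "hnorm (fock m H) (synth (trunc wandering n x)) \<le> hnorm (fock m wandering) x" for n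
    using t[of n] W.trunc_closed[OF x, of n] FW.hnorm_ge0 power2_le_imp_le order_trans by blast
  hence le: "hnorm (fock m H) (trunc H n (synth x)) \<le> hnorm (fock m wandering) x" for n
    unfolding tr using H.trunc_closed(2)[OF tc, of n n] order_trans by blast
  have "trunc H n (synth x) \<in> carrier (fock m H)" for n
    unfolding tr using H.trunc_closed(1)[OF tc] .
  note c = H.fock_if_trunc[OF this n0 le]
  show "hnorm (fock m H) (synth x) \<le> hnorm (fock m wandering) x" using c(2) .
  have "P (synth x) w = \<zero>\<^bsub>E\<^esub>" for w
  proof -
    define n where "n = Suc (length w)"
    let ?s = "synth (trunc wandering n x)"
    let ?g = "synth x \<ominus>\<^bsub>fock m H\<^esub> ?s"
    have "?g u = \<zero>\<^bsub>H\<^esub>" if "length u < n" for u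
    proof -
      have "?s u = synth x u" using that by (simp add: synth_def glue_trunc)
      thus ?thesis using H.fock_D(1)[OF c(1), of u] H.eq_iff_minus[of "synth x u" "synth x u"]
        unfolding H.fock_minus[OF c(1) tc] by simp
    qed
    hence "P ?g w = \<zero>\<^bsub>E\<^esub>" using c(1) tc by (intro P.of_vanishing[where n = n]) (auto simp: n_def)
    moreover have "P ?g = P (synth x)"
    proof -
      have "P ?g = P (synth x) \<ominus>\<^bsub>fock m E\<^esub> \<zero>\<^bsub>fock m E\<^esub>" using P.minus[OF c(1) tc] t[of n] by simp
      thus ?thesis using P.closed[OF c(1)] by (simp add: P.K.minus_eq)
    qed
    ultimately show ?thesis by simp
  qed
  thus "synth x \<in> N" using c(1) by (auto simp: fock_simps(2) fun_eq_iff)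
qed

lemma synth_linear:
  assumes "x \<in> carrier (fock m wandering)"
  shows "y \<in> carrier (fock m wandering) \<Longrightarrow>
      synth (x \<oplus>\<^bsub>fock m wandering\<^esub> y) = synth x \<oplus>\<^bsub>fock m H\<^esub> synth y"
    "synth (a \<odot>\<^bsub>fock m wandering\<^esub> x) = a \<odot>\<^bsub>fock m H\<^esub> synth x"
proof -
  have S: "bounded_operator (fock m wandering) (fock m wandering) (bshift i)" if "i < m" for i
    by (rule W.bounded_operator_bshift[OF that])
  have x0: "x [] u \<in> carrier H" if "x \<in> carrier (fock m wandering)" for x u
    using W.fock_D(1)[OF that, of "[]"] H.fock_D(1)[of "x []" m u] by (auto simp: wandering_simps)
  have gc: "glue u x \<in> carrier H" if "x \<in> carrier (fock m wandering)" for x u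
    using H.fock_D(1)[of "synth x" m u] synth_closed(1)[OF that] by (simp add: synth_def)
  have nil: "(x \<oplus>\<^bsub>fock m wandering\<^esub> y) [] u = x [] u \<oplus>\<^bsub>H\<^esub> y [] u" "(a \<odot>\<^bsub>fock m wandering\<^esub> x) [] u = a \<odot>\<^bsub>H\<^esub> x [] u" for x y u
    by (simp_all add: fock_simps wandering_simps)
  have "glue u (x \<oplus>\<^bsub>fock m wandering\<^esub> y) = glue u x \<oplus>\<^bsub>H\<^esub> glue u y"
    if "x \<in> carrier (fock m wandering)" "y \<in> carrier (fock m wandering)" for x y u
    using that
  proof (induction u arbitrary: x y)
    case (Cons i v)
    show ?case
    proof (cases "i < m")
      case True
      note b = W.bshift_closed[OF Cons.prems(1) True] W.bshift_closed[OF Cons.prems(2) True]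
      show ?thesis using True Cons.IH[OF b] x0[OF Cons.prems(1)] x0[OF Cons.prems(2)] gc[OF b(1)] gc[OF b(2)]
        by (simp add: nil bounded_operator.add[OF S Cons.prems] H.M.a_ac)
    qed (use x0 Cons.prems in \<open>simp add: nil\<close>)
  qed (simp add: nil)
  thus "y \<in> carrier (fock m wandering) \<Longrightarrow>
      synth (x \<oplus>\<^bsub>fock m wandering\<^esub> y) = synth x \<oplus>\<^bsub>fock m H\<^esub> synth y"
    using assms by (simp add: synth_def fun_eq_iff fock_simps(3)[of m H])
  have "glue u (a \<odot>\<^bsub>fock m wandering\<^esub> x) = a \<odot>\<^bsub>H\<^esub> glue u x" if "x \<in> carrier (fock m wandering)" for x u
    using that
  proof (induction u arbitrary: x)
    case (Cons i v)
    show ?case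
    proof (cases "i < m")
      case True
      note b = W.bshift_closed[OF Cons.prems True]
      show ?thesis using True Cons.IH[OF b] x0[OF Cons.prems] gc[OF b]
        by (simp add: nil bounded_operator.smult[OF S Cons.prems] H.smult_r_distr)
    qed (use x0 Cons.prems in \<open>simp add: nil\<close>)
  qed (simp add: nil)
  thus "synth (a \<odot>\<^bsub>fock m wandering\<^esub> x) = a \<odot>\<^bsub>fock m H\<^esub> synth x"
    using assms by (simp add: synth_def fun_eq_iff fock_simps(4)[of m H])
qed

lemma synth_analyse:
  assumes "f \<in> N"
  shows "synth (analyse f) = f"
proof
  fix u
  have "glue u (analyse f) = f u" using assms
  proof (induction u arbitrary: f)
    case Nil
    have f: "f \<in> carrier (fock m H)" using Nil by simp
    have "B.proj shifted f [] = \<zero>\<^bsub>H\<^esub>" using proj_in[OF f] by (simp add: shifted_def)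
    thus ?case using decompose[OF f, of "[]"] H.fock_D(1)[OF D.closed[OF f]] by (simp add: analyse_Nil)
  next
    case (Cons i v)
    have f: "f \<in> carrier (fock m H)" using Cons.prems by simp
    have p: "B.proj shifted f \<in> carrier (fock m H)" using proj_in[OF f] shifted_D(1) by blast
    show ?case
    proof (cases "i < m")
      case True
      have "glue (i # v) (analyse f) = D f (i # v) \<oplus>\<^bsub>H\<^esub> A i f v"
        using True Cons.IH[OF A_in[OF f True]] by (simp add: analyse_Nil bshift_analyse)
      thus ?thesis using decompose[OF f, of "i # v"] by (simp add: bshift_def)
    next
      case False
      thus ?thesis using H.fock_D(2)[OF D.closed[OF f], of "i # v"] H.fock_D(2)[OF f, of "i # v"]
        by (simp add: analyse_Nil)
    qed
  qed
  thus "synth (analyse f) u = f u" by (simp add: synth_def)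
qed

lemma analyse_synth:
  assumes "x \<in> carrier (fock m wandering)"
  shows "analyse (synth x) = x"
proof
  fix w
  show "analyse (synth x) w = x w" using assms
  proof (induction w arbitrary: x)
    case Nil
    have "\<forall>i<m. synth (bshift i x) \<in> N" using synth_closed(1)[OF W.bshift_closed[OF Nil]] by blast
    note dec = synth_decompose[OF Nil this]
    let ?h = "\<lambda>u. case u of [] \<Rightarrow> \<zero>\<^bsub>H\<^esub> | i # v \<Rightarrow> if i < m then synth (bshift i x) v else \<zero>\<^bsub>H\<^esub>"
    have c: "x [] \<in> carrier (fock m H)" using W.fock_D(1)[OF Nil, of "[]"] by (auto simp: wandering_simps)
    have h: "?h \<in> carrier (fock m H)" using dec(1) shifted_D(1) by blast
    have "D (synth x) = x []"
      unfolding dec(3) unfolding dec(2) using c h by (intro B.eqI_ip) (auto simp: B.ip_linear)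
    thus ?case by (simp add: analyse_Nil)
  next
    case (Cons i w)
    have "\<forall>i<m. synth (bshift i x) \<in> N" using synth_closed(1)[OF W.bshift_closed[OF Cons.prems]] by blast
    note dec = synth_decompose[OF Cons.prems this]
    show ?case
    proof (cases "i < m")
      case True
      have "analyse (synth x) (i # w) = analyse (A i (synth x)) w"
        using bshift_analyse[OF True, of "synth x"] by (metis bshift_def)
      also have "\<dots> = bshift i x w"
        unfolding dec(3) dec(4)[OF True] by (rule Cons.IH[OF W.bshift_closed[OF Cons.prems True]])
      finally show ?thesis by (simp add: bshift_def)
    next
      case False
      thus ?thesis using W.fock_D(2)[OF Cons.prems, of "i # w"] by (simp add: analyse_outside)
    qed
  qed
qed

end

section \<open>Extending intertwiners of the backward shifts\<close>

text \<open>
  An operator, defined only on a subspace \<open>G\<close> invariant under the backward shifts, that intertwines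
  these with the backward shifts of the other Fock module.
\<close>
definition backward_intertwiner ::
  "nat \<Rightarrow> ('a, 'y) hilbert_scheme \<Rightarrow> ('b, 'z) hilbert_scheme \<Rightarrow> real \<Rightarrow> (nat list \<Rightarrow> 'a) set \<Rightarrow>
    ((nat list \<Rightarrow> 'a) \<Rightarrow> nat list \<Rightarrow> 'b) \<Rightarrow> bool" where
  "backward_intertwiner m H F C G W \<longleftrightarrow> subspace_of (fock m H) G \<and>
     (\<forall>g\<in>G. \<forall>i<m. bshift i g \<in> G) \<and>
     (\<forall>g\<in>G. W g \<in> carrier (fock m F)) \<and>
     (\<forall>g\<in>G. \<forall>h\<in>G. W (g \<oplus>\<^bsub>fock m H\<^esub> h) = W g \<oplus>\<^bsub>fock m F\<^esub> W h) \<and>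
     (\<forall>a. \<forall>g\<in>G. W (a \<odot>\<^bsub>fock m H\<^esub> g) = a \<odot>\<^bsub>fock m F\<^esub> W g) \<and>
     (\<forall>g\<in>G. hnorm (fock m F) (W g) \<le> C * hnorm (fock m H) g) \<and>
     (\<forall>g\<in>G. \<forall>i<m. bshift i (W g) = W (bshift i g))"

definition pre_shifted :: "nat \<Rightarrow> ('a, 'y) hilbert_scheme \<Rightarrow> (nat list \<Rightarrow> 'a) set \<Rightarrow> (nat list \<Rightarrow> 'a) set" where
  "pre_shifted m H G = {f \<in> carrier (fock m H). \<forall>i<m. bshift i f \<in> G}"

text \<open>
  On \<open>G\<close>, the identity \<open>\<parallel>W g\<parallel>\<^sup>2 = \<parallel>W g []\<parallel>\<^sup>2 + (\<Sum>i<m. \<parallel>W (bshift i g)\<parallel>\<^sup>2)\<close> and the bound \<open>C\<close> say that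
  the square of the norm of \<open>W g []\<close> is at most \<open>t g g\<close>, where \<open>t\<close> is the form of the proof.
  This form makes sense on the larger space because it involves \<open>W\<close> only at backward shifts.
  It is positive there: by the bound \<open>C\<close>, the subtracted sum is at most \<open>C\<^sup>2\<close> times the sum of the
  \<open>\<parallel>bshift i f\<parallel>\<^sup>2\<close>, hence at most \<open>C\<^sup>2 \<parallel>f\<parallel>\<^sup>2\<close>.
  So the component at the empty word extends, and the other components are forced.
\<close>
lemma backward_intertwiner_step:
  assumes "hilbert_space H" "hilbert_space F" and C: "0 \<le> C"
    and W: "backward_intertwiner m H F C G W"
  shows "\<exists>W'. backward_intertwiner m H F C (pre_shifted m H G) W' \<and> (\<forall>g\<in>G. W' g = W g)"
proof -
  interpret H: hilbert_space H by fact
  interpret F: hilbert_space F by fact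
  interpret B: hilbert_space "fock m H" by (rule H.hilbert_space_fock)
  interpret FF: hilbert_space "fock m F" by (rule F.hilbert_space_fock)
  have S: "bounded_operator (fock m H) (fock m H) (bshift i)" if "i < m" for i
    by (rule H.bounded_operator_bshift[OF that])
  have G: "subspace_of (fock m H) G" using W by (simp add: backward_intertwiner_def)
  note GD = B.subspace_D[OF G]
  have inv: "bshift i g \<in> G" if "g \<in> G" "i < m" for g i using W that by (simp add: backward_intertwiner_def)
  have Wc: "W g \<in> carrier (fock m F)" if "g \<in> G" for g using W that by (simp add: backward_intertwiner_def)
  have Wadd: "W (g \<oplus>\<^bsub>fock m H\<^esub> h) = W g \<oplus>\<^bsub>fock m F\<^esub> W h" if "g \<in> G" "h \<in> G" for g h
    using W that by (simp add: backward_intertwiner_def)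
  have Wsm: "W (a \<odot>\<^bsub>fock m H\<^esub> g) = a \<odot>\<^bsub>fock m F\<^esub> W g" if "g \<in> G" for g a
    using W that by (simp add: backward_intertwiner_def)
  have Wb: "(hnorm (fock m F) (W g))\<^sup>2 \<le> C\<^sup>2 * (hnorm (fock m H) g)\<^sup>2" if "g \<in> G" for g
    using W that FF.hnorm_ge0[OF Wc[OF that]] unfolding power_mult_distrib[symmetric]
    by (intro power_mono) (simp_all add: backward_intertwiner_def)
  have Wi: "bshift i (W g) = W (bshift i g)" if "g \<in> G" "i < m" for g i
    using W that by (simp add: backward_intertwiner_def)
  define G' where "G' = pre_shifted m H G"
  have G'_D: "f \<in> carrier (fock m H)" "i < m \<Longrightarrow> bshift i f \<in> G" if "f \<in> G'" for f i
    using that by (auto simp: G'_def pre_shifted_def)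
  have GG': "g \<in> G'" if "g \<in> G" for g using that GD(1) inv by (auto simp: G'_def pre_shifted_def)
  have G': "subspace_of (fock m H) G'"
  proof (rule B.subspace_I)
    fix f g a assume f: "f \<in> G'"
    {
      assume g: "g \<in> G'"
      show "f \<oplus>\<^bsub>fock m H\<^esub> g \<in> G'"
        using G'_D[OF f] G'_D[OF g] GD(3) bounded_operator.add[OF S]
        by (simp add: G'_def pre_shifted_def)
    }
    show "a \<odot>\<^bsub>fock m H\<^esub> f \<in> G'"
      using G'_D[OF f] GD(4) bounded_operator.smult[OF S] by (simp add: G'_def pre_shifted_def)
  qed (use GG' GD(2) in \<open>auto simp: G'_def pre_shifted_def\<close>)
  define t where "t f g = of_real (C\<^sup>2) * ip (fock m H) f g -
    (\<Sum>i<m. ip (fock m F) (W (bshift i f)) (W (bshift i g)))" for f g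
  have tt: "Re (t f f) = C\<^sup>2 * (hnorm (fock m H) f)\<^sup>2 - (\<Sum>i<m. (hnorm (fock m F) (W (bshift i f)))\<^sup>2)"
    if "f \<in> G'" for f
    using G'_D[OF that] by (simp add: t_def B.ip_self FF.ip_self Wc flip: of_real_power of_real_mult)
  have Wsum: "(\<Sum>i<m. (hnorm (fock m F) (W (bshift i f)))\<^sup>2) \<le> C\<^sup>2 * (\<Sum>i<m. (hnorm (fock m H) (bshift i f))\<^sup>2)"
    if "f \<in> G'" for f
    unfolding sum_distrib_left using G'_D[OF that] by (intro sum_mono Wb) auto
  interpret V: semi_inner_product_space "fock m H\<lparr>carrier := G'\<rparr>" t
  proof (intro semi_inner_product_space.intro semi_inner_product_space_axioms.intro)
    show "Module.module complex_field (fock m H\<lparr>carrier := G'\<rparr>)"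
      by (rule submodule.submodule_is_module[OF G' B.module_H])
    fix f g h a assume f': "f \<in> carrier (fock m H\<lparr>carrier := G'\<rparr>)"
    hence f: "f \<in> G'" by simp
    note fD = G'_D[OF f]
    {
      assume g': "g \<in> carrier (fock m H\<lparr>carrier := G'\<rparr>)"
      hence g: "g \<in> G'" by simp
      note gD = G'_D[OF g]
      show "t (a \<odot>\<^bsub>fock m H\<lparr>carrier := G'\<rparr>\<^esub> f) g = a * t f g"
        using fD gD Wc by (simp add: t_def B.ip_smult bounded_operator.smult[OF S] Wsm FF.ip_smult
            sum_distrib_left right_diff_distrib)
      show "t g f = cnj (t f g)"
        using fD gD Wc B.ip_cnj[OF fD(1) gD(1)] FF.ip_cnj[OF Wc[OF fD(2)] Wc[OF gD(2)]] by (simp add: t_def)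
      assume h': "h \<in> carrier (fock m H\<lparr>carrier := G'\<rparr>)"
      hence h: "h \<in> G'" by simp
      note hD = G'_D[OF h]
      show "t (f \<oplus>\<^bsub>fock m H\<lparr>carrier := G'\<rparr>\<^esub> g) h = t f h + t g h"
        using fD gD hD Wc by (simp add: t_def B.ip_add bounded_operator.add[OF S] Wadd FF.ip_add
            sum.distrib algebra_simps)
    }
    have "(\<Sum>i<m. (hnorm (fock m H) (bshift i f))\<^sup>2) \<le> (hnorm (fock m H) f)\<^sup>2"
      using H.hnorm_fock_rec[OF fD(1)] by simp
    hence "C\<^sup>2 * (\<Sum>i<m. (hnorm (fock m H) (bshift i f))\<^sup>2) \<le> C\<^sup>2 * (hnorm (fock m H) f)\<^sup>2"
      by (rule mult_left_mono) simp
    thus "0 \<le> Re (t f f)" using Wsum[OF f] unfolding tt[OF f] by linarith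
  qed
  have GV: "subspace_of (fock m H\<lparr>carrier := G'\<rparr>) G"
    by (rule subspaceI[OF submodule.submodule_is_module[OF G' B.module_H]]) (use GG' GD in auto)
  have "\<exists>c. (\<forall>x\<in>carrier (fock m H\<lparr>carrier := G'\<rparr>). c x \<in> carrier F) \<and>
    (\<forall>x\<in>carrier (fock m H\<lparr>carrier := G'\<rparr>). \<forall>y\<in>carrier (fock m H\<lparr>carrier := G'\<rparr>).
      c (x \<oplus>\<^bsub>fock m H\<lparr>carrier := G'\<rparr>\<^esub> y) = c x \<oplus>\<^bsub>F\<^esub> c y) \<and>
    (\<forall>a. \<forall>x\<in>carrier (fock m H\<lparr>carrier := G'\<rparr>). c (a \<odot>\<^bsub>fock m H\<lparr>carrier := G'\<rparr>\<^esub> x) = a \<odot>\<^bsub>F\<^esub> c x) \<and>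
    (\<forall>x\<in>carrier (fock m H\<lparr>carrier := G'\<rparr>). (hnorm F (c x))\<^sup>2 \<le> Re (t x x)) \<and> (\<forall>x\<in>G. c x = W x [])"
  proof (rule V.extend_operator[OF \<open>hilbert_space F\<close> GV])
    fix f assume f: "f \<in> G"
    show "W f [] \<in> carrier F" using F.fock_D(1)[OF Wc[OF f]] .
    show "W (f \<oplus>\<^bsub>fock m H\<lparr>carrier := G'\<rparr>\<^esub> g) [] = W f [] \<oplus>\<^bsub>F\<^esub> W g []" if "g \<in> G" for g
      using Wadd[OF f that] by (simp add: fock_simps(3)[of m F])
    show "W (a \<odot>\<^bsub>fock m H\<lparr>carrier := G'\<rparr>\<^esub> f) [] = a \<odot>\<^bsub>F\<^esub> W f []" for a
      using Wsm[OF f] by (simp add: fock_simps(4)[of m F])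
    have "(hnorm F (W f []))\<^sup>2 = (hnorm (fock m F) (W f))\<^sup>2 - (\<Sum>i<m. (hnorm (fock m F) (W (bshift i f)))\<^sup>2)"
      using F.hnorm_fock_rec[OF Wc[OF f]] Wi[OF f] by simp
    thus "(hnorm F (W f []))\<^sup>2 \<le> Re (t f f)" using Wb[OF f] unfolding tt[OF GG'[OF f]] by simp
  qed
  then obtain c where "(\<forall>f\<in>G'. c f \<in> carrier F) \<and>
      (\<forall>f\<in>G'. \<forall>g\<in>G'. c (f \<oplus>\<^bsub>fock m H\<^esub> g) = c f \<oplus>\<^bsub>F\<^esub> c g) \<and>
      (\<forall>a. \<forall>f\<in>G'. c (a \<odot>\<^bsub>fock m H\<^esub> f) = a \<odot>\<^bsub>F\<^esub> c f) \<and>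
      (\<forall>f\<in>G'. (hnorm F (c f))\<^sup>2 \<le> Re (t f f)) \<and> (\<forall>f\<in>G. c f = W f [])"
    by auto
  hence c: "\<And>f. f \<in> G' \<Longrightarrow> c f \<in> carrier F"
    "\<And>f g. f \<in> G' \<Longrightarrow> g \<in> G' \<Longrightarrow> c (f \<oplus>\<^bsub>fock m H\<^esub> g) = c f \<oplus>\<^bsub>F\<^esub> c g"
    "\<And>a f. f \<in> G' \<Longrightarrow> c (a \<odot>\<^bsub>fock m H\<^esub> f) = a \<odot>\<^bsub>F\<^esub> c f"
    "\<And>f. f \<in> G' \<Longrightarrow> (hnorm F (c f))\<^sup>2 \<le> Re (t f f)" "\<And>f. f \<in> G \<Longrightarrow> c f = W f []"
    by blast+
  define W' where "W' f w = (case w of [] \<Rightarrow> c f | i # v \<Rightarrow> if i < m then W (bshift i f) v else \<zero>\<^bsub>F\<^esub>)" for f w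
  have W'0: "W' f [] = c f" and W's: "i < m \<Longrightarrow> bshift i (W' f) = W (bshift i f)" for f i
    by (auto simp: W'_def bshift_def fun_eq_iff)
  have W'c: "W' f \<in> carrier (fock m F)" if f: "f \<in> G'" for f
    unfolding F.fock_iff[of "W' f"] using W'0 W's c(1)[OF f] Wc G'_D(2)[OF f] by (auto simp: W'_def)
  have on_G: "W' g = W g" if g: "g \<in> G" for g
  proof
    fix w show "W' g w = W g w"
    proof (cases w)
      case Nil thus ?thesis using c(5)[OF g] W'0 by simp
    next
      case (Cons i v)
      show ?thesis
      proof (cases "i < m")
        case True
        have "W (bshift i g) v = W g (i # v)" unfolding Wi[OF g True, symmetric] bshift_def ..
        thus ?thesis using True by (simp add: Cons W'_def)
      next
        case False thus ?thesis using F.fock_D(2)[OF Wc[OF g], of w] by (simp add: Cons W'_def)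
      qed
    qed
  qed
  have fF: "W (bshift i f) v \<in> carrier F" if "f \<in> G'" "i < m" for f i v
    using F.fock_D(1)[OF Wc[OF G'_D(2)[OF that]]] .
  have "backward_intertwiner m H F C G' W'" unfolding backward_intertwiner_def
  proof (intro conjI ballI allI impI)
    show "subspace_of (fock m H) G'" by (rule G')
    fix f g i and a :: complex assume f: "f \<in> G'"
    show "W' f \<in> carrier (fock m F)" by (rule W'c[OF f])
    {
      assume i: "i < m"
      show "bshift i f \<in> G'" using GG' G'_D(2)[OF f i] by simp
      show "bshift i (W' f) = W' (bshift i f)" using W's[OF i] on_G[OF G'_D(2)[OF f i]] by simp
    }
    show "W' (f \<oplus>\<^bsub>fock m H\<^esub> g) = W' f \<oplus>\<^bsub>fock m F\<^esub> W' g" if g: "g \<in> G'"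
    proof
      fix w
      have e: "W (bshift i (f \<oplus>\<^bsub>fock m H\<^esub> g)) v = W (bshift i f) v \<oplus>\<^bsub>F\<^esub> W (bshift i g) v" if i: "i < m" for i v
        using bounded_operator.add[OF S[OF i] G'_D(1)[OF f] G'_D(1)[OF g]]
          Wadd[OF G'_D(2)[OF f i] G'_D(2)[OF g i]] by (simp add: fock_simps(3)[of m F])
      show "W' (f \<oplus>\<^bsub>fock m H\<^esub> g) w = (W' f \<oplus>\<^bsub>fock m F\<^esub> W' g) w"
        using c(2)[OF f g] e by (cases w) (auto simp: W'_def fock_simps(3)[of m F])
    qed
    show "W' (a \<odot>\<^bsub>fock m H\<^esub> f) = a \<odot>\<^bsub>fock m F\<^esub> W' f"
    proof
      fix w
      have e: "W (bshift i (a \<odot>\<^bsub>fock m H\<^esub> f)) v = a \<odot>\<^bsub>F\<^esub> W (bshift i f) v" if i: "i < m" for i v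
        using bounded_operator.smult[OF S[OF i] G'_D(1)[OF f]]
          Wsm[OF G'_D(2)[OF f i]] by (simp add: fock_simps(4)[of m F])
      show "W' (a \<odot>\<^bsub>fock m H\<^esub> f) w = (a \<odot>\<^bsub>fock m F\<^esub> W' f) w"
        using c(3)[OF f] e by (cases w) (auto simp: W'_def fock_simps(4)[of m F])
    qed
    have "(hnorm (fock m F) (W' f))\<^sup>2 = (hnorm F (c f))\<^sup>2 + (\<Sum>i<m. (hnorm (fock m F) (W (bshift i f)))\<^sup>2)"
      using F.hnorm_fock_rec[OF W'c[OF f]] by (simp add: W'0 W's)
    hence "(hnorm (fock m F) (W' f))\<^sup>2 \<le> (C * hnorm (fock m H) f)\<^sup>2"
      using c(4)[OF f] unfolding tt[OF f] by (simp add: power_mult_distrib)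
    thus "hnorm (fock m F) (W' f) \<le> C * hnorm (fock m H) f"
      using C B.hnorm_ge0[OF G'_D(1)[OF f]] power2_le_imp_le mult_nonneg_nonneg by blast
  qed
  thus ?thesis using on_G unfolding G'_def by blast
qed

definition single :: "('a, 'z) hilbert_scheme \<Rightarrow> nat list \<Rightarrow> 'a \<Rightarrow> nat list \<Rightarrow> 'a" where
  "single H w x v = (if v = w then x else \<zero>\<^bsub>H\<^esub>)"

context inner_product_space begin

lemma single_closed:
  assumes x: "x \<in> carrier H" and w: "w \<in> words m"
  shows "single H w x \<in> carrier (fock m H)"
proof -
  have "(\<lambda>v. (hnorm H (single H w x v))\<^sup>2) summable_on words m \<longleftrightarrow>
      (\<lambda>v. (hnorm H (single H w x v))\<^sup>2) summable_on {w}"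
    using w by (intro summable_on_cong_neutral) (auto simp: single_def hnorm_def)
  thus ?thesis using x w by (auto simp: fock_simps single_def)
qed

lemma bshift_single: "bshift i (single H w x) =
    (case w of [] \<Rightarrow> (\<lambda>v. \<zero>) | j # u \<Rightarrow> if i = j then single H u x else (\<lambda>v. \<zero>))"
  by (auto simp: bshift_def single_def fun_eq_iff split: list.split)

lemma ip_single:
  assumes x: "x \<in> carrier H" and w: "w \<in> words m" and z: "z \<in> carrier (fock m H)"
  shows "ip (fock m H) (single H w x) z = ip H x (z w)"
proof -
  have "ip (fock m H) (single H w x) z = (\<Sum>\<^sub>\<infinity>v\<in>{w}. ip H (single H w x v) (z v))"
    unfolding fock_simps using w fock_D(1)[OF z] by (intro infsum_cong_neutral) (auto simp: single_def)
  thus ?thesis by (simp add: single_def)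
qed

end

text \<open>
  The steps are repeated along an increasing sequence of subspaces \<open>Gn n\<close>.  A family supported at one
  word of length \<open>n\<close> lies in \<open>Gn (n + 1)\<close>, since \<open>n + 1\<close> backward shifts annihilate it.  So the union
  \<open>U\<close> determines vectors by inner products, and \<open>L u\<close> is well defined by its inner products with \<open>U\<close>.
\<close>
lemma backward_intertwiner_adjoint:
  assumes "hilbert_space H" "hilbert_space F" and C: "0 \<le> C"
    and W: "backward_intertwiner m H F C G W"
  shows "\<exists>L. multi_analytic m F H L \<and>
    (\<forall>g\<in>G. \<forall>u\<in>carrier (fock m F). ip (fock m H) g (L u) = ip (fock m F) (W g) u)"
proof -
  interpret H: hilbert_space H by fact
  interpret F: hilbert_space F by fact
  interpret B: hilbert_space "fock m H" by (rule H.hilbert_space_fock)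
  interpret FF: hilbert_space "fock m F" by (rule F.hilbert_space_fock)
  define Gn where "Gn n = (pre_shifted m H ^^ n) G" for n
  have Gn0: "Gn 0 = G" and GnS: "Gn (Suc n) = pre_shifted m H (Gn n)" for n by (simp_all add: Gn_def)
  have "\<exists>Wn. \<forall>n. backward_intertwiner m H F C (Gn n) (Wn n) \<and>
      ((n = 0 \<longrightarrow> Wn n = W) \<and> (\<forall>g\<in>Gn n. Wn (Suc n) g = Wn n g))"
  proof -
    have "\<exists>f. \<forall>n. (backward_intertwiner m H F C (Gn n) (f n) \<and> (n = 0 \<longrightarrow> f n = W)) \<and> (\<forall>g\<in>Gn n. f (Suc n) g = f n g)"
    proof (rule dependent_nat_choice)
      show "\<exists>W'. backward_intertwiner m H F C (Gn 0) W' \<and> ((0::nat) = 0 \<longrightarrow> W' = W)" using W Gn0 by auto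
      show "\<exists>W''. (backward_intertwiner m H F C (Gn (Suc n)) W'' \<and> (Suc n = 0 \<longrightarrow> W'' = W)) \<and> (\<forall>g\<in>Gn n. W'' g = W' g)"
        if "backward_intertwiner m H F C (Gn n) W' \<and> (n = 0 \<longrightarrow> W' = W)" for W' n
        using backward_intertwiner_step[OF assms(1-3), of m "Gn n" W'] that unfolding GnS by auto
    qed
    thus ?thesis by blast
  qed
  then obtain Wn where Wn: "\<And>n. backward_intertwiner m H F C (Gn n) (Wn n)" "Wn 0 = W"
    "\<And>n g. g \<in> Gn n \<Longrightarrow> Wn (Suc n) g = Wn n g" by blast
  have G: "subspace_of (fock m H) (Gn n)" for n using Wn(1)[of n] by (simp add: backward_intertwiner_def)
  note GD = B.subspace_D[OF G]
  have sub: "g \<in> Gn (Suc n)" if "g \<in> Gn n" for g n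
    using that GD(1)[OF that] Wn(1)[of n] unfolding GnS pre_shifted_def backward_intertwiner_def by simp
  have mono: "g \<in> Gn k \<and> Wn k g = Wn n g" if g: "g \<in> Gn n" and "n \<le> k" for g n k
    using \<open>n \<le> k\<close>
  proof (induction k rule: dec_induct)
    case (step k) thus ?case using sub[of g k] Wn(3)[of g k] by simp
  qed (use g in simp)
  define U where "U = (\<Union>n. Gn n)"
  have join: "\<exists>n. f \<in> Gn n \<and> g \<in> Gn n" if "f \<in> U" "g \<in> U" for f g
  proof -
    obtain n k where "f \<in> Gn n" "g \<in> Gn k" using \<open>f \<in> U\<close> \<open>g \<in> U\<close> by (auto simp: U_def)
    thus ?thesis using mono[of f n "max n k"] mono[of g k "max n k"] by auto
  qed
  have Uc: "f \<in> carrier (fock m H)" if "f \<in> U" for f using that GD(1) by (auto simp: U_def)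
  have U: "subspace_of (fock m H) U"
  proof (rule B.subspace_I)
    show "\<zero>\<^bsub>fock m H\<^esub> \<in> U" using GD(2) by (auto simp: U_def)
    show "f \<oplus>\<^bsub>fock m H\<^esub> g \<in> U" if "f \<in> U" "g \<in> U" for f g
      using join[OF that] GD(3) unfolding U_def by blast
    show "a \<odot>\<^bsub>fock m H\<^esub> f \<in> U" if "f \<in> U" for f a using that GD(4) unfolding U_def by blast
  qed (use Uc in auto)
  define V where "V f = Wn (LEAST n. f \<in> Gn n) f" for f
  have V: "V f = Wn n f" if "f \<in> Gn n" for f n
    unfolding V_def using mono[of f "LEAST n. f \<in> Gn n" n] LeastI[of "\<lambda>n. f \<in> Gn n" n] Least_le[of "\<lambda>n. f \<in> Gn n" n] that
    by simp
  have Vc: "V f \<in> carrier (fock m F)" "hnorm (fock m F) (V f) \<le> C * hnorm (fock m H) f"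
    "i < m \<Longrightarrow> bshift i f \<in> U \<and> bshift i (V f) = V (bshift i f)"
    "V (a \<odot>\<^bsub>fock m H\<^esub> f) = a \<odot>\<^bsub>fock m F\<^esub> V f" if "f \<in> U" for f i a
  proof -
    obtain n where n: "f \<in> Gn n" using \<open>f \<in> U\<close> by (auto simp: U_def)
    note I = Wn(1)[of n, unfolded backward_intertwiner_def]
    show "V f \<in> carrier (fock m F)" "hnorm (fock m F) (V f) \<le> C * hnorm (fock m H) f"
      using I n V[OF n] by simp_all
    have b: "bshift i f \<in> Gn n" if "i < m" using I n that by simp
    thus "bshift i f \<in> U \<and> bshift i (V f) = V (bshift i f)" if "i < m"
      using I n V[OF n] V[OF b[OF that]] that by (auto simp: U_def)
    show "V (a \<odot>\<^bsub>fock m H\<^esub> f) = a \<odot>\<^bsub>fock m F\<^esub> V f" using I n V[OF n] V[OF GD(4)[OF n]] by simp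
  qed
  have Vadd: "V (f \<oplus>\<^bsub>fock m H\<^esub> g) = V f \<oplus>\<^bsub>fock m F\<^esub> V g" if fg: "f \<in> U" "g \<in> U" for f g
  proof -
    obtain n where n: "f \<in> Gn n" "g \<in> Gn n" using join[OF fg] by blast
    show ?thesis using Wn(1)[of n] n V[OF n(1)] V[OF n(2)] V[OF GD(3)[OF n]]
      by (simp add: backward_intertwiner_def)
  qed
  have single: "single H w x \<in> U" if x: "x \<in> carrier H" and "w \<in> words m" for x w
  proof -
    have "single H w x \<in> Gn (Suc (length w))" using \<open>w \<in> words m\<close>
    proof (induction w)
      case Nil
      have "(\<lambda>v. \<zero>\<^bsub>H\<^esub>) \<in> Gn 0" using GD(2)[of 0] by (simp add: fock_simps(2))
      thus ?case unfolding GnS pre_shifted_def using H.single_closed[OF x Nil] by (simp add: H.bshift_single)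
    next
      case (Cons j u)
      have "(\<lambda>v. \<zero>\<^bsub>H\<^esub>) \<in> Gn (length (j # u))" using GD(2) by (simp add: fock_simps(2))
      thus ?case unfolding GnS[of "length (j # u)"] pre_shifted_def
        using H.single_closed[OF x Cons.prems] Cons by (simp add: H.bshift_single)
    qed
    thus ?thesis by (auto simp: U_def)
  qed
  have separate: "z = z'" if z: "z \<in> carrier (fock m H)" "z' \<in> carrier (fock m H)"
    and eq: "\<And>f. f \<in> U \<Longrightarrow> ip (fock m H) f z = ip (fock m H) f z'" for z z'
  proof
    fix w show "z w = z' w"
    proof (cases "w \<in> words m")
      case True
      show ?thesis
        using H.fock_D(1)[OF z(1)] H.fock_D(1)[OF z(2)] eq[OF single[OF _ True]] H.ip_single[OF _ True z(1)] H.ip_single[OF _ True z(2)]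
        by (intro H.eqI_ip) auto
    next
      case False thus ?thesis using H.fock_D(2)[OF z(1)] H.fock_D(2)[OF z(2)] by simp
    qed
  qed
  have "\<exists>z. z \<in> carrier (fock m H) \<and> hnorm (fock m H) z \<le> C * hnorm (fock m F) u \<and>
      (\<forall>f\<in>U. ip (fock m H) f z = ip (fock m F) (V f) u)" if u: "u \<in> carrier (fock m F)" for u
  proof -
    have "\<exists>z\<in>carrier (fock m H). hnorm (fock m H) z \<le> C * hnorm (fock m F) u \<and>
      (\<forall>f\<in>U. ip (fock m H) f z = ip (fock m F) (V f) u) \<and> (B.seq_closed U \<longrightarrow> z \<in> U)"
    proof (rule B.riesz[OF U])
      fix f assume f: "f \<in> U"
      have "cmod (ip (fock m F) (V f) u) \<le> hnorm (fock m F) (V f) * hnorm (fock m F) u"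
        using Vc(1)[OF f] u by (rule FF.cauchy_schwarz)
      also have "\<dots> \<le> (C * hnorm (fock m H) f) * hnorm (fock m F) u"
        using Vc(2)[OF f] FF.hnorm_ge0[OF u] by (rule mult_right_mono)
      finally show "cmod (ip (fock m F) (V f) u) \<le> C * hnorm (fock m F) u * hnorm (fock m H) f" by (simp add: mult_ac)
    qed (use u C FF.hnorm_ge0[OF u] in \<open>simp_all add: Vadd Vc FF.ip_add FF.ip_smult\<close>)
    thus ?thesis by blast
  qed
  then obtain L where L: "\<And>u. u \<in> carrier (fock m F) \<Longrightarrow> L u \<in> carrier (fock m H)"
    "\<And>u. u \<in> carrier (fock m F) \<Longrightarrow> hnorm (fock m H) (L u) \<le> C * hnorm (fock m F) u"
    "\<And>u f. u \<in> carrier (fock m F) \<Longrightarrow> f \<in> U \<Longrightarrow> ip (fock m H) f (L u) = ip (fock m F) (V f) u" by metis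
  have "bounded_operator (fock m F) (fock m H) L"
  proof (rule bounded_operatorI[OF F.inner_product_space_fock H.inner_product_space_fock L(1) _ _ L(2)])
    fix u v a assume u: "u \<in> carrier (fock m F)"
    show "L (u \<oplus>\<^bsub>fock m F\<^esub> v) = L u \<oplus>\<^bsub>fock m H\<^esub> L v" if v: "v \<in> carrier (fock m F)"
      using u v L(1,3) Uc Vc(1) by (intro separate) (simp_all add: B.ip_add_r FF.ip_add_r)
    show "L (a \<odot>\<^bsub>fock m F\<^esub> u) = a \<odot>\<^bsub>fock m H\<^esub> L u"
      using u L(1,3) Uc Vc(1) by (intro separate) (simp_all add: B.ip_smult_r FF.ip_smult_r)
  qed
  moreover have "L (creation F i u) = creation H i (L u)" if i: "i < m" and u: "u \<in> carrier (fock m F)" for i u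
  proof (rule separate)
    have c: "creation F i u \<in> carrier (fock m F)" using F.creation_closed[OF u i] .
    show "L (creation F i u) \<in> carrier (fock m H)" using L(1)[OF c] .
    show "creation H i (L u) \<in> carrier (fock m H)" using H.creation_closed[OF L(1)[OF u] i] .
    fix f assume f: "f \<in> U"
    have "ip (fock m H) f (L (creation F i u)) = ip (fock m F) (V f) (creation F i u)" using L(3)[OF c f] .
    also have "\<dots> = ip (fock m F) (V (bshift i f)) u"
      using F.ip_bshift[OF Vc(1)[OF f] u i] Vc(3)[OF f i] by simp
    also have "\<dots> = ip (fock m H) (bshift i f) (L u)" using L(3)[OF u] Vc(3)[OF f i] by simp
    also have "\<dots> = ip (fock m H) f (creation H i (L u))" using H.ip_bshift[OF Uc[OF f] L(1)[OF u] i] .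
    finally show "ip (fock m H) f (L (creation F i u)) = ip (fock m H) f (creation H i (L u))" .
  qed
  ultimately have "multi_analytic m F H L"
    unfolding multi_analytic_def fock_simps(6) by (auto simp: bounded_operator.bounded)
  moreover have "ip (fock m H) g (L u) = ip (fock m F) (W g) u"
    if g: "g \<in> G" and u: "u \<in> carrier (fock m F)" for g u
  proof -
    have "g \<in> U" using g Gn0 by (auto simp: U_def)
    thus ?thesis using L(3)[OF u] V[of g 0] g Gn0 Wn(2) by simp
  qed
  ultimately show ?thesis by blast
qed

section \<open>Split multi-analytic operators\<close>

locale injective_multi_analytic = E: hilbert_space E + Es: hilbert_space Es
  for m :: nat and E :: "('a, 'y) hilbert_scheme" and Es :: "('b, 'z) hilbert_scheme" +
  fixes \<Theta> :: "(nat list \<Rightarrow> 'a) \<Rightarrow> nat list \<Rightarrow> 'b"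
  assumes multi_analytic: "multi_analytic m E Es \<Theta>"
    and inj: "\<And>f. f \<in> carrier (fock m E) \<Longrightarrow> \<Theta> f = \<zero>\<^bsub>fock m Es\<^esub> \<Longrightarrow> f = \<zero>\<^bsub>fock m E\<^esub>"
    and closed_range: "closed_in (fock m Es) (\<Theta> ` carrier (fock m E))"
begin

sublocale A: hilbert_space "fock m E" by (rule E.hilbert_space_fock)

sublocale B: hilbert_space "fock m Es" by (rule Es.hilbert_space_fock)

sublocale T: multi_analytic_operator m E Es \<Theta>
  by unfold_locales (rule multi_analytic)

abbreviation R :: "(nat list \<Rightarrow> 'b) set" where "R \<equiv> \<Theta> ` carrier (fock m E)"

lemma seq_closed_range: "B.seq_closed R"
  using closed_range B.closed_in_iff by blast

sublocale Q: quotient_space "fock m Es" R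
  by (intro quotient_space.intro quotient_space_axioms.intro B.inner_product_space_axioms T.subspace_range)

lemma range_invariant: "\<lbrakk>n \<in> R; i < m\<rbrakk> \<Longrightarrow> creation Es i n \<in> R"
  using E.creation_closed by (auto simp flip: T.creation)

lemma quotient_act:
  assumes "f \<in> carrier (fock m Es)" "i < m"
  shows "act (quotient_module m E Es \<Theta>) i (Q.coset f) = Q.coset (creation Es i f)"
  unfolding quotient_module_def fock_simps(6)[of m Es, symmetric]
proof (rule Q.coset_act)
  interpret S: bounded_operator "fock m Es" "fock m Es" "creation Es i"
    by (rule Es.bounded_operator_creation[OF assms(2)])
  show "act (fock m Es) i n \<in> R" if "n \<in> R" for n
    using range_invariant[OF that assms(2)] by (simp add: fock_simps(6))
  show "act (fock m Es) i (x \<oplus>\<^bsub>fock m Es\<^esub> y) = act (fock m Es) i x \<oplus>\<^bsub>fock m Es\<^esub> act (fock m Es) i y"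
    if "x \<in> carrier (fock m Es)" "y \<in> carrier (fock m Es)" for x y
    using S.add[OF that] by (simp add: fock_simps(6))
  show "act (fock m Es) i x \<in> carrier (fock m Es)" if "x \<in> carrier (fock m Es)" for x
    using S.closed[OF that] by (simp add: fock_simps(6))
qed (rule assms(1))

lemma injective: "\<lbrakk>f \<in> carrier (fock m E); g \<in> carrier (fock m E); \<Theta> f = \<Theta> g\<rbrakk> \<Longrightarrow> f = g"
  using inj[of "f \<ominus>\<^bsub>fock m E\<^esub> g"] T.minus[of f g] B.eq_iff_minus[of "\<Theta> f" "\<Theta> g"] A.eq_iff_minus[of f g] by simp

text \<open>
  The idempotent \<open>q = I - \<Theta>\<Psi>\<close> has kernel \<open>R\<close> and range \<open>N\<close>, the kernel of \<open>\<Theta>\<Psi>\<close>.  So it induces a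
  similarity of the quotient with \<open>N\<close>, and the Wold decomposition identifies \<open>N\<close> with the Fock module
  over a subspace of the given Fock module.
\<close>
lemma similar_if_split:
  assumes \<Psi>: "multi_analytic m Es E \<Psi>" and split: "\<And>f. f \<in> carrier (fock m E) \<Longrightarrow> \<Theta> (\<Psi> (\<Theta> f)) = \<Theta> f"
  shows "\<exists>F :: (nat list \<Rightarrow> 'b) hilbert. hilbert_space F \<and> similar m (quotient_module m E Es \<Theta>) (fock m F)"
proof -
  interpret P: multi_analytic_operator m Es E \<Psi> by unfold_locales (rule \<Psi>)
  define P where "P f = \<Theta> (\<Psi> f)" for f
  have "bounded_op (fock m Es) (fock m Es) P"
    unfolding P_def by (rule bounded_op_comp[OF P.bounded T.bounded A.hnorm_ge0])
  moreover have "P (creation Es i f) = creation Es i (P f)" if "i < m" "f \<in> carrier (fock m Es)" for i f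
    unfolding P_def using that T.creation P.creation P.closed by simp
  ultimately have "multi_analytic m Es Es P" by (simp add: multi_analytic_def fock_simps(6))
  then interpret K: multi_analytic_kernel m Es Es P by unfold_locales
  let ?W = K.wandering
  interpret FW: inner_product_space "fock m ?W" by (rule K.W.inner_product_space_fock)
  have PP: "P (P f) = P f" if "f \<in> carrier (fock m Es)" for f
    unfolding P_def using split P.closed[OF that] by simp
  define q where "q f = f \<ominus>\<^bsub>fock m Es\<^esub> P f" for f
  have q_in: "q f \<in> K.N" if f: "f \<in> carrier (fock m Es)" for f
    using f K.P.closed[OF f] K.P.closed[OF K.P.closed[OF f]] by (simp add: q_def K.P.minus PP B.eq_iff_minus)
  obtain C where C: "C > 0" "\<And>f. f \<in> carrier (fock m Es) \<Longrightarrow> hnorm (fock m Es) (P f) \<le> C * hnorm (fock m Es) f"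
    using K.P.bound_ex by blast
  have q_add: "q (f \<oplus>\<^bsub>fock m Es\<^esub> g) = q f \<oplus>\<^bsub>fock m Es\<^esub> q g"
    if "f \<in> carrier (fock m Es)" "g \<in> carrier (fock m Es)" for f g
    unfolding q_def K.P.add[OF that] using that K.P.closed by (intro B.eqI_ip) (auto simp: B.ip_linear)
  have q_smult: "q (a \<odot>\<^bsub>fock m Es\<^esub> f) = a \<odot>\<^bsub>fock m Es\<^esub> q f" if "f \<in> carrier (fock m Es)" for f a
    unfolding q_def K.P.smult[OF that] using that K.P.closed by (intro B.eqI_ip) (auto simp: B.ip_linear algebra_simps)
  have q_norm: "hnorm (fock m Es) (q f) \<le> (1 + C) * hnorm (fock m Es) f" if f: "f \<in> carrier (fock m Es)" for f
    using B.hnorm_triangle[OF f, of "(-1) \<odot>\<^bsub>fock m Es\<^esub> P f"] C(2)[OF f] f K.P.closed[OF f]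
    by (simp add: q_def B.minus_eq B.hnorm_smult distrib_right)
  have q_N: "q f = f" if "f \<in> K.N" for f
    using that by (simp add: q_def B.minus_eq)
  have q_R: "q n = \<zero>\<^bsub>fock m Es\<^esub>" if n: "n \<in> R" for n
  proof -
    have "P n = n" using n split by (auto simp: P_def)
    thus ?thesis using Q.N_D(1)[OF n] by (simp add: q_def B.eq_iff_minus)
  qed
  have T_bo: "bounded_operator (fock m Es) (fock m ?W) (\<lambda>f. K.analyse (q f))"
  proof (rule bounded_operatorI[where C = "1 + C", OF Es.inner_product_space_fock K.W.inner_product_space_fock])
    fix f g and a :: complex assume f: "f \<in> carrier (fock m Es)"
    show "K.analyse (q f) \<in> carrier (fock m ?W)" using K.analyse_closed(1)[OF q_in[OF f]] .
    show "K.analyse (q (f \<oplus>\<^bsub>fock m Es\<^esub> g)) = K.analyse (q f) \<oplus>\<^bsub>fock m ?W\<^esub> K.analyse (q g)"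
      if g: "g \<in> carrier (fock m Es)"
      using q_in[OF f] q_in[OF g] K.analyse_linear(1)[of "q f" "q g"] by (simp add: q_add[OF f g])
    show "K.analyse (q (a \<odot>\<^bsub>fock m Es\<^esub> f)) = a \<odot>\<^bsub>fock m ?W\<^esub> K.analyse (q f)"
      using q_in[OF f] K.analyse_linear(2)[of "q f" a] by (simp add: q_smult[OF f])
    show "hnorm (fock m ?W) (K.analyse (q f)) \<le> (1 + C) * hnorm (fock m Es) f"
      using K.analyse_closed(2)[OF q_in[OF f]] q_norm[OF f] by linarith
  qed
  have T_R: "K.analyse (q n) = \<zero>\<^bsub>fock m ?W\<^esub>" if "n \<in> R" for n
    using q_R[OF that] K.analyse_zero by simp
  obtain X where X: "bounded_op (quot (fock m Es) R) (fock m ?W) X"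
    "\<And>f. f \<in> carrier (fock m Es) \<Longrightarrow> X (Q.coset f) = K.analyse (q f)"
    using Q.factor_through_quotient[OF T_bo T_R] by blast
  have S: "bounded_op (fock m ?W) (fock m Es) K.synth"
    unfolding bounded_op_def
  proof (intro conjI)
    show "\<exists>C. \<forall>x\<in>carrier (fock m ?W). hnorm (fock m Es) (K.synth x) \<le> C * hnorm (fock m ?W) x"
      using K.synth_closed(2) by (intro exI[of _ 1]) simp
  qed (use K.synth_closed(1) K.synth_linear in auto)
  define Y where "Y x = Q.coset (K.synth x)" for x
  have Y: "bounded_op (fock m ?W) (quot (fock m Es) R) Y"
    unfolding Y_def by (rule bounded_op_comp[OF S Q.bounded_op_coset B.hnorm_ge0])
  have YX: "Y (X Z) = Z" if Z: "Z \<in> carrier (quot (fock m Es) R)" for Z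
  proof -
    obtain f where f: "f \<in> carrier (fock m Es)" "Z = Q.coset f" using Z by (auto simp: Q.carrier_quot)
    have qc: "q f \<in> carrier (fock m Es)" using q_in[OF f(1)] by simp
    have "q f \<ominus>\<^bsub>fock m Es\<^esub> f = (-1) \<odot>\<^bsub>fock m Es\<^esub> P f"
      unfolding q_def using f(1) K.P.closed[OF f(1)] by (intro B.eqI_ip) (auto simp: B.ip_linear)
    moreover have "P f \<in> R" unfolding P_def using P.closed[OF f(1)] by simp
    ultimately have "q f \<ominus>\<^bsub>fock m Es\<^esub> f \<in> R" using Q.N_D(4) by simp
    hence "Q.coset (q f) = Q.coset f" by (rule Q.coset_eqI[OF qc f(1)])
    thus ?thesis by (simp add: f X(2) Y_def K.synth_analyse[OF q_in])
  qed
  have XY: "X (Y x) = x" if x: "x \<in> carrier (fock m ?W)" for x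
    using K.synth_closed(1)[OF x] by (simp add: Y_def X(2) q_N K.analyse_synth[OF x])
  have act: "X (act (quot (fock m Es) R) i Z) = act (fock m ?W) i (X Z)"
    if i: "i < m" and Z: "Z \<in> carrier (quot (fock m Es) R)" for i Z
  proof -
    obtain f where f: "f \<in> carrier (fock m Es)" "Z = Q.coset f" using Z by (auto simp: Q.carrier_quot)
    interpret S: bounded_operator "fock m Es" "fock m Es" "creation Es i" by (rule Es.bounded_operator_creation[OF i])
    have "q (creation Es i f) = creation Es i (q f)"
      unfolding q_def using f(1) i K.P.closed[OF f(1)] by (simp add: K.P.creation S.minus)
    thus ?thesis using quotient_act[OF f(1) i] f S.closed[OF f(1)] K.analyse_creation[OF q_in[OF f(1)] i]
      by (simp add: quotient_module_def X(2) fock_simps(6)[of m ?W])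
  qed
  have "similar m (quotient_module m E Es \<Theta>) (fock m ?W)"
    unfolding similar_def quotient_module_def using X(1) Y YX XY act by blast
  thus ?thesis using K.hilbert_space_wandering by blast
qed

text \<open>
  In the proof, \<open>J\<close> picks the representative of a coset that is orthogonal to \<open>R\<close>.  The operator
  \<open>y = J \<circ> Y\<close> is a lift of \<open>Y\<close>, but it commutes with the variables only modulo \<open>R\<close>.  Its adjoint,
  restricted to the orthogonal complement \<open>G\<close> of \<open>R\<close>, does not see the difference and intertwines the
  backward shifts; the adjoint \<open>L\<close> of an extension of this intertwiner is a lift that commutes with the
  variables.
\<close>
lemma split_if_similar:
  fixes F :: "'f hilbert"
  assumes "hilbert_space F" and sim: "similar m (quotient_module m E Es \<Theta>) (fock m F)"
  shows "\<exists>\<Psi>. multi_analytic m Es E \<Psi> \<and> (\<forall>f\<in>carrier (fock m E). \<Theta> (\<Psi> (\<Theta> f)) = \<Theta> f)"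
proof -
  interpret F: hilbert_space F by fact
  interpret FF: hilbert_space "fock m F" by (rule F.hilbert_space_fock)
  let ?Q = "quot (fock m Es) R"
  obtain X Y where "bounded_op ?Q (fock m F) X \<and> bounded_op (fock m F) ?Q Y \<and>
      (\<forall>Z\<in>carrier ?Q. Y (X Z) = Z) \<and> (\<forall>u\<in>carrier (fock m F). X (Y u) = u) \<and>
      (\<forall>i<m. \<forall>Z\<in>carrier ?Q. X (act ?Q i Z) = act (fock m F) i (X Z))"
    using sim unfolding similar_def quotient_module_def by (elim exE)
  hence X: "bounded_op ?Q (fock m F) X" and Y: "bounded_op (fock m F) ?Q Y"
    and YX: "\<And>Z. Z \<in> carrier ?Q \<Longrightarrow> Y (X Z) = Z" and XY: "\<And>u. u \<in> carrier (fock m F) \<Longrightarrow> X (Y u) = u"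
    and act: "\<And>i Z. i < m \<Longrightarrow> Z \<in> carrier ?Q \<Longrightarrow> X (act ?Q i Z) = creation F i (X Z)"
    by (simp_all add: fock_simps(6)[of m F])
  have Xc: "X Z \<in> carrier (fock m F)" if "Z \<in> carrier ?Q" for Z using X that unfolding bounded_op_def by auto
  have Yc: "Y u \<in> carrier ?Q" if "u \<in> carrier (fock m F)" for u using Y that unfolding bounded_op_def by auto
  note cl = Q.N seq_closed_range
  define G where "G = {x \<in> carrier (fock m Es). \<forall>h\<in>R. ip (fock m Es) h x = 0}"
  interpret D: bounded_operator "fock m Es" "fock m Es" "\<lambda>f. f \<ominus>\<^bsub>fock m Es\<^esub> B.proj R f"
    by (rule B.bounded_operator_minus_proj[OF cl])
  have projR: "f \<ominus>\<^bsub>fock m Es\<^esub> B.proj R f = \<zero>\<^bsub>fock m Es\<^esub>" if f: "f \<in> R" for f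
  proof -
    have "B.proj R f = f" using f Q.N_D(1) by (intro B.proj_unique[OF cl]) auto
    thus ?thesis using Q.N_D(1)[OF f] by (simp add: B.eq_iff_minus)
  qed
  \<comment> \<open>the orthogonal representative depends only on the coset, since \<open>R\<close> projects onto itself\<close>
  obtain J where J: "bounded_op ?Q (fock m Es) J"
    "\<And>f. f \<in> carrier (fock m Es) \<Longrightarrow> J (Q.coset f) = f \<ominus>\<^bsub>fock m Es\<^esub> B.proj R f"
    using Q.factor_through_quotient[OF D.bounded_operator_axioms projR] by blast
  have J_G: "J Z \<in> G" "Q.coset (J Z) = Z" if Z: "Z \<in> carrier ?Q" for Z
  proof -
    obtain f where f: "f \<in> carrier (fock m Es)" "Z = Q.coset f" using Z by (auto simp: Q.carrier_quot)
    have p: "B.proj R f \<in> R" "B.proj R f \<in> carrier (fock m Es)"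
      using B.proj_in[OF cl f(1)] B.proj_in_carrier[OF cl f(1)] by auto
    show "J Z \<in> G" using f J(2) p B.orthogonal_minus_proj[OF cl f(1)] by (simp add: G_def)
    have "(f \<ominus>\<^bsub>fock m Es\<^esub> B.proj R f) \<ominus>\<^bsub>fock m Es\<^esub> f = (-1) \<odot>\<^bsub>fock m Es\<^esub> B.proj R f"
      using f(1) p by (intro B.eqI_ip) (auto simp: B.ip_linear)
    hence "Q.coset (f \<ominus>\<^bsub>fock m Es\<^esub> B.proj R f) = Q.coset f"
      using f(1) p Q.N_D(4)[OF p(1), of "-1"] by (intro Q.coset_eqI) auto
    thus "Q.coset (J Z) = Z" using f J(2) by simp
  qed
  define y where "y u = J (Y u)" for u
  have Gc: "g \<in> carrier (fock m Es)" if "g \<in> G" for g using that by (simp add: G_def)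
  have y_G: "y u \<in> G" "Q.coset (y u) = Y u" if "u \<in> carrier (fock m F)" for u
    using J_G[OF Yc[OF that]] by (simp_all add: y_def)
  interpret y: bounded_operator "fock m F" "fock m Es" y
    by unfold_locales (unfold y_def, rule bounded_op_comp[OF Y J(1) Q.hnorm_quot_nonneg])
  \<comment> \<open>both vectors represent \<open>Y (S\<^sub>i u)\<close>\<close>
  have y_creation: "y (creation F i u) \<ominus>\<^bsub>fock m Es\<^esub> creation Es i (y u) \<in> R"
    if i: "i < m" and u: "u \<in> carrier (fock m F)" for i u
  proof -
    have c: "creation F i u \<in> carrier (fock m F)" using F.creation_closed[OF u i] .
    have aQ: "act ?Q i (Y u) = Q.coset (creation Es i (y u))"
      using quotient_act[OF y.closed[OF u] i] y_G(2)[OF u] by (simp add: quotient_module_def)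
    have aQc: "act ?Q i (Y u) \<in> carrier ?Q"
      unfolding aQ using Es.creation_closed[OF y.closed[OF u] i] by simp
    have "Y (creation F i u) = Y (X (act ?Q i (Y u)))" using act[OF i Yc[OF u]] XY[OF u] by simp
    also have "\<dots> = act ?Q i (Y u)" using YX[OF aQc] .
    finally have "Q.coset (y (creation F i u)) = Q.coset (creation Es i (y u))"
      using y_G(2)[OF c] aQ by simp
    thus ?thesis
      using Q.coset_eq_iff[OF y.closed[OF c] Es.creation_closed[OF y.closed[OF u] i]] by simp
  qed
  have ex_adj: "\<exists>w. w \<in> carrier (fock m F) \<and> (\<forall>u\<in>carrier (fock m F). ip (fock m Es) (y u) g = ip (fock m F) u w)"
    if "g \<in> carrier (fock m Es)" for g
    using y.adjoint_exists[OF FF.hilbert_space_axioms that] by blast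
  then obtain W where W: "\<And>g. g \<in> carrier (fock m Es) \<Longrightarrow> W g \<in> carrier (fock m F)"
    "\<And>g u. \<lbrakk>g \<in> carrier (fock m Es); u \<in> carrier (fock m F)\<rbrakk> \<Longrightarrow> ip (fock m Es) (y u) g = ip (fock m F) u (W g)" by metis
  have W': "ip (fock m F) (W g) u = ip (fock m Es) g (y u)"
    if "g \<in> carrier (fock m Es)" "u \<in> carrier (fock m F)" for g u
    using W(2)[OF that] FF.ip_cnj[OF that(2) W(1)[OF that(1)]] B.ip_cnj[OF y.closed[OF that(2)] that(1)] by simp
  have G: "subspace_of (fock m Es) G"
    unfolding G_def using Q.N_sub by (rule B.seq_closed_orthogonal)
  obtain C where C: "C > 0" "\<And>u. u \<in> carrier (fock m F) \<Longrightarrow> hnorm (fock m Es) (y u) \<le> C * hnorm (fock m F) u"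
    using y.bound_ex by blast
  have G_orth: "ip (fock m Es) g r = 0" if "g \<in> G" "r \<in> R" for g r
  proof -
    have "ip (fock m Es) r g = 0" using that unfolding G_def by blast
    thus ?thesis using B.ip_cnj[of r g] Q.N_D(1)[OF that(2)] Gc[OF that(1)] by simp
  qed
  have G_inv: "bshift i g \<in> G" if g: "g \<in> G" and i: "i < m" for g i
  proof -
    have b: "bshift i g \<in> carrier (fock m Es)" using Es.bshift_closed[OF Gc[OF g] i] .
    have "ip (fock m Es) r (bshift i g) = 0" if r: "r \<in> R" for r
    proof -
      have "ip (fock m Es) (bshift i g) r = 0"
        using Es.ip_bshift[OF Gc[OF g] Q.N_D(1)[OF r] i] G_orth[OF g range_invariant[OF r i]] by simp
      thus ?thesis using B.ip_cnj[OF b Q.N_D(1)[OF r]] by simp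
    qed
    thus ?thesis using b unfolding G_def by blast
  qed
  have "backward_intertwiner m Es F C G W" unfolding backward_intertwiner_def
  proof (intro conjI ballI allI impI G)
    fix g h i and a :: complex assume g: "g \<in> G"
    note gc = Gc[OF g]
    show "W g \<in> carrier (fock m F)" using W(1)[OF gc] .
    show "W (g \<oplus>\<^bsub>fock m Es\<^esub> h) = W g \<oplus>\<^bsub>fock m F\<^esub> W h" if h: "h \<in> G"
      using gc Gc[OF h] W y.closed
      by (intro FF.eqI_ip) (simp_all add: FF.ip_add_r B.ip_add_r flip: W(2))
    show "W (a \<odot>\<^bsub>fock m Es\<^esub> g) = a \<odot>\<^bsub>fock m F\<^esub> W g"
      using gc W y.closed
      by (intro FF.eqI_ip) (simp_all add: FF.ip_smult_r B.ip_smult_r flip: W(2))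
    show "hnorm (fock m F) (W g) \<le> C * hnorm (fock m Es) g"
    proof -
      have "(hnorm (fock m F) (W g))\<^sup>2 = Re (ip (fock m Es) g (y (W g)))"
        using W'[OF gc W(1)[OF gc]] W(1)[OF gc] by (simp add: FF.hnorm_sq)
      also have "\<dots> \<le> hnorm (fock m Es) g * hnorm (fock m Es) (y (W g))"
        using B.cauchy_schwarz[OF gc y.closed[OF W(1)[OF gc]]] complex_Re_le_cmod order_trans by blast
      also have "\<dots> \<le> hnorm (fock m Es) g * (C * hnorm (fock m F) (W g))"
        using C(2)[OF W(1)[OF gc]] B.hnorm_ge0[OF gc] by (rule mult_left_mono)
      finally have le: "hnorm (fock m F) (W g) * hnorm (fock m F) (W g)
          \<le> (C * hnorm (fock m Es) g) * hnorm (fock m F) (W g)" by (simp add: power2_eq_square mult_ac)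
      show ?thesis
      proof (cases "hnorm (fock m F) (W g) = 0")
        case True thus ?thesis using C(1) B.hnorm_ge0[OF gc] by simp
      next
        case False
        hence "hnorm (fock m F) (W g) > 0" using FF.hnorm_ge0[OF W(1)[OF gc]] by simp
        thus ?thesis using le by (meson mult_right_le_imp_le)
      qed
    qed
    assume i: "i < m"
    show "bshift i g \<in> G" by (rule G_inv[OF g i])
    show "bshift i (W g) = W (bshift i g)"
    proof (rule FF.eqI_ip)
      note bc = Es.bshift_closed[OF gc i]
      show "bshift i (W g) \<in> carrier (fock m F)" using F.bshift_closed[OF W(1)[OF gc] i] .
      show "W (bshift i g) \<in> carrier (fock m F)" using W(1)[OF bc] .
      fix u assume u: "u \<in> carrier (fock m F)"
      have c: "creation F i u \<in> carrier (fock m F)" using F.creation_closed[OF u i] .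
      have c': "creation Es i (y u) \<in> carrier (fock m Es)" using Es.creation_closed[OF y.closed[OF u] i] .
      have "ip (fock m F) (bshift i (W g)) u = ip (fock m F) (W g) (creation F i u)"
        by (rule F.ip_bshift[OF W(1)[OF gc] u i])
      also have "\<dots> = ip (fock m Es) g (y (creation F i u))" by (rule W'[OF gc c])
      also have "\<dots> = ip (fock m Es) g (creation Es i (y u))"
        using G_orth[OF g y_creation[OF i u]] gc c' y.closed[OF c] by (simp add: B.ip_minus_r)
      also have "\<dots> = ip (fock m Es) (bshift i g) (y u)" using Es.ip_bshift[OF gc y.closed[OF u] i] by simp
      also have "\<dots> = ip (fock m F) (W (bshift i g)) u" using W'[OF bc u] by simp
      finally show "ip (fock m F) u (bshift i (W g)) = ip (fock m F) u (W (bshift i g))"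
        using FF.ip_cnj[OF F.bshift_closed[OF W(1)[OF gc] i] u] FF.ip_cnj[OF W(1)[OF bc] u] by simp
    qed
  qed
  from backward_intertwiner_adjoint[OF Es.hilbert_space_axioms F.hilbert_space_axioms _ this] C(1)
  obtain L where L: "multi_analytic m F Es L"
    "\<And>g u. \<lbrakk>g \<in> G; u \<in> carrier (fock m F)\<rbrakk> \<Longrightarrow> ip (fock m Es) g (L u) = ip (fock m F) (W g) u"
    by (meson less_imp_le)
  interpret L: multi_analytic_operator m F Es L by unfold_locales (rule L(1))
  have L_coset: "Q.coset (L u) = Y u" if u: "u \<in> carrier (fock m F)" for u
  proof -
    have d: "L u \<ominus>\<^bsub>fock m Es\<^esub> y u \<in> carrier (fock m Es)" using u L.closed y.closed by simp
    have "L u \<ominus>\<^bsub>fock m Es\<^esub> y u \<in> R"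
    proof (rule B.in_subspace_if_orthogonal_complement[OF cl d])
      fix g assume g: "g \<in> carrier (fock m Es)" and orth: "\<And>h. h \<in> R \<Longrightarrow> ip (fock m Es) h g = 0"
      have gG: "g \<in> G" using g orth unfolding G_def by blast
      have "ip (fock m Es) g (L u \<ominus>\<^bsub>fock m Es\<^esub> y u) = 0"
        using L(2)[OF gG u] W'[OF g u] g L.closed[OF u] y.closed[OF u] by (simp add: B.ip_minus_r)
      thus "ip (fock m Es) (L u \<ominus>\<^bsub>fock m Es\<^esub> y u) g = 0" using B.ip_cnj[OF g d] by simp
    qed
    hence "Q.coset (L u) = Q.coset (y u)" using L.closed[OF u] y.closed[OF u] by (intro Q.coset_eqI)
    thus ?thesis using y_G(2)[OF u] by simp
  qed
  define p where "p f = L (X (Q.coset f))" for f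
  have Xq: "X (Q.coset f) \<in> carrier (fock m F)" if "f \<in> carrier (fock m Es)" for f
    using Xc[OF Q.coset_closed[OF that]] .
  have Xq_bo: "bounded_op (fock m Es) (fock m F) (\<lambda>f. X (Q.coset f))"
    by (rule bounded_op_comp[OF Q.bounded_op_coset X Q.hnorm_quot_nonneg])
  have p_bo: "bounded_op (fock m Es) (fock m Es) p"
    unfolding p_def by (rule bounded_op_comp[OF Xq_bo L.bounded FF.hnorm_ge0])
  interpret p: bounded_operator "fock m Es" "fock m Es" p by unfold_locales (rule p_bo)
  have p_creation: "p (creation Es i f) = creation Es i (p f)" if "i < m" "f \<in> carrier (fock m Es)" for i f
  proof -
    have "X (Q.coset (creation Es i f)) = creation F i (X (Q.coset f))"
      using quotient_act[OF that(2,1)] act[OF that(1) Q.coset_closed[OF that(2)]] by (simp add: quotient_module_def)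
    thus ?thesis unfolding p_def using L.creation[OF that(1) Xq[OF that(2)]] by simp
  qed
  have p_R: "p n = \<zero>\<^bsub>fock m Es\<^esub>" if n: "n \<in> R" for n
  proof -
    have nc: "n \<in> carrier (fock m Es)" using Q.N_D(1)[OF n] .
    have "n \<ominus>\<^bsub>fock m Es\<^esub> \<zero>\<^bsub>fock m Es\<^esub> \<in> R" using n nc by (simp add: B.minus_eq)
    hence "Q.coset n = Q.coset \<zero>\<^bsub>fock m Es\<^esub>" using nc by (intro Q.coset_eqI) auto
    hence "p n = p \<zero>\<^bsub>fock m Es\<^esub>" by (simp add: p_def)
    thus ?thesis using p.zero by simp
  qed
  \<comment> \<open>\<open>p f\<close> represents the same coset as \<open>f\<close>, since \<open>L\<close> lifts \<open>Y\<close> and \<open>Y\<close> is inverse to \<open>X\<close>\<close>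
  have rest: "f \<ominus>\<^bsub>fock m Es\<^esub> p f \<in> R" if f: "f \<in> carrier (fock m Es)" for f
  proof -
    have "Q.coset (p f) = Q.coset f"
      unfolding p_def using L_coset[OF Xq[OF f]] YX[OF Q.coset_closed[OF f]] by simp
    thus ?thesis using Q.coset_eq_iff[OF f p.closed[OF f]] by simp
  qed
  define \<Psi> where "\<Psi> f = (SOME g. g \<in> carrier (fock m E) \<and> \<Theta> g = f \<ominus>\<^bsub>fock m Es\<^esub> p f)" for f
  have \<Psi>: "\<Psi> f \<in> carrier (fock m E)" "\<Theta> (\<Psi> f) = f \<ominus>\<^bsub>fock m Es\<^esub> p f" if f: "f \<in> carrier (fock m Es)" for f
  proof -
    have "\<exists>g. g \<in> carrier (fock m E) \<and> \<Theta> g = f \<ominus>\<^bsub>fock m Es\<^esub> p f" using rest[OF f] by force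
    from someI_ex[OF this] show "\<Psi> f \<in> carrier (fock m E)" "\<Theta> (\<Psi> f) = f \<ominus>\<^bsub>fock m Es\<^esub> p f"
      unfolding \<Psi>_def by blast+
  qed
  have \<Psi>_eq: "\<Psi> f = g" if "f \<in> carrier (fock m Es)" "g \<in> carrier (fock m E)" "\<Theta> g = f \<ominus>\<^bsub>fock m Es\<^esub> p f" for f g
    using injective[OF \<Psi>(1)[OF that(1)] that(2)] \<Psi>(2)[OF that(1)] that(3) by simp
  obtain c where c: "\<And>g. g \<in> carrier (fock m E) \<Longrightarrow> hnorm (fock m E) g \<le> c * hnorm (fock m Es) (\<Theta> g)"
    using T.bounded_below[OF A.hilbert_space_axioms B.hilbert_space_axioms inj seq_closed_range] by blast
  obtain d where d: "d > 0" "\<And>f. f \<in> carrier (fock m Es) \<Longrightarrow> hnorm (fock m Es) (p f) \<le> d * hnorm (fock m Es) f"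
    using p.bound_ex by blast
  have "bounded_operator (fock m Es) (fock m E) \<Psi>"
  proof (rule bounded_operatorI[OF Es.inner_product_space_fock E.inner_product_space_fock \<Psi>(1)])
    fix f g and a :: complex assume f: "f \<in> carrier (fock m Es)"
    show "\<Psi> (f \<oplus>\<^bsub>fock m Es\<^esub> g) = \<Psi> f \<oplus>\<^bsub>fock m E\<^esub> \<Psi> g" if g: "g \<in> carrier (fock m Es)"
    proof (rule \<Psi>_eq)
      show "\<Theta> (\<Psi> f \<oplus>\<^bsub>fock m E\<^esub> \<Psi> g) = (f \<oplus>\<^bsub>fock m Es\<^esub> g) \<ominus>\<^bsub>fock m Es\<^esub> p (f \<oplus>\<^bsub>fock m Es\<^esub> g)"
        unfolding T.add[OF \<Psi>(1)[OF f] \<Psi>(1)[OF g]] \<Psi>(2)[OF f] \<Psi>(2)[OF g] p.add[OF f g]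
        using f g p.closed by (intro B.eqI_ip) (auto simp: B.ip_linear)
    qed (use f g \<Psi>(1) in auto)
    show "\<Psi> (a \<odot>\<^bsub>fock m Es\<^esub> f) = a \<odot>\<^bsub>fock m E\<^esub> \<Psi> f"
    proof (rule \<Psi>_eq)
      show "\<Theta> (a \<odot>\<^bsub>fock m E\<^esub> \<Psi> f) = (a \<odot>\<^bsub>fock m Es\<^esub> f) \<ominus>\<^bsub>fock m Es\<^esub> p (a \<odot>\<^bsub>fock m Es\<^esub> f)"
        unfolding T.smult[OF \<Psi>(1)[OF f]] \<Psi>(2)[OF f] p.smult[OF f]
        using f p.closed by (intro B.eqI_ip) (auto simp: B.ip_linear algebra_simps)
    qed (use f \<Psi>(1) in auto)
    have "hnorm (fock m E) (\<Psi> f) \<le> c * hnorm (fock m Es) (f \<ominus>\<^bsub>fock m Es\<^esub> p f)"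
      using c[OF \<Psi>(1)[OF f]] \<Psi>(2)[OF f] by simp
    also have "\<dots> \<le> \<bar>c\<bar> * hnorm (fock m Es) (f \<ominus>\<^bsub>fock m Es\<^esub> p f)"
      using f p.closed[OF f] by (intro mult_right_mono B.hnorm_ge0) auto
    also have "\<dots> \<le> \<bar>c\<bar> * ((1 + d) * hnorm (fock m Es) f)"
      using B.hnorm_triangle[OF f, of "(-1) \<odot>\<^bsub>fock m Es\<^esub> p f"] d(2)[OF f] f p.closed[OF f]
      by (intro mult_left_mono) (auto simp: B.minus_eq B.hnorm_smult distrib_right)
    finally show "hnorm (fock m E) (\<Psi> f) \<le> (\<bar>c\<bar> * (1 + d)) * hnorm (fock m Es) f" by (simp add: mult.assoc)
  qed
  moreover have "\<Psi> (creation Es i f) = creation E i (\<Psi> f)" if i: "i < m" and f: "f \<in> carrier (fock m Es)" for i f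
  proof (rule \<Psi>_eq)
    interpret S: bounded_operator "fock m Es" "fock m Es" "creation Es i" by (rule Es.bounded_operator_creation[OF i])
    show "creation Es i f \<in> carrier (fock m Es)" using S.closed[OF f] .
    show "creation E i (\<Psi> f) \<in> carrier (fock m E)" using E.creation_closed[OF \<Psi>(1)[OF f] i] .
    show "\<Theta> (creation E i (\<Psi> f)) = creation Es i f \<ominus>\<^bsub>fock m Es\<^esub> p (creation Es i f)"
      using T.creation[OF i \<Psi>(1)[OF f]] \<Psi>(2)[OF f] p_creation[OF i f] S.minus[OF f p.closed[OF f]] by simp
  qed
  ultimately have "multi_analytic m Es E \<Psi>"
    unfolding multi_analytic_def fock_simps(6) by (auto simp: bounded_operator.bounded)
  moreover have "\<Theta> (\<Psi> (\<Theta> f)) = \<Theta> f" if f: "f \<in> carrier (fock m E)" for f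
    using \<Psi>(2)[OF T.closed[OF f]] p_R[of "\<Theta> f"] f T.closed[OF f] by (simp add: B.minus_eq)
  ultimately show ?thesis by blast
qed

end

theorem theorem5p3:
  fixes m :: nat
    and E :: "'a hilbert"
    and Es :: "'b hilbert"
    and \<Theta> :: "(nat list \<Rightarrow> 'a) \<Rightarrow> nat list \<Rightarrow> 'b"
  assumes "hilbert_space E"
    and "hilbert_space Es"
    and "multi_analytic m E Es \<Theta>"
    and "a_kernel (fock m E) (fock m Es) \<Theta> = {\<zero>\<^bsub>fock m E\<^esub>}"
    and "closed_in (fock m Es) (\<Theta> ` carrier (fock m E))"
  shows "((\<exists>F :: (nat list \<Rightarrow> 'b) hilbert.
             hilbert_space F \<and> similar m (quotient_module m E Es \<Theta>) (fock m F)) \<longleftrightarrow>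
          (\<exists>\<Psi>. multi_analytic m Es E \<Psi> \<and>
             (\<forall>f\<in>carrier (fock m E). \<Theta> (\<Psi> (\<Theta> f)) = \<Theta> f))) \<and>
         ((\<exists>F :: 'f hilbert.
             hilbert_space F \<and> similar m (quotient_module m E Es \<Theta>) (fock m F)) \<longrightarrow>
          (\<exists>\<Psi>. multi_analytic m Es E \<Psi> \<and>
             (\<forall>f\<in>carrier (fock m E). \<Theta> (\<Psi> (\<Theta> f)) = \<Theta> f)))"
proof -
  interpret injective_multi_analytic m E Es \<Theta>
  proof (intro injective_multi_analytic.intro injective_multi_analytic_axioms.intro assms(1,2,3,5))
    fix f assume "f \<in> carrier (fock m E)" "\<Theta> f = \<zero>\<^bsub>fock m Es\<^esub>"
    hence "f \<in> a_kernel (fock m E) (fock m Es) \<Theta>" by (simp add: a_kernel_def')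
    thus "f = \<zero>\<^bsub>fock m E\<^esub>" using assms(4) by simp
  qed
  show ?thesis
  proof (intro conjI iffI impI)
    assume "\<exists>F :: (nat list \<Rightarrow> 'b) hilbert.
      hilbert_space F \<and> similar m (quotient_module m E Es \<Theta>) (fock m F)"
    thus "\<exists>\<Psi>. multi_analytic m Es E \<Psi> \<and> (\<forall>f\<in>carrier (fock m E). \<Theta> (\<Psi> (\<Theta> f)) = \<Theta> f)"
      using split_if_similar by blast
  next
    assume "\<exists>\<Psi>. multi_analytic m Es E \<Psi> \<and> (\<forall>f\<in>carrier (fock m E). \<Theta> (\<Psi> (\<Theta> f)) = \<Theta> f)"
    thus "\<exists>F :: (nat list \<Rightarrow> 'b) hilbert.
      hilbert_space F \<and> similar m (quotient_module m E Es \<Theta>) (fock m F)"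
      using similar_if_split by blast
  next
    assume "\<exists>F :: 'f hilbert. hilbert_space F \<and> similar m (quotient_module m E Es \<Theta>) (fock m F)"
    thus "\<exists>\<Psi>. multi_analytic m Es E \<Psi> \<and> (\<forall>f\<in>carrier (fock m E). \<Theta> (\<Psi> (\<Theta> f)) = \<Theta> f)"
      using split_if_similar by blast
  qed
qed


end
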